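(* Let $s_1,s_2,s_3\in\mathbb{Z}[i]\setminus\{0\}$ with $s_1+s_2+s_3=0$. (a) If $A\subseteq\mathbb{Z}[i]$ satisfies $\overline{d}(A):=\limsup_{N\to\infty}\frac{|A\cap[-N,N]^2|}{(2N+1)^2}=\delta>0$, then $s_1A+s_2A+s_3A$ contains a Bohr-$(k,\eta)$ set in $\mathbb{Z}[i]$, where $k$ and $\eta$ depend only on $s_1,s_2,s_3$ and $\delta$. (b) If $\mathbb{Z}[i]=\bigcup_{j=1}^r A_j$, then for some $j\in\{1,\ldots,r\}$, $s_1A_j-s_1A_j+s_2A_j$ contains a Bohr-$(k,\eta)$ set in $\mathbb{Z}[i]$, where $k$ and $\eta$ depend only on $s_1,s_2$ and $r$. (c) If $\mathbb{Z}[i]=\bigcup_{j=1}^r A_j$, then there exists $j\in\{1,\ldots,r\}$ such that $A_j-A_j+sA_j$ contains a Bohr set in $\mathbb{Z}[i]$ for every $s\in\mathbb{Z}[i]\setminus\{0\}$.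
   Context: As an additive group, $\mathbb{Z}[i]$ is identified with $\mathbb{Z}^2$ via $a+bi\leftrightarrow(a,b)$; $[-N,N]^2$ denotes $\{a+bi: a,b\in\mathbb{Z}, |a|,|b|\le N\}$. For $c\in\mathbb{Z}[i]$ and $A\subseteq\mathbb{Z}[i]$, $cA=\{ca: a\in A\}$ (ring multiplication); $A\pm B=\{a\pm b\}$. A Bohr-$(k,\eta)$ set in $\mathbb{Z}[i]\cong\mathbb{Z}^2$ is a set $\{(w,v)\in\mathbb{Z}^2: |e(w\alpha_j+v\beta_j)-1|<\eta,\ j=1,\ldots,k\}$ with $\alpha_j,\beta_j\in\mathbb{R}$ and $e(x)=e^{2\pi i x}$ (i.e. defined by $k$ characters of $\mathbb{Z}^2$ and radius $\eta$); a Bohr set is a Bohr-$(k,\eta)$ set for some $k,\eta$. *)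

theory Defs
  imports "HOL-Analysis.Analysis" "HOL-Library.Set_Algebras"
begin

text \<open>
  The ring of Gaussian integers is the subset \<open>gauss_ints\<close> of the complex numbers, with the
  identification \<open>w + v i \<leftrightarrow> (w, v)\<close> given by real and imaginary parts. Dilates and sumsets
  are those of \<open>Set_Algebras\<close>: \<open>c *o A\<close> and \<open>A + B\<close>.
\<close>

definition gauss_ints :: "complex set" where
  "gauss_ints = {z. Re z \<in> \<int> \<and> Im z \<in> \<int>}"

definition gauss_box :: "nat \<Rightarrow> complex set" where
  "gauss_box N = {z \<in> gauss_ints. \<bar>Re z\<bar> \<le> real N \<and> \<bar>Im z\<bar> \<le> real N}"

definition upper_density :: "complex set \<Rightarrow> ereal" where
  "upper_density A =
     limsup (\<lambda>N. ereal (real (card (A \<inter> gauss_box N)) / (2 * real N + 1)\<^sup>2))"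

text \<open>On sets, \<open>A - B\<close> denotes the set-theoretic difference, so the difference set \<open>{a - b}\<close>
  needs its own name.\<close>

definition diffset :: "complex set \<Rightarrow> complex set \<Rightarrow> complex set" where
  "diffset A B = {a - b | a b. a \<in> A \<and> b \<in> B}"

definition unit_exp :: "real \<Rightarrow> complex" where
  "unit_exp x = exp (2 * of_real pi * \<i> * of_real x)"

definition is_bohr_set_with :: "nat \<Rightarrow> real \<Rightarrow> complex set \<Rightarrow> bool" where
  "is_bohr_set_with k \<eta> B \<longleftrightarrow>
     (\<exists>\<alpha> \<beta> :: nat \<Rightarrow> real.
        B = {z \<in> gauss_ints. \<forall>j\<in>{1..k}. cmod (unit_exp (Re z * \<alpha> j + Im z * \<beta> j) - 1) < \<eta>})"

text \<open>The radius of a Bohr set has to be positive; otherwise the empty set would be one.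
  The predicate \<open>is_bohr_set_with\<close> does not include this condition.\<close>

definition is_bohr_set :: "complex set \<Rightarrow> bool" where
  "is_bohr_set B \<longleftrightarrow> (\<exists>k. \<exists>\<eta>>0. is_bohr_set_with k \<eta> B)"

end

theory Submission
  imports Defs
begin

text \<open>
  Everything is counted in the finite rings $\mathbb{Z}[i]/(M)$ with $M \equiv 1$ modulo the norms of
  the coefficients, so that the coefficients become units and solutions modulo $M$ inside a box
  of side proportional to $M$ are genuine solutions. The number of solutions of
  $c_1 x + c_2 y + c_3 z = w$ in $A$ changes little when $w$ runs through the Bohr set of the
  large spectrum of $1_A$, so it suffices to bound the number of solutions for $w = 0$ from below.

  If the coefficients sum to zero and $A$ is dense, this is Roth's theorem with a positive
  proportion of solutions: by pigeonholing the energy, $1_A$ splits into a part with large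
  Fourier coefficients, a part that is small in $L^2$ and a part with tiny Fourier coefficients,
  and the count is restricted to differences $d$ along which the first part is almost constant.
  For colourings, a solution of $s_1 x - s_1 y + s_2 z = 0$ has the form $y = x + s_2 d$,
  $z = s_1 d$: in a small Bohr set almost every $d$ is such that $s_2 d$ is a popular difference of
  every colour that is dense enough, and the sparse colours are too sparse to cover that set of $d$.

  The bounds are uniform in $M$; letting the box grow, a limit of the frequencies found for the
  individual boxes defines the required Bohr set.
\<close>

section \<open>Fourier analysis modulo an element of a ring\<close>

text \<open>The part of a function with tiny Fourier coefficients is harmless only on average over
  all \<open>d\<close>, while the useful \<open>d\<close> lie in differences of a Bohr cell whose
  density is exponentially small in the number of frequencies kept. The error has to be far below
  that density, which itself depends on the cut-off. This circularity forces rapidly decreasing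
  cut-offs, and averaging over many scales makes the energy between two neighbouring ones small.

  The quotient sees only the part of a set inside a box. A dense set merely loses a constant factor
  of density, but a colouring no longer covers the quotient. The way out is that lying in a small
  box follows from Bohr conditions at the two frequencies 1 and i. These are added to the
  frequencies of the colours, and the covering is used only for such \<open>d\<close>.

  In (c) one colour must serve infinitely many \<open>s\<close>. The coloured count provides one
  colour for any finite set of multipliers; if all colours failed, one bad multiplier for each of
  the \<open>r\<close> colours would form a finite set contradicting this.\<close>

text \<open>
  \<open>I\<close> represents the quotient by \<open>m\<close>, and a single nondegenerate character \<open>\<psi>\<close> identifies the
  quotient with its dual through \<open>\<xi> \<mapsto> (\<lambda>x. \<psi> (\<xi> * x))\<close>. Under this identification multiplication
  by a ring element is its own adjoint.
\<close>

locale residue_character =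
  fixes I :: "'a::comm_ring_1 set" and m :: 'a and \<psi> :: "'a \<Rightarrow> complex"
  assumes finite_I [simp]: "finite I"
    and ex1_residue: "\<exists>!y. y \<in> I \<and> m dvd (x - y)"
    and psi_add: "\<psi> (x + y) = \<psi> x * \<psi> y"
    and norm_psi [simp]: "cmod (\<psi> x) = 1"
    and psi_modulus: "\<psi> (m * x) = 1"
    and psi_nondegenerate: "\<not> m dvd \<xi> \<Longrightarrow> \<exists>t. \<psi> (\<xi> * t) \<noteq> 1"
begin

lemma I_nonempty [simp]: "I \<noteq> {}"
  using ex1_residue[of 0] by auto

lemma card_I_pos [simp]: "card I > 0"
  by (simp add: card_gt_0_iff)

lemma residue_eq: "x \<in> I \<Longrightarrow> y \<in> I \<Longrightarrow> m dvd (x - y) \<Longrightarrow> x = y"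
  using ex1_residue[of x] by (metis diff_self dvd_0_right)

definition residue :: "'a \<Rightarrow> 'a" where
  "residue x = (THE y. y \<in> I \<and> m dvd (x - y))"

lemma residue_in [simp]: "residue x \<in> I" and residue_dvd: "m dvd (x - residue x)"
  using theI'[OF ex1_residue[of x]] unfolding residue_def by auto

text \<open>Functions on the quotient are kept as functions on the whole ring that are constant on
  residue classes, so that arguments such as \<open>u * x + t\<close> need no reduction.\<close>

definition per :: "('a \<Rightarrow> 'b) \<Rightarrow> bool" where
  "per f \<longleftrightarrow> (\<forall>x y. m dvd (x - y) \<longrightarrow> f x = f y)"

lemma perD: "per f \<Longrightarrow> m dvd (x - y) \<Longrightarrow> f x = f y"
  by (simp add: per_def)

lemma per_residue: "per f \<Longrightarrow> f (residue x) = f x"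
  using perD[OF _ residue_dvd] by metis

lemma per_const [simp]: "per (\<lambda>x. c)"
  by (simp add: per_def)

lemma per_affine: "per f \<Longrightarrow> per (\<lambda>x. f (a * x + b))"
  unfolding per_def
  by (metis add_diff_cancel_right dvd_mult right_diff_distrib)

lemma per_comp: "per f \<Longrightarrow> per (\<lambda>x. F (f x))"
  by (auto simp: per_def)

lemma per_comp2: "per f \<Longrightarrow> per g \<Longrightarrow> per (\<lambda>x. F (f x) (g x))"
  unfolding per_def by metis

lemma per_scaled: "per f \<Longrightarrow> per (\<lambda>x. f (a * x))"
  using per_affine[of f a 0] by simp

lemma per_shift: "per f \<Longrightarrow> per (\<lambda>x. f (x + b))"
  using per_affine[of f 1 b] by simp

lemma per_indicator: "per (\<lambda>x. x \<in> A) \<Longrightarrow> per (indicator A :: 'a \<Rightarrow> 'b::zero_neq_one)"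
  by (simp add: per_def indicator_def)

lemma per_sum: "(\<And>i. i \<in> A \<Longrightarrow> per (f i)) \<Longrightarrow> per (\<lambda>x. \<Sum>i\<in>A. f i x)"
  unfolding per_def by (auto intro!: sum.cong)

lemma psi_0 [simp]: "\<psi> 0 = 1"
  using psi_modulus[of 0] by simp

lemma psi_minus: "\<psi> (- x) = cnj (\<psi> x)"
proof -
  have "\<psi> x * \<psi> (- x) = \<psi> x * cnj (\<psi> x)"
    using psi_add[of x "- x"] by (simp add: complex_norm_square[symmetric])
  moreover have "\<psi> x \<noteq> 0"
    using norm_psi[of x] by force
  ultimately show ?thesis by simp
qed

lemma psi_diff: "\<psi> (x - y) = \<psi> x * cnj (\<psi> y)"
  using psi_add[of x "- y"] by (simp add: psi_minus)

lemma per_psi: "per \<psi>"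
  unfolding per_def
proof safe
  fix x y assume "m dvd (x - y)"
  then obtain k where "x = y + m * k"
    by (metis dvdE add.commute diff_add_cancel)
  then show "\<psi> x = \<psi> y"
    by (simp add: psi_add psi_modulus)
qed

lemma per_psi_mult: "per (\<lambda>x. \<psi> (a * x))" "per (\<lambda>x. \<psi> (x * a))" 
  using per_scaled[OF per_psi, of a] by (simp_all add: mult.commute)

definition unit_mod :: "'a \<Rightarrow> bool" where
  "unit_mod u \<longleftrightarrow> (\<exists>v. m dvd (u * v - 1))"

lemma unit_mod_1 [simp]: "unit_mod 1"
  unfolding unit_mod_def by (rule exI[of _ 1]) simp

lemma unit_mod_minus: "unit_mod u \<Longrightarrow> unit_mod (- u)"
  unfolding unit_mod_def by (metis minus_mult_minus)

lemma unit_mod_cancel: "unit_mod u \<Longrightarrow> m dvd (u * x) \<Longrightarrow> m dvd x"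
proof -
  assume "unit_mod u" "m dvd (u * x)"
  then obtain v where v: "m dvd (u * v - 1)" unfolding unit_mod_def by auto
  have "x = v * (u * x) - (u * v - 1) * x" by (simp add: algebra_simps)
  then show "m dvd x"
    using v \<open>m dvd (u * x)\<close> by (metis dvd_diff dvd_mult dvd_mult2)
qed

text \<open>An affine map with unit slope, followed by reduction, is injective on the finite set
  \<open>I\<close> and hence permutes it. Dilations of variables and of frequencies by the
  coefficients are justified by this.\<close>

lemma sum_affine:
  fixes f :: "'a \<Rightarrow> 'b::comm_monoid_add"
  assumes "per f" "unit_mod u"
  shows "(\<Sum>x\<in>I. f (u * x + t)) = (\<Sum>x\<in>I. f x)"
proof -
  let ?p = "\<lambda>x. residue (u * x + t)"
  have "inj_on ?p I"
  proof (rule inj_onI)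
    fix x y assume xy: "x \<in> I" "y \<in> I" "?p x = ?p y"
    have "m dvd ((u * x + t - ?p x) - (u * y + t - ?p y))"
      using residue_dvd by (blast intro: dvd_diff)
    then have "m dvd (u * (x - y))"
      by (simp add: xy(3) right_diff_distrib)
    then show "x = y"
      using unit_mod_cancel[OF assms(2)] residue_eq xy by blast
  qed
  moreover have "?p ` I \<subseteq> I" by auto
  ultimately have "bij_betw ?p I I"
    by (simp add: bij_betw_def endo_inj_surj)
  from sum.reindex_bij_betw[OF this, of f] show ?thesis
    by (simp add: per_residue[OF assms(1)])
qed

section \<open>Averages over the quotient\<close>

definition avg :: "('a \<Rightarrow> 'b::real_vector) \<Rightarrow> 'b" where
  "avg f = (\<Sum>x\<in>I. f x) /\<^sub>R real (card I)"

lemma avg_const [simp]: "avg (\<lambda>x. c) = c"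
  by (simp add: avg_def sum_constant_scaleR)

lemma avg_add: "avg (\<lambda>x. f x + g x) = avg f + avg g"
  by (simp add: avg_def sum.distrib scaleR_add_right)

lemma avg_diff: "avg (\<lambda>x. f x - g x) = avg f - avg g"
  by (simp add: avg_def sum_subtractf scaleR_diff_right)

lemma avg_sum: "avg (\<lambda>x. \<Sum>i\<in>A. f i x) = (\<Sum>i\<in>A. avg (f i))"
  unfolding avg_def scaleR_sum_right[symmetric] by (subst sum.swap) simp

lemma avg_mult_left: "avg (\<lambda>x. c * f x) = c * avg f" for c :: "'b::real_algebra"
  by (simp add: avg_def sum_distrib_left)

lemma avg_mult_right: "avg (\<lambda>x. f x * c) = avg f * c" for c :: "'b::real_algebra"
  by (simp add: avg_def sum_distrib_right)

lemma avg_swap: "avg (\<lambda>x. avg (\<lambda>y. f x y)) = avg (\<lambda>y. avg (\<lambda>x. f x y))"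
  unfolding avg_def scaleR_sum_right[symmetric] by (subst sum.swap) simp

lemma avg_mono: "(\<And>x. x \<in> I \<Longrightarrow> f x \<le> g x) \<Longrightarrow> avg f \<le> avg g" for f g :: "'a \<Rightarrow> real"
  by (simp add: avg_def sum_mono mult_left_mono)

lemma avg_nonneg: "(\<And>x. x \<in> I \<Longrightarrow> 0 \<le> f x) \<Longrightarrow> 0 \<le> avg f" for f :: "'a \<Rightarrow> real"
  by (simp add: avg_def sum_nonneg)

lemma norm_avg_le: "norm (avg f) \<le> avg (\<lambda>x. norm (f x))" for f :: "'a \<Rightarrow> 'b::real_normed_vector"
  by (simp add: avg_def norm_sum mult_left_mono)

lemma avg_of_real: "avg (\<lambda>x. of_real (f x)) = (of_real (avg f) :: 'b::real_algebra_1)"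
  by (simp add: avg_def scaleR_conv_of_real)

lemma avg_cnj: "cnj (avg f) = avg (\<lambda>x. cnj (f x))"
  by (simp add: avg_def complex_cnj_scaleR)

lemma Re_avg: "Re (avg f) = avg (\<lambda>x. Re (f x))"
  by (simp add: avg_def)

lemma avg_affine: "per f \<Longrightarrow> unit_mod u \<Longrightarrow> avg (\<lambda>x. f (u * x + t)) = avg f"
  by (simp add: avg_def sum_affine)

lemma avg_shift: "per f \<Longrightarrow> avg (\<lambda>x. f (x + t)) = avg f"
  using avg_affine[of f 1 t] by simp

lemma avg_scaled: "per f \<Longrightarrow> unit_mod u \<Longrightarrow> avg (\<lambda>x. f (u * x)) = avg f"
  using avg_affine[of f u 0] by simp

section \<open>Orthogonality and the Fourier transform\<close>

lemma psi_orthogonal: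
  "(\<Sum>x\<in>I. \<psi> (x * \<xi>)) = (if m dvd \<xi> then of_nat (card I) else 0)"
proof (cases "m dvd \<xi>")
  case True
  have "\<psi> (x * \<xi>) = 1" for x
    using perD[OF per_psi, of "x * \<xi>" 0] True by simp
  then show ?thesis using True by simp
next
  case False
  \<comment> \<open>Shifting the summation variable by \<open>t\<close> multiplies the sum by a
    number other than 1, so the sum vanishes.\<close>
  then obtain t where t: "\<psi> (\<xi> * t) \<noteq> 1" using psi_nondegenerate by blast
  have "(\<Sum>x\<in>I. \<psi> (x * \<xi>)) = (\<Sum>x\<in>I. \<psi> ((1 * x + t) * \<xi>))"
    using sum_affine[OF per_psi_mult(2)[of \<xi>] unit_mod_1, of t] by simp
  also have "\<dots> = (\<Sum>x\<in>I. \<psi> (x * \<xi>)) * \<psi> (\<xi> * t)"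
    by (simp add: distrib_right psi_add sum_distrib_right mult.commute[of \<xi> t])
  finally show ?thesis using t False by simp
qed

text \<open>Averages on the physical side and plain sums on the frequency side make inversion and
  Parseval free of constants. Frequencies are ring elements too, so a coefficient \<open>c\<close>
  can dilate them.\<close>

definition ft :: "('a \<Rightarrow> complex) \<Rightarrow> 'a \<Rightarrow> complex" where
  "ft f \<xi> = avg (\<lambda>x. f x * \<psi> (- (\<xi> * x)))"

lemma per_ft: "per (ft f)"
proof -
  have "per (\<lambda>\<xi>. \<psi> (- (\<xi> * x)))" for x
    using per_psi_mult(1)[of "-x"] by (simp add: mult.commute)
  then show ?thesis
    unfolding per_def ft_def avg_def by (auto intro!: sum.cong)
qed

lemma ft_diff: "ft (\<lambda>x. f x - g x) \<xi> = ft f \<xi> - ft g \<xi>"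
  by (simp add: ft_def left_diff_distrib avg_diff)

lemma fourier_inversion:
  assumes "per f"
  shows "f x = (\<Sum>\<xi>\<in>I. ft f \<xi> * \<psi> (\<xi> * x))"
proof -
  have "(\<Sum>\<xi>\<in>I. ft f \<xi> * \<psi> (\<xi> * x)) = (\<Sum>\<xi>\<in>I. avg (\<lambda>y. f y * \<psi> (\<xi> * (x - y))))"
    by (simp add: ft_def avg_mult_right[symmetric] mult.assoc psi_add[symmetric] right_diff_distrib)
  also have "\<dots> = avg (\<lambda>y. f y * (\<Sum>\<xi>\<in>I. \<psi> (\<xi> * (x - y))))"
    by (simp add: avg_sum sum_distrib_left)
  also have "\<dots> = avg (\<lambda>y. if y = residue x then f x * of_nat (card I) else 0)"
    unfolding avg_def psi_orthogonal
  proof (intro arg_cong[of _ _ "scaleR _"] sum.cong refl)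
    fix y assume "y \<in> I"
    then have "m dvd (x - y) \<longleftrightarrow> y = residue x"
      using ex1_residue[of x] residue_in residue_dvd by blast
    then show "f y * (if m dvd x - y then of_nat (card I) else 0)
        = (if y = residue x then f x * of_nat (card I) else 0)"
      using perD[OF assms, of x y] by auto
  qed
  also have "\<dots> = f x"
    by (simp add: avg_def scaleR_conv_of_real)
  finally show ?thesis by simp
qed

lemma parseval:
  assumes "per f"
  shows "(\<Sum>\<xi>\<in>I. ft f \<xi> * cnj (ft g \<xi>)) = avg (\<lambda>x. f x * cnj (g x))"
proof -
  have "avg (\<lambda>x. f x * cnj (g x)) = avg (\<lambda>x. \<Sum>\<xi>\<in>I. ft f \<xi> * (cnj (g x) * \<psi> (\<xi> * x)))"
    by (subst (1) fourier_inversion[OF assms]) (simp add: sum_distrib_left sum_distrib_right mult_ac)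
  also have "\<dots> = (\<Sum>\<xi>\<in>I. ft f \<xi> * avg (\<lambda>x. cnj (g x) * \<psi> (\<xi> * x)))"
    by (simp add: avg_sum avg_mult_left)
  also have "\<dots> = (\<Sum>\<xi>\<in>I. ft f \<xi> * cnj (ft g \<xi>))"
    by (simp add: ft_def avg_cnj psi_minus)
  finally show ?thesis by simp
qed

section \<open>The normalised L2 norm\<close>

definition nrm :: "('a \<Rightarrow> complex) \<Rightarrow> real" where
  "nrm f = sqrt (avg (\<lambda>x. (cmod (f x))\<^sup>2))"

lemma nrm_nonneg [simp]: "nrm f \<ge> 0"
  by (simp add: nrm_def avg_nonneg)

lemma nrm_square: "(nrm f)\<^sup>2 = avg (\<lambda>x. (cmod (f x))\<^sup>2)"
  by (simp add: nrm_def avg_nonneg)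

text \<open>Gives access to the triangle and Cauchy-Schwarz inequalities proved for
  \<open>L2_set\<close>.\<close>

lemma nrm_eq_L2_set: "nrm f = L2_set (\<lambda>x. cmod (f x)) I / sqrt (real (card I))"
  by (simp add: nrm_def avg_def L2_set_def real_sqrt_divide real_sqrt_mult divide_inverse real_sqrt_inverse)

lemma nrm_parseval:
  assumes "per f"
  shows "(\<Sum>\<xi>\<in>I. (cmod (ft f \<xi>))\<^sup>2) = (nrm f)\<^sup>2"
proof -
  have "complex_of_real (\<Sum>\<xi>\<in>I. (cmod (ft f \<xi>))\<^sup>2) = of_real (avg (\<lambda>x. (cmod (f x))\<^sup>2))"
    using parseval[OF assms, of f] 
    by (simp add: complex_norm_square avg_of_real[symmetric] del: of_real_power)
  then show ?thesis unfolding nrm_square using of_real_eq_iff by blast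
qed

lemma nrm_triangle: "nrm (\<lambda>x. f x + g x) \<le> nrm f + nrm g"
proof -
  have "L2_set (\<lambda>x. cmod (f x + g x)) I \<le> L2_set (\<lambda>x. cmod (f x) + cmod (g x)) I"
    by (rule L2_set_mono) (auto simp: norm_triangle_ineq)
  also have "\<dots> \<le> L2_set (\<lambda>x. cmod (f x)) I + L2_set (\<lambda>x. cmod (g x)) I"
    by (rule L2_set_triangle_ineq)
  finally show ?thesis
    unfolding nrm_eq_L2_set add_divide_distrib[symmetric] by (simp add: divide_right_mono)
qed

lemma avg_cauchy_schwarz: "avg (\<lambda>x. cmod (f x) * cmod (g x)) \<le> nrm f * nrm g"
proof -
  have "(\<Sum>x\<in>I. cmod (f x) * cmod (g x)) \<le> L2_set (\<lambda>x. cmod (f x)) I * L2_set (\<lambda>x. cmod (g x)) I"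
    using L2_set_mult_ineq[of "\<lambda>x. cmod (f x)" "\<lambda>x. cmod (g x)" I] by simp
  from mult_left_mono[OF this, of "1 / real (card I)"] show ?thesis
    unfolding nrm_eq_L2_set avg_def times_divide_times_eq real_sqrt_mult_self
    by (simp add: field_simps)
qed

lemma nrm_shift: "per f \<Longrightarrow> nrm (\<lambda>x. f (x + t)) = nrm f"
  using avg_shift[OF per_comp[of f "\<lambda>z. (cmod z)\<^sup>2"]] by (simp add: nrm_def)

lemma nrm_le_1: "(\<And>x. cmod (f x) \<le> 1) \<Longrightarrow> nrm f \<le> 1"
  unfolding nrm_def real_sqrt_le_1_iff
  using avg_mono[of "\<lambda>x. (cmod (f x))\<^sup>2" "\<lambda>x. 1"] by (simp add: power_le_one)

lemma norm_ft_le_nrm: "cmod (ft f \<xi>) \<le> nrm f"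
proof -
  have "cmod (ft f \<xi>) \<le> avg (\<lambda>x. cmod (f x) * cmod (1::complex))"
    using norm_avg_le[of "\<lambda>x. f x * \<psi> (- (\<xi> * x))"] by (simp add: ft_def norm_mult)
  also have "\<dots> \<le> nrm f * nrm (\<lambda>x. 1)" by (rule avg_cauchy_schwarz)
  finally show ?thesis by (simp add: nrm_def)
qed

text \<open>Dilation by a unit only permutes the frequencies, so Cauchy-Schwarz and Parseval apply.
  In a trilinear count this takes care of two Fourier factors, and the third is bounded
  uniformly.\<close>

lemma sum_ft_dilates_le:
  assumes "per g" "per h" "unit_mod u" "unit_mod v"
  shows "(\<Sum>\<zeta>\<in>I. cmod (ft g (u * \<zeta>)) * cmod (ft h (v * \<zeta>))) \<le> nrm g * nrm h"
proof -
  have *: "L2_set (\<lambda>\<zeta>. cmod (ft g (u * \<zeta>))) I = nrm g" if "per g" "unit_mod u" for g u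
  proof -
    have "per (\<lambda>\<zeta>. (cmod (ft g \<zeta>))\<^sup>2)"
      using per_comp[OF per_ft, of "\<lambda>z. (cmod z)\<^sup>2"] by simp
    from sum_affine[OF this that(2), of 0] show ?thesis
      by (simp add: L2_set_def nrm_parseval[OF that(1)])
  qed
  show ?thesis
    using L2_set_mult_ineq[of "\<lambda>\<zeta>. cmod (ft g (u * \<zeta>))" "\<lambda>\<zeta>. cmod (ft h (v * \<zeta>))" I]
    by (simp add: *[OF assms(1,3)] *[OF assms(2,4)])
qed

end

section \<open>Bohr cells, spectra and solution counts\<close>

text \<open>By total boundedness finitely many balls of radius \<open>\<eta>/2\<close> cover the
  circle; \<open>c\<close> records the ball that was chosen for a point.\<close>

lemma unit_circle_arcs:
  assumes "\<eta> > 0"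
  shows "\<exists>q>0. \<exists>c :: complex \<Rightarrow> nat. (\<forall>z. c z < q) \<and>
           (\<forall>z w. cmod z = 1 \<longrightarrow> cmod w = 1 \<longrightarrow> c z = c w \<longrightarrow> cmod (z - w) \<le> \<eta>)"
proof -
  have "compact (sphere (0::complex) 1)" by simp
  note this[unfolded compact_eq_totally_bounded, THEN conjunct2, rule_format, OF half_gt_zero[OF assms]]
  then obtain K :: "complex set" where K: "finite K" "sphere 0 1 \<subseteq> (\<Union>x\<in>K. ball x (\<eta>/2))"
    by (elim exE conjE)
  have "\<forall>z\<in>sphere 0 1. \<exists>x. x \<in> K \<and> z \<in> ball x (\<eta>/2)"
    using K(2) by blast
  then obtain p where p: "\<And>z. z \<in> sphere 0 1 \<Longrightarrow> p z \<in> K \<and> z \<in> ball (p z) (\<eta>/2)"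
    unfolding bchoice_iff by blast
  obtain h :: "complex \<Rightarrow> nat" where h: "bij_betw h K {0..<card K}"
    using K(1) ex_bij_betw_finite_nat by blast
  \<comment> \<open>Off the circle the value is 0, which is admissible because \<open>p 1\<close>
    shows that \<open>K\<close> is nonempty.\<close>
  define c where "c z = (if z \<in> sphere 0 1 then h (p z) else 0)" for z
  have "p 1 \<in> K" using p[of 1] by simp
  then have pos: "card K > 0" using K(1) by (auto simp: card_gt_0_iff)
  moreover have "c z < card K" for z
    using p h pos by (auto simp: c_def bij_betw_def)
  moreover have "cmod (z - w) \<le> \<eta>" if "cmod z = 1" "cmod w = 1" "c z = c w" for z w
  proof -
    have zw: "z \<in> sphere 0 1" "w \<in> sphere 0 1" using that by auto
    then have "p z = p w"
      using that(3) p h by (auto simp: c_def bij_betw_def dest: inj_onD)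
    then have "dist (p z) z < \<eta>/2" "dist (p z) w < \<eta>/2"
      using p[OF zw(1)] p[OF zw(2)] by auto
    then have "dist z w < \<eta>/2 + \<eta>/2" using dist_triangle_less_add by (metis dist_commute)
    then show ?thesis by (simp add: dist_norm)
  qed
  ultimately show ?thesis by blast
qed

text \<open>Choosing the number as a function of \<open>\<eta>\<close> alone keeps all later
  constants independent of the modulus.\<close>

definition arc_count :: "real \<Rightarrow> nat" where
  "arc_count \<eta> = (SOME q. q > 0 \<and> (\<exists>c :: complex \<Rightarrow> nat. (\<forall>z. c z < q) \<and>
     (\<forall>z w. cmod z = 1 \<longrightarrow> cmod w = 1 \<longrightarrow> c z = c w \<longrightarrow> cmod (z - w) \<le> \<eta>)))"

lemma arc_count:
  assumes "\<eta> > 0"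
  shows "arc_count \<eta> > 0"
    and "\<exists>c :: complex \<Rightarrow> nat. (\<forall>z. c z < arc_count \<eta>) \<and>
           (\<forall>z w. cmod z = 1 \<longrightarrow> cmod w = 1 \<longrightarrow> c z = c w \<longrightarrow> cmod (z - w) \<le> \<eta>)"
  using someI_ex[OF unit_circle_arcs[OF assms, unfolded Bex_def]] unfolding arc_count_def
  by blast+

text \<open>
  \<open>cell_density q a b \<epsilon>\<close> is the density of a Bohr cell for \<open>a / \<epsilon>\<^sup>2 + b\<close> frequencies whose unit circles
  are cut into \<open>q\<close> arcs; the spectrum at height \<open>\<epsilon>\<close> has at most \<open>1 / \<epsilon>\<^sup>2\<close> elements. Each level is tiny
  compared with the cell belonging to the spectrum at the level before it.
\<close>

definition cell_density :: "nat \<Rightarrow> real \<Rightarrow> nat \<Rightarrow> real \<Rightarrow> real" where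
  "cell_density q a b \<epsilon> = 1 / real q ^ (nat \<lceil>a / \<epsilon>\<^sup>2\<rceil> + b)"

primrec level :: "nat \<Rightarrow> real \<Rightarrow> nat \<Rightarrow> real \<Rightarrow> real \<Rightarrow> nat \<Rightarrow> real" where
  "level q a b \<kappa> \<epsilon> 0 = \<epsilon>"
| "level q a b \<kappa> \<epsilon> (Suc i) =
     min (level q a b \<kappa> \<epsilon> i) (\<kappa> * (cell_density q a b (level q a b \<kappa> \<epsilon> i))\<^sup>2)"

lemma cell_density_pos: "q > 0 \<Longrightarrow> cell_density q a b \<epsilon> > 0"
  by (simp add: cell_density_def)

lemma cell_density_le_1: "q > 0 \<Longrightarrow> cell_density q a b \<epsilon> \<le> 1"
  by (simp add: cell_density_def)

lemma level_pos: "q > 0 \<Longrightarrow> \<kappa> > 0 \<Longrightarrow> \<epsilon> > 0 \<Longrightarrow> level q a b \<kappa> \<epsilon> i > 0"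
  by (induction i) (auto simp: cell_density_pos[THEN order_less_imp_not_eq2] intro!: mult_pos_pos)

text \<open>The \<open>min\<close> in the recursion ensures this; decreasing levels give nested
  spectra.\<close>

lemma level_antimono: "i \<le> j \<Longrightarrow> level q a b \<kappa> \<epsilon> j \<le> level q a b \<kappa> \<epsilon> i"
  by (induction j rule: dec_induct) (auto simp: min.coboundedI1)

context residue_character
begin

text \<open>Pigeonhole: sorting \<open>x\<close> by the arcs containing all
  \<open>\<psi> (\<xi> * x)\<close> gives at most \<open>arc_count \<eta> ^ n\<close> classes, and
  one class reaches the average density. Differences of two of its points lie in the Bohr set of
  radius \<open>\<eta>\<close>. Working with a cell makes its autocorrelation available as a
  positive definite weight living on such differences.\<close>

lemma bohr_cell:
  assumes "finite \<Xi>" "card \<Xi> \<le> n" "\<eta> > 0"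
  shows "\<exists>C. per (\<lambda>x. x \<in> C) \<and> avg (indicator C) \<ge> 1 / real (arc_count \<eta>) ^ n \<and>
             (\<forall>x\<in>C. \<forall>y\<in>C. \<forall>\<xi>\<in>\<Xi>. cmod (\<psi> (\<xi> * (x - y)) - 1) \<le> \<eta>)"
proof -
  let ?q = "arc_count \<eta>"
  have q: "?q > 0" using arc_count(1) assms(3) .
  obtain c :: "complex \<Rightarrow> nat" where c: "\<And>z. c z < ?q"
      "\<And>z w. cmod z = 1 \<Longrightarrow> cmod w = 1 \<Longrightarrow> c z = c w \<Longrightarrow> cmod (z - w) \<le> \<eta>"
    using arc_count(2)[OF assms(3)] by blast
  define F where "F x = restrict (\<lambda>\<xi>. c (\<psi> (\<xi> * x))) \<Xi>" for x
  define T where "T = PiE \<Xi> (\<lambda>_. {..<?q})"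
  have T: "finite T" "card T = ?q ^ card \<Xi>"
    using assms(1) by (simp_all add: T_def finite_PiE card_PiE)
  have FT: "F x \<in> T" for x using c(1) by (auto simp: F_def T_def)
  have "\<exists>t\<in>T. real (card I) \<le> real (card {x\<in>I. F x = t}) * real ?q ^ n"
  proof (rule ccontr)
    assume "\<not> ?thesis"
    then have less: "\<And>t. t \<in> T \<Longrightarrow> real (card {x\<in>I. F x = t}) * real ?q ^ n < real (card I)"
      by force
    have "card I = (\<Sum>t\<in>T. card {x\<in>I. F x = t})"
      using sum.group[OF finite_I T(1), of F "\<lambda>_. 1::nat"] FT by (simp add: image_subset_iff)
    then have "real (card I) * real ?q ^ n = (\<Sum>t\<in>T. real (card {x\<in>I. F x = t}) * real ?q ^ n)"
      by (simp add: sum_distrib_right)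
    also have "\<dots> < (\<Sum>t\<in>T. real (card I))"
      by (rule sum_strict_mono) (use T FT less in auto)
    also have "\<dots> = real (card I) * real ?q ^ card \<Xi>"
      by (simp add: T)
    also have "\<dots> \<le> real (card I) * real ?q ^ n"
      using assms(2) q by (intro mult_left_mono power_increasing) auto
    finally show False by simp
  qed
  then obtain t where t: "t \<in> T" "real (card I) \<le> real (card {x\<in>I. F x = t}) * real ?q ^ n" by blast
  define C where "C = {x. F x = t}"
  have "per F"
    unfolding per_def F_def by (auto simp: perD[OF per_psi_mult(1)] intro!: restrict_ext)
  then have "per (\<lambda>x. x \<in> C)"
    unfolding C_def mem_Collect_eq by (rule per_comp)
  moreover have "avg (indicator C) \<ge> 1 / real ?q ^ n"
  proof -
    have "(\<Sum>x\<in>I. indicator C x) = real (card {x\<in>I. F x = t})"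
      by (simp add: indicator_def C_def sum.If_cases Int_def)
    then show ?thesis
      using t(2) q by (simp add: avg_def field_simps)
  qed
  moreover have "cmod (\<psi> (\<xi> * (x - y)) - 1) \<le> \<eta>" if "x \<in> C" "y \<in> C" "\<xi> \<in> \<Xi>" for x y \<xi>
  proof -
    have "F x = F y" using that by (simp add: C_def)
    then have "c (\<psi> (\<xi> * x)) = c (\<psi> (\<xi> * y))"
      using that(3) unfolding F_def by (metis restrict_apply')
    then have "cmod (\<psi> (\<xi> * x) - \<psi> (\<xi> * y)) \<le> \<eta>" using c(2) by simp
    moreover have "\<psi> (\<xi> * x) - \<psi> (\<xi> * y) = (\<psi> (\<xi> * (x - y)) - 1) * \<psi> (\<xi> * y)"
      by (simp add: right_diff_distrib left_diff_distrib psi_add[symmetric])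
    ultimately show ?thesis by (simp add: norm_mult)
  qed
  ultimately show ?thesis by blast
qed

section \<open>Trigonometric polynomials and truncations\<close>

text \<open>With \<open>a = ft f\<close> this is the orthogonal projection of \<open>f\<close> to
  the frequencies in \<open>L\<close>. General coefficients are allowed because autocorrelations,
  with coefficients \<open>(cmod (ft f \<xi>))\<^sup>2\<close>, are cut in the same way.\<close>

definition synth :: "('a \<Rightarrow> complex) \<Rightarrow> 'a set \<Rightarrow> 'a \<Rightarrow> complex" where
  "synth a L x = (\<Sum>\<xi>\<in>L. a \<xi> * \<psi> (\<xi> * x))"

lemma per_synth: "per (synth a L)"
  unfolding synth_def
  by (rule per_sum, rule per_comp2[of "\<lambda>_. _"], rule per_const, rule per_psi_mult)

lemma ft_synth:
  assumes "L \<subseteq> I" "\<xi> \<in> I"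
  shows "ft (synth a L) \<xi> = (if \<xi> \<in> L then a \<xi> else 0)"
proof -
  have "ft (synth a L) \<xi> = (\<Sum>\<eta>\<in>L. a \<eta> * avg (\<lambda>x. \<psi> (x * (\<eta> - \<xi>))))"
  proof -
    have "a \<eta> * \<psi> (\<eta> * x) * \<psi> (- (\<xi> * x)) = a \<eta> * \<psi> (x * (\<eta> - \<xi>))" for \<eta> x
      by (simp add: mult.assoc psi_add[symmetric] algebra_simps)
    then show ?thesis
      by (simp only: ft_def synth_def sum_distrib_right avg_sum avg_mult_left)
  qed
  also have "\<dots> = (\<Sum>\<eta>\<in>L. if \<eta> = \<xi> then a \<eta> else 0)"
  proof (rule sum.cong[OF refl])
    fix \<eta> assume "\<eta> \<in> L"
    then have "m dvd (\<eta> - \<xi>) \<longleftrightarrow> \<eta> = \<xi>" using assms residue_eq by auto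
    then show "a \<eta> * avg (\<lambda>x. \<psi> (x * (\<eta> - \<xi>))) = (if \<eta> = \<xi> then a \<eta> else 0)"
      by (simp add: avg_def psi_orthogonal scaleR_conv_of_real)
  qed
  also have "\<dots> = (if \<xi> \<in> L then a \<xi> else 0)"
    using finite_subset[OF assms(1) finite_I] by simp
  finally show ?thesis .
qed

lemma nrm_synth:
  assumes "L \<subseteq> I"
  shows "(nrm (synth a L))\<^sup>2 = (\<Sum>\<xi>\<in>L. (cmod (a \<xi>))\<^sup>2)"
proof -
  have "(nrm (synth a L))\<^sup>2 = (\<Sum>\<xi>\<in>I. if \<xi> \<in> L then (cmod (a \<xi>))\<^sup>2 else 0)"
    unfolding nrm_parseval[OF per_synth, symmetric] by (rule sum.cong) (simp_all add: ft_synth[OF assms])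
  also have "\<dots> = (\<Sum>\<xi>\<in>L. (cmod (a \<xi>))\<^sup>2)"
    using assms by (simp add: sum.If_cases Int_absorb1)
  finally show ?thesis .
qed

lemma synth_diff:
  assumes "L \<subseteq> L'" "L' \<subseteq> I"
  shows "synth a L' x - synth a L x = synth a (L' - L) x"
  unfolding synth_def by (rule sum_diff[symmetric, OF finite_subset[OF assms(2) finite_I] assms(1)])

text \<open>A shift by \<open>d\<close> multiplies the coefficient at \<open>\<xi>\<close> by
  \<open>\<psi> (\<xi> * d)\<close>, so the difference is again a \<open>synth\<close> and Parseval
  compares the two term by term.\<close>

lemma nrm_synth_shift:
  assumes "L \<subseteq> I" "\<And>\<xi>. \<xi> \<in> L \<Longrightarrow> cmod (\<psi> (\<xi> * d) - 1) \<le> \<eta>" "\<eta> \<ge> 0"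
  shows "nrm (\<lambda>x. synth a L (x + d) - synth a L x) \<le> \<eta> * nrm (synth a L)"
proof -
  have "(\<lambda>x. synth a L (x + d) - synth a L x) = synth (\<lambda>\<xi>. a \<xi> * (\<psi> (\<xi> * d) - 1)) L"
    by (rule ext) (simp add: synth_def sum_subtractf[symmetric] psi_add algebra_simps)
  then have "(nrm (\<lambda>x. synth a L (x + d) - synth a L x))\<^sup>2
      = (\<Sum>\<xi>\<in>L. (cmod (a \<xi>))\<^sup>2 * (cmod (\<psi> (\<xi> * d) - 1))\<^sup>2)"
    by (simp add: nrm_synth[OF assms(1)] norm_mult power_mult_distrib)
  also have "\<dots> \<le> (\<Sum>\<xi>\<in>L. (cmod (a \<xi>))\<^sup>2 * \<eta>\<^sup>2)"
    using assms(2) by (intro sum_mono mult_left_mono power_mono) auto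
  also have "\<dots> = (\<eta> * nrm (synth a L))\<^sup>2"
    unfolding sum_distrib_right[symmetric] power_mult_distrib nrm_synth[OF assms(1)] by (rule mult.commute)
  finally show ?thesis
    by (rule power2_le_imp_le) (simp add: assms(3))
qed

text \<open>The inner product of \<open>f\<close> with its own projection is the squared norm of the
  projection.\<close>

lemma avg_mult_cnj_synth:
  assumes "per f" "L \<subseteq> I"
  shows "avg (\<lambda>x. f x * cnj (synth (ft f) L x)) = of_real (\<Sum>\<xi>\<in>L. (cmod (ft f \<xi>))\<^sup>2)"
proof -
  have "avg (\<lambda>x. f x * cnj (synth (ft f) L x)) = (\<Sum>\<xi>\<in>I. if \<xi> \<in> L then of_real ((cmod (ft f \<xi>))\<^sup>2) else 0)"
    unfolding parseval[OF assms(1), symmetric]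
    by (rule sum.cong) (simp_all add: ft_synth[OF assms(2)] complex_norm_square del: of_real_power)
  also have "\<dots> = of_real (\<Sum>\<xi>\<in>L. (cmod (ft f \<xi>))\<^sup>2)"
    using assms(2) by (simp add: sum.If_cases Int_absorb1)
  finally show ?thesis .
qed

section \<open>Large spectra and the pigeonholing of energy\<close>

definition spec :: "('a \<Rightarrow> complex) \<Rightarrow> real \<Rightarrow> 'a set" where
  "spec f \<epsilon> = {\<xi>\<in>I. \<epsilon> \<le> cmod (ft f \<xi>)}"

lemma spec_subset: "spec f \<epsilon> \<subseteq> I" and finite_spec [simp]: "finite (spec f \<epsilon>)"
  by (auto simp: spec_def)

lemma spec_antimono: "\<epsilon> \<le> \<epsilon>' \<Longrightarrow> spec f \<epsilon>' \<subseteq> spec f \<epsilon>"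
  by (auto simp: spec_def)

lemma energy_le_1:
  assumes "per f" "\<And>x. cmod (f x) \<le> 1" "L \<subseteq> I"
  shows "(\<Sum>\<xi>\<in>L. (cmod (ft f \<xi>))\<^sup>2) \<le> 1"
proof -
  have "(\<Sum>\<xi>\<in>L. (cmod (ft f \<xi>))\<^sup>2) \<le> (\<Sum>\<xi>\<in>I. (cmod (ft f \<xi>))\<^sup>2)"
    using assms(3) by (intro sum_mono2) auto
  also have "\<dots> \<le> 1"
    unfolding nrm_parseval[OF assms(1)] using nrm_le_1[of f, OF assms(2)] by (simp add: power_le_one)
  finally show ?thesis .
qed

lemma card_spec_le:
  assumes "per f" "\<And>x. cmod (f x) \<le> 1" "\<epsilon> > 0"
  shows "real (card (spec f \<epsilon>)) \<le> 1 / \<epsilon>\<^sup>2"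
proof -
  have "real (card (spec f \<epsilon>)) * \<epsilon>\<^sup>2 = (\<Sum>\<xi>\<in>spec f \<epsilon>. \<epsilon>\<^sup>2)" by simp
  also have "\<dots> \<le> (\<Sum>\<xi>\<in>spec f \<epsilon>. (cmod (ft f \<xi>))\<^sup>2)"
    using assms(3) by (intro sum_mono power_mono) (auto simp: spec_def)
  also have "\<dots> \<le> 1" using energy_le_1[OF assms(1,2) spec_subset] .
  finally show ?thesis using assms(3) by (simp add: field_simps)
qed

text \<open>For each function the spectral differences between consecutive levels telescope to an
  energy of at most 1, so the \<open>n\<close> scales share a total of at most
  \<open>card J\<close>. Summing over \<open>J\<close> before choosing makes a single scale good for
  all functions simultaneously.\<close>

lemma energy_pigeonhole:
  fixes e :: "nat \<Rightarrow> real"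
  assumes "\<And>j. j \<in> J \<Longrightarrow> per (f j)" "\<And>j x. j \<in> J \<Longrightarrow> cmod (f j x) \<le> 1"
    and "\<And>i. e (Suc i) \<le> e i" "n > 0"
  shows "\<exists>i<n. (\<Sum>j\<in>J. \<Sum>\<xi>\<in>spec (f j) (e (Suc i)) - spec (f j) (e i). (cmod (ft (f j) \<xi>))\<^sup>2)
            \<le> real (card J) / real n"
proof (rule ccontr)
  let ?S = "\<lambda>j i. \<Sum>\<xi>\<in>spec (f j) (e i). (cmod (ft (f j) \<xi>))\<^sup>2"
  let ?M = "\<lambda>j i. \<Sum>\<xi>\<in>spec (f j) (e (Suc i)) - spec (f j) (e i). (cmod (ft (f j) \<xi>))\<^sup>2"
  assume "\<not> ?thesis"
  then have less: "\<And>i. i < n \<Longrightarrow> real (card J) / real n < (\<Sum>j\<in>J. ?M j i)" by force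
  have "real (card J) = (\<Sum>i<n. real (card J) / real n)" using assms(4) by simp
  also have "\<dots> < (\<Sum>i<n. \<Sum>j\<in>J. ?M j i)"
    by (rule sum_strict_mono) (use less assms(4) in auto)
  also have "\<dots> = (\<Sum>j\<in>J. \<Sum>i<n. ?M j i)" by (rule sum.swap)
  also have "\<dots> \<le> (\<Sum>j\<in>J. 1)"
  proof (rule sum_mono)
    fix j assume j: "j \<in> J"
    have "?M j i = ?S j (Suc i) - ?S j i" for i
      using sum_diff[OF finite_spec spec_antimono[OF assms(3)]] .
    then have "(\<Sum>i<n. ?M j i) = ?S j n - ?S j 0"
      using sum_lessThan_telescope[of "?S j" n] by (simp only:)
    also have "\<dots> \<le> 1"
      using energy_le_1[OF assms(1,2)[OF j] spec_subset[of "f j" "e n"]] sum_nonneg[of "spec (f j) (e 0)" "\<lambda>\<xi>. (cmod (ft (f j) \<xi>))\<^sup>2"]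
      by simp
    finally show "(\<Sum>i<n. ?M j i) \<le> 1" .
  qed
  finally show False by simp
qed

text \<open>
  With \<open>k\<close> an inverse of \<open>c\<^sub>3\<close> modulo \<open>m\<close>, the argument of \<open>h\<close> is the solution \<open>z\<close> of
  \<open>c\<^sub>1 * a + c\<^sub>2 * b + c\<^sub>3 * z = w\<close> modulo \<open>m\<close>.
\<close>

definition triple_count :: "'a \<Rightarrow> 'a \<Rightarrow> 'a \<Rightarrow> ('a \<Rightarrow> complex) \<Rightarrow> ('a \<Rightarrow> complex) \<Rightarrow> ('a \<Rightarrow> complex) \<Rightarrow> 'a \<Rightarrow> complex" where
  "triple_count c\<^sub>1 c\<^sub>2 k f g h w = avg (\<lambda>a. avg (\<lambda>b. f a * g b * h (k * (w - c\<^sub>1 * a - c\<^sub>2 * b))))"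

lemma count_fourier:
  assumes "per f" "per g" "per h" "m dvd (c\<^sub>3 * k - 1)"
  shows "triple_count c\<^sub>1 c\<^sub>2 k f g h w
      = (\<Sum>\<zeta>\<in>I. ft f (c\<^sub>1 * \<zeta>) * ft g (c\<^sub>2 * \<zeta>) * ft h (c\<^sub>3 * \<zeta>) * \<psi> (\<zeta> * w))"
proof -
  have unit: "unit_mod c\<^sub>3" using assms(4) unfolding unit_mod_def by blast
  have h: "h (k * z) = (\<Sum>\<zeta>\<in>I. ft h (c\<^sub>3 * \<zeta>) * \<psi> (\<zeta> * z))" for z
  proof -
    have p: "per (\<lambda>\<xi>. ft h \<xi> * \<psi> (\<xi> * (k * z)))"
      using per_comp2[OF per_ft per_psi_mult(2), of "(*)" h "k * z"] by simp
    have "h (k * z) = (\<Sum>\<xi>\<in>I. ft h \<xi> * \<psi> (\<xi> * (k * z)))" by (rule fourier_inversion[OF assms(3)])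
    also have "\<dots> = (\<Sum>\<zeta>\<in>I. ft h (c\<^sub>3 * \<zeta>) * \<psi> (c\<^sub>3 * \<zeta> * (k * z)))"
      using sum_affine[OF p unit, of 0] by simp
    also have "\<dots> = (\<Sum>\<zeta>\<in>I. ft h (c\<^sub>3 * \<zeta>) * \<psi> (\<zeta> * z))"
    proof (rule sum.cong[OF refl])
      fix \<zeta>
      have "c\<^sub>3 * \<zeta> * (k * z) - \<zeta> * z = (c\<^sub>3 * k - 1) * (\<zeta> * z)" by (simp add: algebra_simps)
      then have "\<psi> (c\<^sub>3 * \<zeta> * (k * z)) = \<psi> (\<zeta> * z)"
        using assms(4) by (intro perD[OF per_psi]) (metis dvd_mult2)
      then show "ft h (c\<^sub>3 * \<zeta>) * \<psi> (c\<^sub>3 * \<zeta> * (k * z)) = ft h (c\<^sub>3 * \<zeta>) * \<psi> (\<zeta> * z)" by simp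
    qed
    finally show ?thesis .
  qed
  have psi: "\<psi> (\<zeta> * (w - c\<^sub>1 * a - c\<^sub>2 * b)) = \<psi> (- (c\<^sub>1 * \<zeta> * a)) * \<psi> (- (c\<^sub>2 * \<zeta> * b)) * \<psi> (\<zeta> * w)" for \<zeta> a b
    by (simp add: psi_add[symmetric] algebra_simps)
  have "triple_count c\<^sub>1 c\<^sub>2 k f g h w = avg (\<lambda>a. avg (\<lambda>b. \<Sum>\<zeta>\<in>I. (ft h (c\<^sub>3 * \<zeta>) * \<psi> (\<zeta> * w)) *
      ((f a * \<psi> (- (c\<^sub>1 * \<zeta> * a))) * (g b * \<psi> (- (c\<^sub>2 * \<zeta> * b))))))"
    unfolding triple_count_def h psi sum_distrib_left by (simp add: mult_ac)
  also have "\<dots> = (\<Sum>\<zeta>\<in>I. (ft h (c\<^sub>3 * \<zeta>) * \<psi> (\<zeta> * w)) *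
      (avg (\<lambda>a. f a * \<psi> (- (c\<^sub>1 * \<zeta> * a))) * avg (\<lambda>b. g b * \<psi> (- (c\<^sub>2 * \<zeta> * b)))))"
    unfolding avg_sum avg_mult_left avg_mult_right ..
  also have "\<dots> = (\<Sum>\<zeta>\<in>I. ft f (c\<^sub>1 * \<zeta>) * ft g (c\<^sub>2 * \<zeta>) * ft h (c\<^sub>3 * \<zeta>) * \<psi> (\<zeta> * w))"
    by (simp add: ft_def mult_ac)
  finally show ?thesis .
qed

text \<open>A frequency contributes through \<open>\<psi> (\<zeta> * w) - 1\<close>, which is at
  most \<open>\<eta>\<close> where the first coefficient is large. Elsewhere the trivial bound 2
  meets a coefficient below \<open>\<epsilon>\<close>. The two remaining factors sum to at most
  1.\<close>

lemma count_stable: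
  assumes "per f" "\<And>x. cmod (f x) \<le> 1" "unit_mod c\<^sub>2" "m dvd (c\<^sub>3 * k - 1)" "\<epsilon> \<ge> 0" "\<eta> \<ge> 0"
    and w: "\<And>\<zeta>. \<zeta> \<in> I \<Longrightarrow> \<epsilon> \<le> cmod (ft f (c\<^sub>1 * \<zeta>)) \<Longrightarrow> cmod (\<psi> (\<zeta> * w) - 1) \<le> \<eta>"
  shows "cmod (triple_count c\<^sub>1 c\<^sub>2 k f f f w - triple_count c\<^sub>1 c\<^sub>2 k f f f 0) \<le> \<eta> + 2 * \<epsilon>"
proof -
  have unit: "unit_mod c\<^sub>3" using assms(4) unfolding unit_mod_def by blast
  let ?F = "ft f"
  have le1: "cmod (?F \<xi>) \<le> 1" for \<xi>
    using norm_ft_le_nrm[of f \<xi>] nrm_le_1[of f, OF assms(2)] by simp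
  have "triple_count c\<^sub>1 c\<^sub>2 k f f f w - triple_count c\<^sub>1 c\<^sub>2 k f f f 0
      = (\<Sum>\<zeta>\<in>I. (?F (c\<^sub>1 * \<zeta>) * (\<psi> (\<zeta> * w) - 1)) * (?F (c\<^sub>2 * \<zeta>) * ?F (c\<^sub>3 * \<zeta>)))"
    unfolding count_fourier[OF assms(1,1,1,4)] sum_subtractf[symmetric] by (simp add: algebra_simps)
  then have "cmod (triple_count c\<^sub>1 c\<^sub>2 k f f f w - triple_count c\<^sub>1 c\<^sub>2 k f f f 0)
      \<le> (\<Sum>\<zeta>\<in>I. (cmod (?F (c\<^sub>1 * \<zeta>)) * cmod (\<psi> (\<zeta> * w) - 1)) * (cmod (?F (c\<^sub>2 * \<zeta>)) * cmod (?F (c\<^sub>3 * \<zeta>))))"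
    by (metis (no_types, lifting) norm_sum norm_mult sum.cong)
  also have "\<dots> \<le> (\<Sum>\<zeta>\<in>I. (\<eta> + 2 * \<epsilon>) * (cmod (?F (c\<^sub>2 * \<zeta>)) * cmod (?F (c\<^sub>3 * \<zeta>))))"
  proof (intro sum_mono mult_right_mono)
    fix \<zeta> assume z: "\<zeta> \<in> I"
    show "cmod (?F (c\<^sub>1 * \<zeta>)) * cmod (\<psi> (\<zeta> * w) - 1) \<le> \<eta> + 2 * \<epsilon>"
    proof (cases "\<epsilon> \<le> cmod (?F (c\<^sub>1 * \<zeta>))")
      case True
      have "cmod (?F (c\<^sub>1 * \<zeta>)) * cmod (\<psi> (\<zeta> * w) - 1) \<le> 1 * \<eta>"
        using w[OF z True] le1 by (intro mult_mono) auto
      then show ?thesis using assms(5) by simp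
    next
      case False
      have "cmod (\<psi> (\<zeta> * w) - 1) \<le> 2"
        using norm_triangle_ineq4[of "\<psi> (\<zeta> * w)" 1] by simp
      then have "cmod (?F (c\<^sub>1 * \<zeta>)) * cmod (\<psi> (\<zeta> * w) - 1) \<le> \<epsilon> * 2"
        using False assms(5) by (intro mult_mono) auto
      then show ?thesis using assms(6) by simp
    qed
  qed auto
  also have "\<dots> \<le> (\<eta> + 2 * \<epsilon>) * 1"
    unfolding sum_distrib_left[symmetric]
  proof (rule mult_left_mono)
    have "nrm f * nrm f \<le> 1"
      using nrm_le_1[of f, OF assms(2)] by (simp add: mult_le_one)
    then show "(\<Sum>\<zeta>\<in>I. cmod (?F (c\<^sub>2 * \<zeta>)) * cmod (?F (c\<^sub>3 * \<zeta>))) \<le> 1"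
      using sum_ft_dilates_le[OF assms(1,1,3) unit] by linarith
  qed (use assms in auto)
  finally show ?thesis by simp
qed

end

section \<open>A Roth-type count in dense sets\<close>

context residue_character
begin

lemma ft_shift: "per f \<Longrightarrow> ft (\<lambda>x. f (x + d)) \<xi> = \<psi> (\<xi> * d) * ft f \<xi>"
proof -
  assume "per f"
  then have p: "per (\<lambda>x. f x * \<psi> (- (\<xi> * x)))"
    using per_comp2[OF _ per_psi_mult(1), of f "(*)" "- \<xi>"] by simp
  have "ft f \<xi> = avg (\<lambda>x. f (x + d) * \<psi> (- (\<xi> * (x + d))))"
    unfolding ft_def using avg_shift[OF p, of d] by simp
  also have "\<dots> = avg (\<lambda>x. \<psi> (- (\<xi> * d)) * (f (x + d) * \<psi> (- (\<xi> * x))))"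
    by (simp add: distrib_left psi_diff psi_minus mult_ac)
  also have "\<dots> = \<psi> (- (\<xi> * d)) * ft (\<lambda>x. f (x + d)) \<xi>"
    by (simp add: avg_mult_left ft_def)
  finally have "\<psi> (\<xi> * d) * ft f \<xi> = (\<psi> (\<xi> * d) * \<psi> (- (\<xi> * d))) * ft (\<lambda>x. f (x + d)) \<xi>"
    by simp
  also have "\<psi> (\<xi> * d) * \<psi> (- (\<xi> * d)) = 1"
    by (simp add: psi_add[symmetric])
  finally show ?thesis by simp
qed

text \<open>Parseval for \<open>f\<close> and its shift. The coefficients are nonnegative and, for
  functions bounded by 1, have sum at most 1.\<close>

lemma autocorrelation:
  assumes "per f"
  shows "avg (\<lambda>x. f (x + d) * cnj (f x)) = (\<Sum>\<xi>\<in>I. of_real ((cmod (ft f \<xi>))\<^sup>2) * \<psi> (\<xi> * d))"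
  unfolding parseval[OF per_shift[OF assms], symmetric]
  by (rule sum.cong) (simp_all add: ft_shift[OF assms] complex_norm_square mult_ac del: of_real_power)

lemma ft_modulate: "ft (\<lambda>x. f x * \<psi> (c * x)) \<xi> = ft f (\<xi> - c)"
proof -
  have "f x * \<psi> (c * x) * \<psi> (- (\<xi> * x)) = f x * \<psi> (- ((\<xi> - c) * x))" for x
    by (simp add: mult.assoc psi_add[symmetric] left_diff_distrib)
  then show ?thesis by (simp only: ft_def)
qed

lemma nrm_modulate: "nrm (\<lambda>x. f x * \<psi> (c * x)) = nrm f"
  by (simp add: nrm_def norm_mult)

lemma per_modulate: "per f \<Longrightarrow> per (\<lambda>x. f x * \<psi> (c * x))"
  using per_comp2[OF _ per_psi_mult(1), of f "(*)" c] by simp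

lemma ft_cnj: "ft (\<lambda>x. cnj (f x)) \<xi> = cnj (ft f (- \<xi>))"
  by (simp add: ft_def avg_cnj psi_minus[symmetric])

text \<open>One Fourier transform is bounded uniformly, the other two by
  \<open>sum_ft_dilates_le\<close>. The small function sits in the second place and then in the
  third, as it does when two factors are replaced one after the other.\<close>

lemma count_le:
  assumes "per f" "per g" "per h" "m dvd (c\<^sub>3 * k - 1)"
  shows "unit_mod c\<^sub>1 \<Longrightarrow> (\<And>\<xi>. cmod (ft g \<xi>) \<le> \<epsilon>) \<Longrightarrow> cmod (triple_count c\<^sub>1 c\<^sub>2 k f g h 0) \<le> \<epsilon> * (nrm f * nrm h)"
    and "unit_mod c\<^sub>1 \<Longrightarrow> unit_mod c\<^sub>2 \<Longrightarrow> (\<And>\<xi>. cmod (ft h \<xi>) \<le> \<epsilon>) \<Longrightarrow> cmod (triple_count c\<^sub>1 c\<^sub>2 k f g h 0) \<le> \<epsilon> * (nrm f * nrm g)"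
proof -
  have unit: "unit_mod c\<^sub>3" using assms(4) unfolding unit_mod_def by blast
  have le: "cmod (triple_count c\<^sub>1 c\<^sub>2 k f g h 0)
      \<le> (\<Sum>\<zeta>\<in>I. cmod (ft f (c\<^sub>1 * \<zeta>)) * cmod (ft g (c\<^sub>2 * \<zeta>)) * cmod (ft h (c\<^sub>3 * \<zeta>)))"
    unfolding count_fourier[OF assms] by (rule norm_sum[THEN order_trans]) (simp add: norm_mult)
  {
    assume u: "unit_mod c\<^sub>1" and g: "\<And>\<xi>. cmod (ft g \<xi>) \<le> \<epsilon>"
    have "(\<Sum>\<zeta>\<in>I. cmod (ft f (c\<^sub>1 * \<zeta>)) * cmod (ft g (c\<^sub>2 * \<zeta>)) * cmod (ft h (c\<^sub>3 * \<zeta>)))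
        \<le> (\<Sum>\<zeta>\<in>I. \<epsilon> * (cmod (ft f (c\<^sub>1 * \<zeta>)) * cmod (ft h (c\<^sub>3 * \<zeta>))))"
      using g by (intro sum_mono) (simp add: mult.assoc mult.left_commute[of _ "cmod (ft g _)"] mult_right_mono)
    also have "\<dots> \<le> \<epsilon> * (nrm f * nrm h)"
      unfolding sum_distrib_left[symmetric]
      using sum_ft_dilates_le[OF assms(1,3) u unit] g[of 0]
      by (intro mult_left_mono) (auto intro: order_trans[OF norm_ge_zero])
    finally show "cmod (triple_count c\<^sub>1 c\<^sub>2 k f g h 0) \<le> \<epsilon> * (nrm f * nrm h)" using le by linarith
  }
  {
    assume u: "unit_mod c\<^sub>1" "unit_mod c\<^sub>2" and h: "\<And>\<xi>. cmod (ft h \<xi>) \<le> \<epsilon>"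
    have "(\<Sum>\<zeta>\<in>I. cmod (ft f (c\<^sub>1 * \<zeta>)) * cmod (ft g (c\<^sub>2 * \<zeta>)) * cmod (ft h (c\<^sub>3 * \<zeta>)))
        \<le> (\<Sum>\<zeta>\<in>I. (cmod (ft f (c\<^sub>1 * \<zeta>)) * cmod (ft g (c\<^sub>2 * \<zeta>))) * \<epsilon>)"
      using h by (intro sum_mono mult_left_mono) auto
    also have "\<dots> \<le> (nrm f * nrm g) * \<epsilon>"
      unfolding sum_distrib_right[symmetric]
      using sum_ft_dilates_le[OF assms(1,2) u] h[of 0]
      by (intro mult_right_mono) (auto intro: order_trans[OF norm_ge_zero])
    finally show "cmod (triple_count c\<^sub>1 c\<^sub>2 k f g h 0) \<le> \<epsilon> * (nrm f * nrm g)" using le by (simp add: mult.commute)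
  }
qed

text \<open>The substitution \<open>b = a + c\<^sub>3 * d\<close> is a bijection in
  \<open>d\<close>, and the linear relation turns the third argument into
  \<open>e * a - c\<^sub>2 * d\<close>. The value \<open>e = 1\<close> is the case of coefficients
  with sum zero; \<open>e = 0\<close> is the case \<open>p, - p, s\<close> of colourings.\<close>

lemma count_parametrize:
  assumes "per f" "per g" "per h" "c\<^sub>1 + c\<^sub>2 + c\<^sub>3 * e = 0" "m dvd (c\<^sub>3 * k - 1)"
  shows "triple_count c\<^sub>1 c\<^sub>2 k f g h 0 = avg (\<lambda>d. avg (\<lambda>x. f x * g (x + c\<^sub>3 * d) * h (e * x - c\<^sub>2 * d)))"
proof -
  have unit: "unit_mod c\<^sub>3" using assms(5) unfolding unit_mod_def by blast
  have c1: "c\<^sub>1 = - c\<^sub>2 - c\<^sub>3 * e" using assms(4) by (simp add: eq_neg_iff_add_eq_0 algebra_simps)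
  have "avg (\<lambda>b. f a * g b * h (k * (0 - c\<^sub>1 * a - c\<^sub>2 * b)))
      = avg (\<lambda>d. f a * g (a + c\<^sub>3 * d) * h (e * a - c\<^sub>2 * d))" for a
  proof -
    have p: "per (\<lambda>b. f a * g b * h (k * (0 - c\<^sub>1 * a - c\<^sub>2 * b)))"
    proof -
      have "per (\<lambda>b. h (- (k * c\<^sub>2) * b + k * (- c\<^sub>1 * a)))" using per_affine[OF assms(3)] .
      moreover have "- (k * c\<^sub>2) * b + k * (- c\<^sub>1 * a) = k * (0 - c\<^sub>1 * a - c\<^sub>2 * b)" for b
        by (simp add: algebra_simps)
      ultimately have "per (\<lambda>b. h (k * (0 - c\<^sub>1 * a - c\<^sub>2 * b)))" by simp
      from per_comp2[OF assms(2) this, of "\<lambda>y z. f a * y * z"] show ?thesis .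
    qed
    have h: "h (k * (0 - c\<^sub>1 * a - c\<^sub>2 * (c\<^sub>3 * d + a))) = h (e * a - c\<^sub>2 * d)" for d
    proof (rule perD[OF assms(3)])
      have "k * (0 - c\<^sub>1 * a - c\<^sub>2 * (c\<^sub>3 * d + a)) - (e * a - c\<^sub>2 * d) = (c\<^sub>3 * k - 1) * (e * a - c\<^sub>2 * d)"
        by (simp add: c1 algebra_simps)
      then show "m dvd (k * (0 - c\<^sub>1 * a - c\<^sub>2 * (c\<^sub>3 * d + a)) - (e * a - c\<^sub>2 * d))"
        using assms(5) by (metis dvd_mult2)
    qed
    show ?thesis
      using avg_affine[OF p unit, of a] unfolding h by (simp only: add.commute)
  qed
  then have "triple_count c\<^sub>1 c\<^sub>2 k f g h 0 = avg (\<lambda>x. avg (\<lambda>d. f x * g (x + c\<^sub>3 * d) * h (e * x - c\<^sub>2 * d)))"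
    unfolding triple_count_def by simp
  then show ?thesis by (simp only: avg_swap[of "\<lambda>x d. f x * g (x + c\<^sub>3 * d) * h (e * x - c\<^sub>2 * d)"])
qed

text \<open>A positive definite weight is a nonnegative combination of characters, and a character
  in \<open>d\<close> can be absorbed into \<open>f\<close> and \<open>g\<close> as a modulation, which only translates their Fourier
  transforms.\<close>

lemma weighted_count_le:
  assumes "per f" "per g" "per h" "per K" "s\<^sub>1 + s\<^sub>2 + s\<^sub>3 = 0" "m dvd (s\<^sub>3 * k - 1)"
    and "\<And>x. cmod (K x) \<le> 1"
    and B: "\<And>c c'. cmod (triple_count s\<^sub>1 s\<^sub>2 k (\<lambda>x. f x * \<psi> (c * x)) (\<lambda>x. g x * \<psi> (c' * x)) h 0) \<le> B"
  shows "cmod (avg (\<lambda>d. avg (\<lambda>y. K (y + d) * cnj (K y)) *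
            avg (\<lambda>x. f x * g (x + s\<^sub>3 * d) * h (x - s\<^sub>2 * d)))) \<le> B"
proof -
  let ?T = "\<lambda>d. avg (\<lambda>x. f x * g (x + s\<^sub>3 * d) * h (x - s\<^sub>2 * d))"
  have sum0: "s\<^sub>1 + s\<^sub>2 + s\<^sub>3 * 1 = 0" using assms(5) by simp
  have twist: "avg (\<lambda>d. \<psi> (\<xi> * d) * ?T d)
      = triple_count s\<^sub>1 s\<^sub>2 k (\<lambda>x. f x * \<psi> ((- \<xi> * k) * x)) (\<lambda>x. g x * \<psi> ((\<xi> * k) * x)) h 0" for \<xi>
  proof -
    \<comment> \<open>The frequencies \<open>- \<xi> * k\<close> on \<open>x\<close> and
      \<open>\<xi> * k\<close> on \<open>x + s\<^sub>3 * d\<close> add up to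
      \<open>\<xi> * d\<close> because \<open>s\<^sub>3 * k\<close> is 1 modulo
      \<open>m\<close>.\<close>
    have e: "\<psi> ((- \<xi> * k) * x) * \<psi> ((\<xi> * k) * (x + s\<^sub>3 * d)) = \<psi> (\<xi> * d)" for x d
    proof -
      have "(- \<xi> * k) * x + (\<xi> * k) * (x + s\<^sub>3 * d) - \<xi> * d = (s\<^sub>3 * k - 1) * (\<xi> * d)"
        by (simp add: algebra_simps)
      then have "m dvd ((- \<xi> * k) * x + (\<xi> * k) * (x + s\<^sub>3 * d) - \<xi> * d)"
        using assms(6) by (metis dvd_mult2)
      from perD[OF per_psi this] show ?thesis by (simp only: psi_add)
    qed
    have "f x * \<psi> ((- \<xi> * k) * x) * (g (x + s\<^sub>3 * d) * \<psi> ((\<xi> * k) * (x + s\<^sub>3 * d))) * h (x - s\<^sub>2 * d)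
        = \<psi> (\<xi> * d) * (f x * g (x + s\<^sub>3 * d) * h (x - s\<^sub>2 * d))" for x d
      unfolding e[of x d, symmetric] by (simp only: mult_ac)
    then show ?thesis
      unfolding count_parametrize[OF per_modulate[OF assms(1)] per_modulate[OF assms(2)] assms(3) sum0 assms(6)]
        mult_1_left
      by (simp only: avg_mult_left)
  qed
  let ?c = "\<lambda>\<xi>. (cmod (ft K \<xi>))\<^sup>2"
  have "avg (\<lambda>d. avg (\<lambda>y. K (y + d) * cnj (K y)) * ?T d)
      = (\<Sum>\<xi>\<in>I. of_real (?c \<xi>) * avg (\<lambda>d. \<psi> (\<xi> * d) * ?T d))"
    unfolding autocorrelation[OF assms(4)] sum_distrib_right avg_sum mult.assoc avg_mult_left ..
  then have "cmod (avg (\<lambda>d. avg (\<lambda>y. K (y + d) * cnj (K y)) * ?T d))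
      \<le> (\<Sum>\<xi>\<in>I. ?c \<xi> * cmod (avg (\<lambda>d. \<psi> (\<xi> * d) * ?T d)))"
    using norm_sum[of "\<lambda>\<xi>. of_real (?c \<xi>) * avg (\<lambda>d. \<psi> (\<xi> * d) * ?T d)" I]
    by (simp add: norm_mult norm_power)
  also have "\<dots> \<le> (\<Sum>\<xi>\<in>I. ?c \<xi> * B)"
    unfolding twist by (intro sum_mono mult_left_mono B) auto
  also have "\<dots> \<le> 1 * B"
    unfolding sum_distrib_right[symmetric]
    using energy_le_1[OF assms(4,7) order_refl] B[of 0 0]
    by (intro mult_right_mono) (auto intro: order_trans[OF norm_ge_zero])
  finally show ?thesis by simp
qed

lemma avg_autocorr_indicator:
  assumes "per (\<lambda>x. x \<in> C)"
  shows "avg (\<lambda>d. avg (\<lambda>y. indicator C (y + d) * indicator C y)) = (avg (indicator C) :: real)\<^sup>2"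
proof -
  have p: "per (indicator C :: 'a \<Rightarrow> real)"
    by (rule per_indicator[OF assms])
  have "avg (\<lambda>d. avg (\<lambda>y. indicator C (y + d) * indicator C y)) 
      = avg (\<lambda>y. avg (\<lambda>d. indicator C (d + y) * indicator C y :: real))"
    by (subst avg_swap) (simp add: add.commute)
  also have "\<dots> = avg (\<lambda>y. avg (indicator C) * indicator C y :: real)"
    by (simp only: avg_mult_right avg_shift[OF p])
  finally show ?thesis by (simp only: avg_mult_left power2_eq_square)
qed

lemma avg_mult_le_nrm:
  assumes "\<And>x. cmod (f x) \<le> 1"
  shows "cmod (avg (\<lambda>x. f x * g x * h x)) \<le> nrm g * nrm h"
proof -
  have "cmod (avg (\<lambda>x. f x * g x * h x)) \<le> avg (\<lambda>x. cmod (f x * g x * h x))" by (rule norm_avg_le)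
  also have "\<dots> \<le> avg (\<lambda>x. cmod (g x) * cmod (h x))"
    using assms by (intro avg_mono) (simp add: norm_mult mult.assoc mult_left_le_one_le)
  also have "\<dots> \<le> nrm g * nrm h" by (rule avg_cauchy_schwarz)
  finally show ?thesis .
qed

lemma nrm_cnj [simp]: "nrm (\<lambda>x. cnj (f x)) = nrm f"
  by (simp add: nrm_def)

text \<open>The two factors are replaced by \<open>p\<close> one at a time; each replacement costs
  \<open>t\<close> by Cauchy-Schwarz, as the first factor is bounded by 1.\<close>

lemma avg_perturb:
  assumes "\<And>x. cmod (f x) \<le> 1" "nrm (\<lambda>x. g x - p x) \<le> t" "nrm (\<lambda>x. h x - p x) \<le> t" "nrm h \<le> 1" "nrm p \<le> 1"
  shows "cmod (avg (\<lambda>x. f x * g x * cnj (h x)) - avg (\<lambda>x. f x * p x * cnj (p x))) \<le> 2 * t"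
proof -
  have t: "t \<ge> 0" using assms(2) nrm_nonneg order_trans by blast
  have "avg (\<lambda>x. f x * g x * cnj (h x)) - avg (\<lambda>x. f x * p x * cnj (p x))
      = avg (\<lambda>x. f x * (g x - p x) * cnj (h x)) + avg (\<lambda>x. f x * p x * cnj (h x - p x))"
    by (simp add: avg_diff[symmetric] avg_add[symmetric] algebra_simps)
  also have "cmod \<dots> \<le> nrm (\<lambda>x. g x - p x) * nrm h + nrm p * nrm (\<lambda>x. h x - p x)"
    using avg_mult_le_nrm[of f "\<lambda>x. g x - p x" "\<lambda>x. cnj (h x)", OF assms(1)]
      avg_mult_le_nrm[of f p "\<lambda>x. cnj (h x - p x)", OF assms(1)]
    unfolding nrm_cnj by (rule norm_triangle_mono)
  also have "\<dots> \<le> t * 1 + 1 * t"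
    using assms t by (intro add_mono mult_mono) auto
  finally show ?thesis by simp
qed

text \<open>The truncation cancels exactly the coefficients of size at least
  \<open>\<epsilon>\<close>. Since \<open>spec\<close> contains representatives only,
  \<open>\<xi>\<close> is first reduced.\<close>

lemma ft_diff_synth_spec:
  assumes "per f" "\<epsilon> \<ge> 0"
  shows "cmod (ft (\<lambda>x. f x - synth (ft f) (spec f \<epsilon>) x) \<xi>) \<le> \<epsilon>"
proof -
  let ?g = "\<lambda>x. f x - synth (ft f) (spec f \<epsilon>) x"
  have "cmod (ft ?g (residue \<xi>)) \<le> \<epsilon>"
    unfolding ft_diff ft_synth[OF spec_subset residue_in] using assms(2) by (auto simp: spec_def)
  then show ?thesis by (simp add: per_residue[OF per_ft])
qed

text \<open>The inner product of \<open>f\<close> with its truncation equals the energy. Writing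
  \<open>F\<close> as the product of two square roots and applying Cauchy-Schwarz leaves the average
  of \<open>F\<close> times the squared modulus of the truncation. Nonnegativity of the truncation
  itself is never involved.\<close>

lemma avg_mult_square_synth_ge:
  assumes "per f" "\<And>x. f x = of_real (F x)" "\<And>x. 0 \<le> F x" "\<And>x. F x \<le> 1" "L \<subseteq> I" 
  shows "Re (avg (\<lambda>x. f x * synth (ft f) L x * cnj (synth (ft f) L x))) \<ge> (\<Sum>\<xi>\<in>L. (cmod (ft f \<xi>))\<^sup>2)\<^sup>2"
proof -
  let ?p = "synth (ft f) L" and ?E = "\<Sum>\<xi>\<in>L. (cmod (ft f \<xi>))\<^sup>2"
  have nn: "?E \<ge> 0" by (simp add: sum_nonneg)
  have "?E = cmod (avg (\<lambda>x. f x * cnj (?p x)))"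
    unfolding avg_mult_cnj_synth[OF assms(1,5)] norm_of_real using nn by (simp only: abs_of_nonneg)
  also have "\<dots> \<le> avg (\<lambda>x. cmod (of_real (sqrt (F x))) * cmod (of_real (sqrt (F x)) * ?p x))"
    by (rule order_trans[OF norm_avg_le]) (simp add: assms(2,3) norm_mult mult.assoc[symmetric])
  also have "\<dots> \<le> nrm (\<lambda>x. of_real (sqrt (F x))) * nrm (\<lambda>x. of_real (sqrt (F x)) * ?p x)"
    by (rule avg_cauchy_schwarz)
  also have "\<dots> \<le> 1 * nrm (\<lambda>x. of_real (sqrt (F x)) * ?p x)"
    using assms(3,4) by (intro mult_right_mono nrm_le_1) auto
  finally have "?E\<^sup>2 \<le> (nrm (\<lambda>x. of_real (sqrt (F x)) * ?p x))\<^sup>2"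
    using nn by (simp add: power_mono)
  also have "\<dots> = avg (\<lambda>x. F x * (cmod (?p x))\<^sup>2)"
    by (simp add: nrm_square norm_mult power_mult_distrib assms(3))
  also have "\<dots> = Re (avg (\<lambda>x. f x * ?p x * cnj (?p x)))"
    by (simp add: Re_avg assms(2) mult.assoc complex_norm_square[symmetric] del: of_real_power)
  finally show ?thesis .
qed

text \<open>Let \<open>p\<close> and \<open>P\<close> be the truncations of \<open>f\<close> at two
  consecutive levels. The count, weighted by the autocorrelation of a Bohr cell, changes little when
  \<open>f\<close> is replaced by \<open>P\<close> in the last two places. For each \<open>d\<close>
  carrying weight, the shifts of \<open>P\<close> are close to \<open>p\<close> in L2, so the inner
  average is close to that of \<open>f\<close> times the squared modulus of \<open>p\<close>, which
  is at least \<open>\<delta>^4\<close>.\<close>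

lemma roth_count:
  fixes F :: "'a \<Rightarrow> real"
  assumes F: "per F" "\<And>x. 0 \<le> F x" "\<And>x. F x \<le> 1" "\<delta> \<le> avg F" and \<delta>: "0 < \<delta>"
    and s: "s\<^sub>1 + s\<^sub>2 + s\<^sub>3 = 0" "unit_mod s\<^sub>1" "unit_mod s\<^sub>2" "m dvd (s\<^sub>3 * k - 1)"
    and n: "real n \<ge> (16 / \<delta>^4)\<^sup>2"
    and f_def: "f = (\<lambda>x. complex_of_real (F x))"
  shows "Re (triple_count s\<^sub>1 s\<^sub>2 k f f f 0) \<ge> level (arc_count (\<delta>^4 / 16)) 2 0 (\<delta>^4 / 8) \<delta> n"
proof -
  \<comment> \<open>Two shifts, each with error \<open>2 * \<eta>\<close>, cost
    \<open>4 * \<eta>\<close>, a quarter of the main term \<open>\<delta>^4\<close>. The bound on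
    \<open>n\<close> says that 1/n is at most \<open>\<eta>\<^sup>2\<close>, the energy allowed
    between the two levels.\<close>
  define \<eta> q where "\<eta> = \<delta>^4 / 16" and "q = arc_count \<eta>"
  define e where "e = level q 2 0 (\<delta>^4 / 8) \<delta>"
  have \<eta>: "\<eta> > 0" and q: "q > 0" using \<delta> arc_count(1) by (auto simp: \<eta>_def q_def)
  have e_pos: "e i > 0" for i unfolding e_def by (rule level_pos) (use q \<delta> in auto)
  have per: "per f" unfolding f_def by (rule per_comp[OF F(1)])
  have f1: "cmod (f x) \<le> 1" for x using F(2,3) by (simp add: f_def)
  have n0: "n > 0" using n \<delta> by (metis divide_pos_pos linorder_not_less not_gr_zero of_nat_0 zero_less_numeral zero_less_power)
  have "\<exists>i<n. (\<Sum>j\<in>{()}. \<Sum>\<xi>\<in>spec f (e (Suc i)) - spec f (e i). (cmod (ft f \<xi>))\<^sup>2) \<le> real (card {()}) / real n"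
    by (rule energy_pigeonhole) (use per f1 n0 in \<open>auto simp: e_def\<close>)
  then obtain i where i: "i < n" "(\<Sum>\<xi>\<in>spec f (e (Suc i)) - spec f (e i). (cmod (ft f \<xi>))\<^sup>2) \<le> 1 / real n"
    by auto
  define L L' where "L = spec f (e i)" and "L' = spec f (e (Suc i))"
  define p P where "p = synth (ft f) L" and "P = synth (ft f) L'"
  have L: "L \<subseteq> L'" "L' \<subseteq> I" "L \<subseteq> I"
    unfolding L_def L'_def by (simp_all add: spec_antimono spec_subset e_def)
  have nrm_le: "nrm (synth (ft f) T) \<le> 1" if "T \<subseteq> I" for T
    using energy_le_1[OF per f1 that] unfolding nrm_synth[OF that, symmetric] by (simp add: abs_square_le_1[of "nrm _", simplified])
  have per_P: "per P" unfolding P_def by (rule per_synth)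
  have "nrm (\<lambda>x. P x - p x) \<le> \<eta>"
  proof (rule power2_le_imp_le)
    have "(nrm (\<lambda>x. P x - p x))\<^sup>2 \<le> 1 / real n"
      unfolding P_def p_def synth_diff[OF L(1,2)] using i(2) nrm_synth[OF order_trans[OF Diff_subset L(2)], of "ft f" L]
      by (simp add: L_def L'_def)
    also have "\<dots> \<le> \<eta>\<^sup>2"
      using n n0 \<delta> by (simp add: \<eta>_def power_divide field_simps)
    finally show "(nrm (\<lambda>x. P x - p x))\<^sup>2 \<le> \<eta>\<^sup>2" .
  qed (use \<eta> in auto)
  note Pp = this
  have dens: "\<delta> ^ 2 \<le> (\<Sum>\<xi>\<in>L. (cmod (ft f \<xi>))\<^sup>2)"
  proof -
    have "ft f (residue 0) = of_real (avg F)"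
      unfolding per_residue[OF per_ft] by (simp add: ft_def f_def avg_of_real)
    then have c: "\<delta> \<le> cmod (ft f (residue 0))" using F(4) \<delta> by simp
    have "e i \<le> \<delta>" unfolding e_def using level_antimono[of 0 i] by simp
    then have "residue 0 \<in> L" using c by (simp add: L_def spec_def)
    then have "(cmod (ft f (residue 0)))\<^sup>2 \<le> (\<Sum>\<xi>\<in>L. (cmod (ft f \<xi>))\<^sup>2)"
      by (intro member_le_sum) (auto simp: L_def)
    moreover have "\<delta>\<^sup>2 \<le> (cmod (ft f (residue 0)))\<^sup>2"
      using c \<delta> by (intro power_mono) auto
    ultimately show ?thesis by linarith
  qed
  have main: "\<delta>^4 \<le> Re (avg (\<lambda>x. f x * p x * cnj (p x)))"
  proof -
    have "\<delta>^4 = (\<delta>^2)\<^sup>2" by simp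
    also have "\<dots> \<le> (\<Sum>\<xi>\<in>L. (cmod (ft f \<xi>))\<^sup>2)\<^sup>2" using dens by (intro power_mono) auto
    also have "\<dots> \<le> Re (avg (\<lambda>x. f x * p x * cnj (p x)))"
      unfolding p_def by (rule avg_mult_square_synth_ge[OF per _ F(2,3) L(3)]) (simp add: f_def)
    finally show ?thesis .
  qed
  \<comment> \<open>Both shifts \<open>s\<^sub>3 * d\<close> and \<open>- s\<^sub>2 * d\<close> must
    be almost periods of \<open>p\<close>. Hence each frequency occurs twice, which is the parameter
    2 in \<open>level\<close>.\<close>
  define \<Xi> where "\<Xi> = (\<lambda>\<xi>. \<xi> * s\<^sub>3) ` L \<union> (\<lambda>\<xi>. \<xi> * (- s\<^sub>2)) ` L"
  have fin\<Xi>: "finite \<Xi>" by (simp add: \<Xi>_def L_def)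
  have "card \<Xi> \<le> nat \<lceil>2 / (e i)\<^sup>2\<rceil>"
  proof -
    have "card \<Xi> \<le> card L + card L"
      unfolding \<Xi>_def by (rule order_trans[OF card_Un_le]) (intro add_mono card_image_le; simp add: L_def)
    then have "real (card \<Xi>) \<le> 2 * real (card L)" by linarith
    also have "\<dots> \<le> 2 / (e i)\<^sup>2"
      using card_spec_le[OF per f1 e_pos, of i] by (simp add: L_def)
    finally show ?thesis by linarith
  qed
  from bohr_cell[OF fin\<Xi> this \<eta>] obtain C where C: "per (\<lambda>x. x \<in> C)"
    "avg (indicator C) \<ge> cell_density q 2 0 (e i)"
    "\<And>x y \<xi>. x \<in> C \<Longrightarrow> y \<in> C \<Longrightarrow> \<xi> \<in> \<Xi> \<Longrightarrow> cmod (\<psi> (\<xi> * (x - y)) - 1) \<le> \<eta>"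
    unfolding cell_density_def q_def by auto
  \<comment> \<open>A weight between 0 and 1 that is nonzero only if \<open>d\<close> is a
    difference of two points of \<open>C\<close>, and that averages to the square of the density of
    \<open>C\<close>.\<close>
  define K where "K d = avg (\<lambda>y. indicator C (y + d) * indicator C y :: real)" for d
  have K: "0 \<le> K d" "K d \<le> 1" for d
    using avg_mono[of "\<lambda>y. indicator C (y + d) * indicator C y :: real" "\<lambda>_. 1"]
    by (auto simp: K_def indicator_def intro!: avg_nonneg)
  define T where "T g h d = avg (\<lambda>x. f x * g (x + s\<^sub>3 * d) * h (x - s\<^sub>2 * d))" for g h d
  define W where "W g h = avg (\<lambda>d. of_real (K d) * T g h d)" for g h
  have K_complex: "of_real (K d) = avg (\<lambda>y. indicator C (y + d) * cnj (indicator C y))" for d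
  proof -
    have "complex_of_real (indicator C x) = indicator C x" "cnj (indicator C x) = indicator C x" for x
      by (simp_all add: indicator_def)
    then show ?thesis unfolding K_def avg_of_real[symmetric] by simp
  qed
  have per_C: "per (indicator C :: 'a \<Rightarrow> complex)"
    by (rule per_indicator[OF C(1)])
  have W_le: "cmod (W g h) \<le> B" 
    if "per g" "per h" "\<And>c c'. cmod (triple_count s\<^sub>1 s\<^sub>2 k (\<lambda>x. f x * \<psi> (c * x)) (\<lambda>x. g x * \<psi> (c' * x)) h 0) \<le> B" for g h B
    unfolding W_def T_def K_complex
    by (rule weighted_count_le[OF per that(1,2) per_C s(1,4) _ that(3)]) (simp add: indicator_def)
  have nf: "nrm f \<le> 1" using nrm_le_1[of f, OF f1] .
  have nP: "nrm P \<le> 1" "nrm p \<le> 1" using nrm_le L by (auto simp: P_def p_def)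
  have small: "cmod (ft (\<lambda>x. f x - P x) \<xi>) \<le> e (Suc i)" for \<xi>
    unfolding P_def L'_def by (rule ft_diff_synth_spec[OF per]) (use e_pos[of "Suc i"] in simp)
  have cf: "cnj (f x) = f x" for x by (simp add: f_def)
  have small': "cmod (ft (\<lambda>x. f x - cnj (P x)) \<xi>) \<le> e (Suc i)" for \<xi>
    using small[of "- \<xi>"] ft_cnj[of "\<lambda>x. f x - P x" \<xi>] by (simp add: cf)
  have perd: "per (\<lambda>x. f x - P x)" "per (\<lambda>x. f x - cnj (P x))" "per (\<lambda>x. cnj (P x))"
    using per_comp2[OF per per_P, of "(-)"] per_comp2[OF per per_P, of "\<lambda>x y. x - cnj y"]
      per_comp[OF per_P, of cnj] by simp_all
  have e0: "0 \<le> e (Suc i)" using e_pos[of "Suc i"] by simp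
  have A1: "cmod (W (\<lambda>x. f x - P x) f) \<le> e (Suc i)"
  proof (rule W_le[OF perd(1) per])
    fix c c'
    have "cmod (triple_count s\<^sub>1 s\<^sub>2 k (\<lambda>x. f x * \<psi> (c * x)) (\<lambda>x. (f x - P x) * \<psi> (c' * x)) f 0)
        \<le> e (Suc i) * (nrm (\<lambda>x. f x * \<psi> (c * x)) * nrm f)"
      by (rule count_le(1)[OF per_modulate[OF per] per_modulate[OF perd(1)] per s(4,2)])
        (unfold ft_modulate, rule small)
    also have "\<dots> \<le> e (Suc i) * 1"
      unfolding nrm_modulate using nf e0 by (intro mult_left_mono mult_le_one) auto
    finally show "cmod (triple_count s\<^sub>1 s\<^sub>2 k (\<lambda>x. f x * \<psi> (c * x)) (\<lambda>x. (f x - P x) * \<psi> (c' * x)) f 0) \<le> e (Suc i)"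
      by simp
  qed
  have A2: "cmod (W P (\<lambda>x. f x - cnj (P x))) \<le> e (Suc i)"
  proof (rule W_le[OF per_P perd(2)])
    fix c c'
    have "cmod (triple_count s\<^sub>1 s\<^sub>2 k (\<lambda>x. f x * \<psi> (c * x)) (\<lambda>x. P x * \<psi> (c' * x)) (\<lambda>x. f x - cnj (P x)) 0)
        \<le> e (Suc i) * (nrm (\<lambda>x. f x * \<psi> (c * x)) * nrm (\<lambda>x. P x * \<psi> (c' * x)))"
      by (rule count_le(2)[OF per_modulate[OF per] per_modulate[OF per_P] perd(2) s(4,2,3) small'])
    also have "\<dots> \<le> e (Suc i) * 1"
      unfolding nrm_modulate using nf nP e0 by (intro mult_left_mono mult_le_one) auto
    finally show "cmod (triple_count s\<^sub>1 s\<^sub>2 k (\<lambda>x. f x * \<psi> (c * x)) (\<lambda>x. P x * \<psi> (c' * x)) (\<lambda>x. f x - cnj (P x)) 0) \<le> e (Suc i)"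
      by simp
  qed
  \<comment> \<open>As \<open>f\<close> is real, the third factor may be compared with
    \<open>cnj (P x)\<close>; this makes the main term a squared modulus without showing that
    truncations are real.\<close>
  have split: "W f f = W P (\<lambda>x. cnj (P x)) + W (\<lambda>x. f x - P x) f + W P (\<lambda>x. f x - cnj (P x))"
    unfolding W_def T_def avg_add[symmetric] distrib_left[symmetric]
    by (simp add: algebra_simps)
  have Tge: "K d * (3 / 4 * \<delta>^4) \<le> K d * Re (T P (\<lambda>x. cnj (P x)) d)" for d
  proof (cases "K d = 0")
    case False
    then obtain y where y: "y + d \<in> C" "y \<in> C"
      unfolding K_def avg_def by (auto simp: indicator_def dest!: sum.not_neutral_contains_not_neutral split: if_splits)
    have sh: "nrm (\<lambda>x. P (x + t) - p x) \<le> 2 * \<eta>" if t: "\<And>\<xi>. \<xi> \<in> L \<Longrightarrow> cmod (\<psi> (\<xi> * t) - 1) \<le> \<eta>" for t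
    proof -
      have "nrm (\<lambda>x. P (x + t) - p x) = nrm (\<lambda>x. (P (x + t) - p (x + t)) + (p (x + t) - p x))" by simp
      also have "\<dots> \<le> nrm (\<lambda>x. P (x + t) - p (x + t)) + nrm (\<lambda>x. p (x + t) - p x)"
        by (rule nrm_triangle)
      also have "nrm (\<lambda>x. P (x + t) - p (x + t)) = nrm (\<lambda>x. P x - p x)"
        by (rule nrm_shift) (unfold p_def, rule per_comp2[OF per_P per_synth])
      also have "nrm (\<lambda>x. p (x + t) - p x) \<le> \<eta> * nrm p"
        unfolding p_def by (rule nrm_synth_shift[OF L(3) t]) (use \<eta> in auto)
      also have "\<eta> * nrm p \<le> \<eta>" using nP \<eta> by (simp add: mult_left_le)
      finally show ?thesis using Pp by linarith
    qed
    have "cmod (T P (\<lambda>x. cnj (P x)) d - avg (\<lambda>x. f x * p x * cnj (p x))) \<le> 2 * (2 * \<eta>)"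
      unfolding T_def
    proof (rule avg_perturb[OF f1 _ _ _ nP(2)])
      show "nrm (\<lambda>x. P (x + s\<^sub>3 * d) - p x) \<le> 2 * \<eta>"
      proof (rule sh)
        fix \<xi> assume "\<xi> \<in> L"
        then have "cmod (\<psi> (\<xi> * s\<^sub>3 * (y + d - y)) - 1) \<le> \<eta>"
          by (intro C(3)[OF y]) (auto simp: \<Xi>_def)
        then show "cmod (\<psi> (\<xi> * (s\<^sub>3 * d)) - 1) \<le> \<eta>" by (simp add: mult.assoc)
      qed
      have "nrm (\<lambda>x. P (x + (- s\<^sub>2) * d) - p x) \<le> 2 * \<eta>"
      proof (rule sh)
        fix \<xi> assume "\<xi> \<in> L"
        then have "cmod (\<psi> (\<xi> * (- s\<^sub>2) * (y + d - y)) - 1) \<le> \<eta>"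
          by (intro C(3)[OF y]) (auto simp: \<Xi>_def)
        then show "cmod (\<psi> (\<xi> * (- s\<^sub>2 * d)) - 1) \<le> \<eta>" by (simp add: mult.assoc)
      qed
      then show "nrm (\<lambda>x. P (x - s\<^sub>2 * d) - p x) \<le> 2 * \<eta>" by simp
      have "nrm (\<lambda>x. P (x + (- s\<^sub>2 * d))) = nrm P" by (rule nrm_shift[OF per_P])
      then show "nrm (\<lambda>x. P (x - s\<^sub>2 * d)) \<le> 1" using nP by simp
    qed
    then have "Re (T P (\<lambda>x. cnj (P x)) d) \<ge> \<delta>^4 - 4 * \<eta>"
      using abs_Re_le_cmod[of "T P (\<lambda>x. cnj (P x)) d - avg (\<lambda>x. f x * p x * cnj (p x))"] main by simp
    then show ?thesis using K(1)[of d] by (intro mult_left_mono) (auto simp: \<eta>_def)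
  qed simp
  define \<beta> where "\<beta> = cell_density q 2 0 (e i)"
  have \<beta>: "0 < \<beta>" using cell_density_pos[OF q] by (simp add: \<beta>_def)
  have "\<beta>\<^sup>2 * (3 / 4 * \<delta>^4) \<le> (avg (indicator C))\<^sup>2 * (3 / 4 * \<delta>^4)"
    using C(2) \<beta> by (intro mult_right_mono power_mono) (auto simp: \<beta>_def)
  also have "\<dots> = avg (\<lambda>d. K d * (3 / 4 * \<delta>^4))"
    unfolding avg_mult_right K_def avg_autocorr_indicator[OF C(1)] ..
  also have "\<dots> \<le> avg (\<lambda>d. K d * Re (T P (\<lambda>x. cnj (P x)) d))"
    by (rule avg_mono) (rule Tge)
  also have "\<dots> = Re (W P (\<lambda>x. cnj (P x)))"
    by (simp add: W_def Re_avg)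
  \<comment> \<open>The factor \<open>\<delta>^4 / 8\<close> in \<open>level\<close> makes three
    times \<open>e (Suc i)\<close> at most half of the main term: two copies absorb the errors and
    one is left as the lower bound.\<close>
  finally have "Re (W f f) \<ge> \<beta>\<^sup>2 * (3 / 4 * \<delta>^4) - 2 * e (Suc i)"
    using split A1 A2 abs_Re_le_cmod[of "W (\<lambda>x. f x - P x) f"] abs_Re_le_cmod[of "W P (\<lambda>x. f x - cnj (P x))"]
    by simp
  moreover have "e (Suc i) \<le> \<delta>^4 / 8 * \<beta>\<^sup>2"
    by (simp add: e_def \<beta>_def)
  ultimately have "Re (W f f) \<ge> e (Suc i) + \<beta>\<^sup>2 * \<delta>^4 * (3 / 8)"
    by (simp add: algebra_simps)
  then have "e (Suc i) \<le> Re (W f f)"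
    using \<beta> \<delta> by (smt (verit) mult_pos_pos zero_less_power zero_less_divide_iff)
  moreover have "e n \<le> e (Suc i)"
    unfolding e_def using i(1) by (intro level_antimono) simp
  \<comment> \<open>The inner averages for \<open>f\<close> itself are nonnegative, so removing the
    weight can only increase the count.\<close>
  moreover have "Re (W f f) \<le> Re (triple_count s\<^sub>1 s\<^sub>2 k f f f 0)"
  proof -
    have Tf: "Re (T f f d) = avg (\<lambda>x. F x * F (x + s\<^sub>3 * d) * F (x - s\<^sub>2 * d))" for d
      by (simp add: T_def f_def Re_avg)
    then have "0 \<le> Re (T f f d)" for d
      using F(2) by (auto intro!: avg_nonneg)
    then have "avg (\<lambda>d. K d * Re (T f f d)) \<le> avg (\<lambda>d. Re (T f f d))"
      using K by (intro avg_mono) (simp add: mult_left_le_one_le)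
    then show ?thesis
      using count_parametrize[OF per per per, of s\<^sub>1 s\<^sub>2 s\<^sub>3 1 k] s(1,4) by (simp add: W_def T_def Re_avg)
  qed
  ultimately have "e n \<le> Re (triple_count s\<^sub>1 s\<^sub>2 k f f f 0)" by linarith
  then show ?thesis by (simp only: e_def q_def \<eta>_def)
qed

end

section \<open>Popular differences and colourings\<close>

text \<open>
  Consecutive thresholds are so far apart that \<open>r\<close> colours of density below the next threshold cannot
  cover a Bohr cell built from the spectra of colours of density above the current one.
\<close>

primrec threshold :: "nat \<Rightarrow> nat \<Rightarrow> nat \<Rightarrow> real \<Rightarrow> nat \<Rightarrow> real" where
  "threshold r \<sigma> b \<eta> 0 = 1"
| "threshold r \<sigma> b \<eta> (Suc i) = (let \<theta> = threshold r \<sigma> b \<eta> i in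
     level (arc_count \<eta>) (real (r * \<sigma>)) b (\<theta>\<^sup>2 / (8 * real r)) \<theta> (nat \<lceil>4 * real r / \<theta>\<^sup>2\<rceil>) / (2 * real r))"

lemma threshold_pos: "r > 0 \<Longrightarrow> \<eta> > 0 \<Longrightarrow> threshold r \<sigma> b \<eta> i > 0"
  by (induction i) (auto simp: Let_def intro!: divide_pos_pos level_pos arc_count(1))

lemma threshold_Suc_le:
  assumes "r > 0" "\<eta> > 0"
  shows "threshold r \<sigma> b \<eta> (Suc i) \<le> threshold r \<sigma> b \<eta> i"
proof -
  let ?\<theta> = "threshold r \<sigma> b \<eta> i"
  let ?l = "level (arc_count \<eta>) (real (r * \<sigma>)) b (?\<theta>\<^sup>2 / (8 * real r)) ?\<theta> (nat \<lceil>4 * real r / ?\<theta>\<^sup>2\<rceil>)"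
  have "?l \<le> ?\<theta>" using level_antimono[OF le0] by (metis level.simps(1))
  moreover have "?\<theta> / (2 * real r) \<le> ?\<theta> / 1"
    using assms threshold_pos[OF assms] by (intro divide_left_mono) (auto simp: less_imp_le)
  ultimately show ?thesis
    using assms by (simp add: Let_def) (smt (verit) divide_right_mono of_nat_0_le_iff)
qed

lemma threshold_antimono:
  assumes "r > 0" "\<eta> > 0" "i \<le> j"
  shows "threshold r \<sigma> b \<eta> j \<le> threshold r \<sigma> b \<eta> i"
  using lift_Suc_antimono_le[of "threshold r \<sigma> b \<eta>", OF threshold_Suc_le[OF assms(1,2)] assms(3)] .

lemma threshold_le_1: "r > 0 \<Longrightarrow> \<eta> > 0 \<Longrightarrow> threshold r \<sigma> b \<eta> i \<le> 1"
  using threshold_antimono[of r \<eta> 0 i] by simp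

text \<open>There are \<open>r + 1\<close> disjoint intervals and at most \<open>r\<close> values,
  so some interval contains none.\<close>

lemma interval_gap:
  fixes t :: "nat \<Rightarrow> real"
  assumes "finite J" "card J \<le> r" "\<And>i j. i \<le> j \<Longrightarrow> t j \<le> t i"
  shows "\<exists>i\<le>r. \<forall>j\<in>J. \<not> (t (Suc i) \<le> x j \<and> x j < t i)"
proof (rule ccontr)
  assume "\<not> ?thesis"
  then have "\<forall>i\<in>{..r}. \<exists>j. j \<in> J \<and> t (Suc i) \<le> x j \<and> x j < t i" by auto
  then obtain c where c: "\<And>i. i \<le> r \<Longrightarrow> c i \<in> J \<and> t (Suc i) \<le> x (c i) \<and> x (c i) < t i"
    unfolding bchoice_iff by auto
  have ne: "c i \<noteq> c j" if "i < j" "j \<le> r" for i j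
    using c[of i] c[of j] that assms(3)[of "Suc i" j] by force
  have "inj_on c {..r}"
    by (rule inj_onI) (metis atMost_iff linorder_neqE_nat ne)
  then have "card {..r} \<le> card J"
    using c assms(1) by (intro card_inj_on_le[of c]) auto
  then show False using assms(2) by simp
qed

context residue_character
begin

text \<open>The autocorrelation of \<open>F j\<close> at \<open>s * d\<close> is cut at two levels.
  On \<open>D\<close> the large frequencies contribute at least
  \<open>3 / 4 * \<theta>\<^sup>2\<close>, and the middle ones at most
  \<open>\<theta>\<^sup>2 / 4\<close> by their energy. The rest is small only in L2, so exceptional
  \<open>d\<close> cannot be excluded. The conclusion is therefore tested against every weight
  \<open>G\<close> under the indicator of \<open>D\<close> with a fair share of its mass.\<close>

lemma popular_differences:
  fixes F :: "'i \<Rightarrow> 'a \<Rightarrow> real"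
  assumes J: "finite J" "card J \<le> r" "r > 0"
    and F: "\<And>j. j \<in> J \<Longrightarrow> per (F j)" "\<And>j x. j \<in> J \<Longrightarrow> 0 \<le> F j x" "\<And>j x. j \<in> J \<Longrightarrow> F j x \<le> 1"
    and \<theta>: "\<And>j. j \<in> J \<Longrightarrow> \<theta> \<le> avg (F j)" "0 < \<theta>" "\<theta> \<le> 1"
    and S: "finite S" "card S \<le> \<sigma>" "\<And>s. s \<in> S \<Longrightarrow> unit_mod s"
    and \<Xi>: "finite \<Xi>" "card \<Xi> \<le> b"
    and \<eta>: "0 < \<eta>" "\<eta> \<le> 1 / 4"
    and n: "4 * real r / \<theta>\<^sup>2 \<le> real n"
  defines "l \<equiv> level (arc_count \<eta>) (real (r * \<sigma>)) b (\<theta>\<^sup>2 / (8 * real r)) \<theta> n"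
  shows "\<exists>D. per (\<lambda>x. x \<in> D) \<and> avg (indicator D) \<ge> l \<and>
     (\<forall>d\<in>D. \<forall>\<xi>\<in>\<Xi>. cmod (\<psi> (\<xi> * d) - 1) \<le> \<eta>) \<and>
     (\<forall>j\<in>J. \<forall>s\<in>S. \<forall>G. (\<forall>x. 0 \<le> G x \<and> G x \<le> indicator D x) \<longrightarrow> avg (indicator D) / (2 * real r) \<le> avg G \<longrightarrow>
        l \<le> avg (\<lambda>d. G d * avg (\<lambda>x. F j (x + s * d) * F j x)))"
proof -
  define q \<kappa> where "q = arc_count \<eta>" and "\<kappa> = \<theta>\<^sup>2 / (8 * real r)"
  define e where "e = level q (real (r * \<sigma>)) b \<kappa> \<theta>"
  define f where "f j x = complex_of_real (F j x)" for j x
  have q: "q > 0" using \<eta> arc_count(1) by (auto simp: q_def)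
  have \<kappa>: "0 < \<kappa>" "\<kappa> \<le> 1" 
  proof -
    show "0 < \<kappa>" using \<theta> J(3) by (simp add: \<kappa>_def)
    have "\<theta>\<^sup>2 \<le> 1" using \<theta> by (simp add: power_le_one)
    then show "\<kappa> \<le> 1" using J(3) by (simp add: \<kappa>_def divide_simps)
  qed
  have l_eq: "l = e n" by (simp add: l_def e_def q_def \<kappa>_def)
  have e_pos: "e i > 0" for i unfolding e_def by (rule level_pos) (use q \<theta> \<kappa> in auto)
  have per: "per (f j)" if "j \<in> J" for j unfolding f_def[abs_def] by (rule per_comp[OF F(1)[OF that]])
  have f1: "cmod (f j x) \<le> 1" if "j \<in> J" for j x using F(2,3)[OF that] by (simp add: f_def)
  have n0: "n > 0" using n \<theta> J(3) by (metis divide_pos_pos linorder_not_less mult_pos_pos not_gr_zero of_nat_0 of_nat_0_less_iff zero_less_numeral zero_less_power)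
  obtain i where i: "i < n" "(\<Sum>j\<in>J. \<Sum>\<xi>\<in>spec (f j) (e (Suc i)) - spec (f j) (e i). (cmod (ft (f j) \<xi>))\<^sup>2) \<le> real (card J) / real n"
    using energy_pigeonhole[of J f e n, OF per f1 _ n0] by (auto simp: e_def)
  \<comment> \<open>One cell has to work for all functions and all multipliers: at most
    \<open>r * \<sigma>\<close> spectra' worth of frequencies in addition to the \<open>b\<close>
    prescribed ones.\<close>
  define \<Xi>' where "\<Xi>' = \<Xi> \<union> (\<Union>j\<in>J. (\<lambda>(\<xi>, s). \<xi> * s) ` (spec (f j) (e i) \<times> S))"
  have fin: "finite \<Xi>'" using \<Xi> J S by (auto simp: \<Xi>'_def)
  have "card \<Xi>' \<le> nat \<lceil>real (r * \<sigma>) / (e i)\<^sup>2\<rceil> + b"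
  proof -
    have "real (card (\<Union>j\<in>J. (\<lambda>(\<xi>, s). \<xi> * s) ` (spec (f j) (e i) \<times> S)))
        \<le> real (\<Sum>j\<in>J. card ((\<lambda>(\<xi>, s). \<xi> * s) ` (spec (f j) (e i) \<times> S)))"
      unfolding of_nat_le_iff by (rule card_UN_le[OF J(1)])
    also have "\<dots> \<le> (\<Sum>j\<in>J. 1 / (e i)\<^sup>2 * real \<sigma>)"
      unfolding of_nat_sum
    proof (rule sum_mono)
      fix j assume j: "j \<in> J"
      have "real (card ((\<lambda>(\<xi>, s). \<xi> * s) ` (spec (f j) (e i) \<times> S))) \<le> real (card (spec (f j) (e i) \<times> S))"
        unfolding of_nat_le_iff by (rule card_image_le) (use S in auto)
      also have "\<dots> = real (card (spec (f j) (e i))) * real (card S)"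
        by (simp add: card_cartesian_product)
      also have "\<dots> \<le> 1 / (e i)\<^sup>2 * real \<sigma>"
        using card_spec_le[OF per[OF j] f1[OF j] e_pos] S(2) by (intro mult_mono) auto
      finally show "real (card ((\<lambda>(\<xi>, s). \<xi> * s) ` (spec (f j) (e i) \<times> S))) \<le> 1 / (e i)\<^sup>2 * real \<sigma>" .
    qed
    also have "\<dots> = real (card J) * (1 / (e i)\<^sup>2 * real \<sigma>)" by simp
    also have "\<dots> \<le> real r * (1 / (e i)\<^sup>2 * real \<sigma>)" using J(2) by (intro mult_right_mono) auto
    also have "\<dots> = real (r * \<sigma>) / (e i)\<^sup>2" by simp
    finally have "card (\<Union>j\<in>J. (\<lambda>(\<xi>, s). \<xi> * s) ` (spec (f j) (e i) \<times> S)) \<le> nat \<lceil>real (r * \<sigma>) / (e i)\<^sup>2\<rceil>"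
      by linarith
    then show ?thesis
      using card_Un_le[of \<Xi> "\<Union>j\<in>J. (\<lambda>(\<xi>, s). \<xi> * s) ` (spec (f j) (e i) \<times> S)"] \<Xi>(2)
      unfolding \<Xi>'_def by linarith
  qed
  from bohr_cell[OF fin this \<eta>(1)] obtain C where C: "per (\<lambda>x. x \<in> C)"
    "avg (indicator C) \<ge> cell_density q (real (r * \<sigma>)) b (e i)"
    "\<And>x y \<xi>. x \<in> C \<Longrightarrow> y \<in> C \<Longrightarrow> \<xi> \<in> \<Xi>' \<Longrightarrow> cmod (\<psi> (\<xi> * (x - y)) - 1) \<le> \<eta>"
    unfolding cell_density_def q_def by auto
  define \<beta> where "\<beta> = cell_density q (real (r * \<sigma>)) b (e i)"
  have \<beta>: "0 < \<beta>" "\<beta> \<le> 1" using cell_density_pos[OF q] cell_density_le_1[OF q] by (auto simp: \<beta>_def)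
  have "C \<noteq> {}" using C(2) \<beta> by (auto simp: \<beta>_def avg_def)
  then obtain y where y: "y \<in> C" by blast
  \<comment> \<open>The cell translated by one of its points: its elements are differences of points
    of \<open>C\<close>, and its density is that of \<open>C\<close>.\<close>
  define D where "D = {d. d + y \<in> C}"
  have per_D: "per (\<lambda>x. x \<in> D)"
    unfolding D_def mem_Collect_eq by (rule per_shift[OF C(1)])
  have avg_D: "avg (indicator D) = (avg (indicator C) :: real)"
  proof -
    have "per (indicator C :: 'a \<Rightarrow> real)"
      by (rule per_indicator[OF C(1)])
    from avg_shift[OF this, of y] show ?thesis by (simp add: D_def indicator_def[abs_def])
  qed
  have D_bohr: "cmod (\<psi> (\<xi> * d) - 1) \<le> \<eta>" if "d \<in> D" "\<xi> \<in> \<Xi>'" for d \<xi>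
    using C(3)[of "d + y" y \<xi>] that y by (simp add: D_def)
  have e_le: "e (Suc i) \<le> \<kappa> * \<beta>\<^sup>2" by (simp add: e_def \<beta>_def)
  have \<beta>2: "\<beta>\<^sup>2 \<le> \<beta>" using \<beta> by (simp add: power2_eq_square mult_left_le)
  have e_n: "e n \<le> e (Suc i)" unfolding e_def using i(1) by (intro level_antimono) simp
  have popular: "e n \<le> avg (\<lambda>d. G d * avg (\<lambda>x. F j (x + s * d) * F j x))"
    if j: "j \<in> J" and s: "s \<in> S" and G: "\<And>x. 0 \<le> G x" "\<And>x. G x \<le> indicator D x"
      and G_avg: "avg (indicator D) / (2 * real r) \<le> avg G" for j s G
  proof -
    define a where "a = (\<lambda>\<xi>. complex_of_real ((cmod (ft (f j) \<xi>))\<^sup>2))"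
    have norm_a: "cmod (a \<xi>) = (cmod (ft (f j) \<xi>))\<^sup>2" for \<xi>
      by (simp add: a_def norm_power)
    define L L' where "L = spec (f j) (e i)" and "L' = spec (f j) (e (Suc i))"
    define R where "R = synth a (I - L')"
    have L: "L \<subseteq> L'" "L' \<subseteq> I" "finite L'"
      unfolding L_def L'_def by (simp_all add: spec_antimono spec_subset e_def)
    have corr: "of_real (avg (\<lambda>x. F j (x + t) * F j x)) = synth a L t + synth a (L' - L) t + R t" for t
    proof -
      have "of_real (avg (\<lambda>x. F j (x + t) * F j x)) = avg (\<lambda>x. f j (x + t) * cnj (f j x))"
        by (simp add: avg_of_real[symmetric] f_def)
      also have "\<dots> = synth a I t"
        by (simp add: autocorrelation[OF per[OF j]] synth_def a_def)
      also have "\<dots> = synth a L t + synth a (L' - L) t + R t"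
        unfolding R_def synth_diff[OF L(1,2), symmetric] synth_diff[OF L(2) order_refl, symmetric] by simp
      finally show ?thesis .
    qed
    have dens: "\<theta>\<^sup>2 \<le> (\<Sum>\<xi>\<in>L. (cmod (ft (f j) \<xi>))\<^sup>2)"
    proof -
      have "ft (f j) (residue 0) = of_real (avg (F j))"
        unfolding per_residue[OF per_ft] by (simp add: ft_def f_def avg_of_real)
      then have c: "\<theta> \<le> cmod (ft (f j) (residue 0))" using \<theta>(1)[OF j] \<theta>(2) by simp
      have "e i \<le> \<theta>" unfolding e_def using level_antimono[of 0 i] by simp
      then have "residue 0 \<in> L" using c by (simp add: L_def spec_def)
      then have "(cmod (ft (f j) (residue 0)))\<^sup>2 \<le> (\<Sum>\<xi>\<in>L. (cmod (ft (f j) \<xi>))\<^sup>2)"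
        by (intro member_le_sum) (auto simp: L_def)
      moreover have "\<theta>\<^sup>2 \<le> (cmod (ft (f j) (residue 0)))\<^sup>2"
        using c \<theta> by (intro power_mono) auto
      ultimately show ?thesis by linarith
    qed
    have low: "3 / 4 * \<theta>\<^sup>2 \<le> Re (synth a L (s * d))" if d: "d \<in> D" for d
    proof -
      have "3 / 4 * \<theta>\<^sup>2 \<le> (\<Sum>\<xi>\<in>L. (cmod (ft (f j) \<xi>))\<^sup>2 * (3 / 4))"
        unfolding sum_distrib_right[symmetric] using dens by linarith
      also have "\<dots> \<le> (\<Sum>\<xi>\<in>L. (cmod (ft (f j) \<xi>))\<^sup>2 * Re (\<psi> (\<xi> * (s * d))))"
      proof (intro sum_mono mult_left_mono)
        fix \<xi> assume x: "\<xi> \<in> L"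
        have "\<xi> * s \<in> \<Xi>'" using x j s by (force simp: \<Xi>'_def L_def)
        from D_bohr[OF d this] have "cmod (\<psi> (\<xi> * (s * d)) - 1) \<le> 1 / 4" using \<eta>(2) by (simp add: mult.assoc)
        then show "3 / 4 \<le> Re (\<psi> (\<xi> * (s * d)))"
          using abs_Re_le_cmod[of "\<psi> (\<xi> * (s * d)) - 1"] by simp
      qed auto
      also have "\<dots> = Re (synth a L (s * d))"
        unfolding synth_def a_def Re_sum by simp
      finally show ?thesis .
    qed
    \<comment> \<open>The coefficients of an autocorrelation are squares, so the energy between the
      levels bounds this part for every \<open>t\<close>, not only on average.\<close>
    have mid: "cmod (synth a (L' - L) t) \<le> \<theta>\<^sup>2 / 4" for t
    proof -
      have "cmod (synth a (L' - L) t) \<le> (\<Sum>\<xi>\<in>L' - L. (cmod (ft (f j) \<xi>))\<^sup>2)"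
        unfolding synth_def by (rule order_trans[OF norm_sum]) (simp add: norm_mult a_def norm_power)
      also have "\<dots> \<le> (\<Sum>j\<in>J. \<Sum>\<xi>\<in>spec (f j) (e (Suc i)) - spec (f j) (e i). (cmod (ft (f j) \<xi>))\<^sup>2)"
        unfolding L_def L'_def
        by (rule member_le_sum[OF j _ J(1), of "\<lambda>j. \<Sum>\<xi>\<in>spec (f j) (e (Suc i)) - spec (f j) (e i). (cmod (ft (f j) \<xi>))\<^sup>2"])
          (simp add: sum_nonneg)
      also have "\<dots> \<le> real (card J) / real n" by (rule i(2))
      also have "\<dots> \<le> real r / real n" using J(2) by (intro divide_right_mono) auto
      also have "\<dots> \<le> \<theta>\<^sup>2 / 4" using n n0 \<theta>(2) by (simp add: field_simps)
      finally show ?thesis .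
    qed
    \<comment> \<open>A sum of fourth powers is at most the largest square times the energy.\<close>
    have "nrm R \<le> e (Suc i)"
    proof (rule power2_le_imp_le)
      have "(nrm R)\<^sup>2 = (\<Sum>\<xi>\<in>I - L'. (cmod (ft (f j) \<xi>))\<^sup>2 * (cmod (ft (f j) \<xi>))\<^sup>2)"
        unfolding R_def nrm_synth[OF Diff_subset] by (simp only: norm_a power2_eq_square)
      also have "\<dots> \<le> (\<Sum>\<xi>\<in>I - L'. (e (Suc i))\<^sup>2 * (cmod (ft (f j) \<xi>))\<^sup>2)"
        by (intro sum_mono mult_right_mono power_mono) (auto simp: L'_def spec_def)
      also have "\<dots> \<le> (e (Suc i))\<^sup>2 * 1"
        unfolding sum_distrib_left[symmetric]
        by (intro mult_left_mono energy_le_1[OF per[OF j] f1[OF j]]) auto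
      finally show "(nrm R)\<^sup>2 \<le> (e (Suc i))\<^sup>2" by simp
    qed (use e_pos[of "Suc i"] in simp)
    moreover have "avg (\<lambda>d. cmod (R (s * d))) \<le> nrm R"
    proof -
      have "avg (\<lambda>d. cmod (R (s * d))) = avg (\<lambda>d. cmod (R d) * cmod (1::complex))"
        using avg_scaled[OF per_comp[OF per_synth, of cmod] S(3)[OF s]] by (simp add: R_def)
      also have "\<dots> \<le> nrm R * nrm (\<lambda>x. 1)" by (rule avg_cauchy_schwarz)
      finally show ?thesis by (simp add: nrm_def)
    qed
    ultimately have R: "avg (\<lambda>d. cmod (R (s * d))) \<le> e (Suc i)" by linarith
    have "\<theta>\<^sup>2 / 2 * G d - cmod (R (s * d)) \<le> G d * avg (\<lambda>x. F j (x + s * d) * F j x)" for d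
    proof (cases "d \<in> D")
      case True
      have "avg (\<lambda>x. F j (x + s * d) * F j x) = Re (synth a L (s * d) + synth a (L' - L) (s * d) + R (s * d))"
        using corr[of "s * d"] by (metis Re_complex_of_real)
      moreover have "Re (synth a (L' - L) (s * d)) \<ge> - \<theta>\<^sup>2 / 4"
        using mid[of "s * d"] abs_Re_le_cmod[of "synth a (L' - L) (s * d)"] by linarith
      moreover have "Re (R (s * d)) \<ge> - cmod (R (s * d))"
        using abs_Re_le_cmod[of "R (s * d)"] by linarith
      ultimately have "\<theta>\<^sup>2 / 2 - cmod (R (s * d)) \<le> avg (\<lambda>x. F j (x + s * d) * F j x)"
        using low[OF True] by simp
      then have "G d * (\<theta>\<^sup>2 / 2 - cmod (R (s * d))) \<le> G d * avg (\<lambda>x. F j (x + s * d) * F j x)"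
        using G(1) by (intro mult_left_mono)
      moreover have "G d * cmod (R (s * d)) \<le> cmod (R (s * d))"
        using G(1,2)[of d] True by (intro mult_left_le_one_le) auto
      ultimately show ?thesis by (simp add: right_diff_distrib mult.commute)
    next
      case False
      then have "G d = 0" using G(1,2)[of d] by simp
      then show ?thesis by simp
    qed
    then have "avg (\<lambda>d. \<theta>\<^sup>2 / 2 * G d - cmod (R (s * d))) \<le> avg (\<lambda>d. G d * avg (\<lambda>x. F j (x + s * d) * F j x))"
      by (intro avg_mono)
    then have "\<theta>\<^sup>2 / 2 * avg G - e (Suc i) \<le> avg (\<lambda>d. G d * avg (\<lambda>x. F j (x + s * d) * F j x))"
      unfolding avg_diff avg_mult_left using R by linarith
    moreover have "2 * e (Suc i) \<le> \<theta>\<^sup>2 / 2 * avg G"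
    proof -
      \<comment> \<open>The value of \<open>\<kappa>\<close> is chosen so that, for a weight holding
        a fraction \<open>1 / (2 * real r)\<close> of \<open>D\<close>, the main term is at least
        twice the error.\<close>
      have "2 * e (Suc i) \<le> 2 * (\<kappa> * \<beta>)"
        using e_le mult_left_mono[OF \<beta>2, of \<kappa>] \<kappa> by linarith
      also have "\<dots> = \<theta>\<^sup>2 / 2 * (\<beta> / (2 * real r))" by (simp add: \<kappa>_def)
      also have "\<dots> \<le> \<theta>\<^sup>2 / 2 * (avg (indicator D) / (2 * real r))"
        using C(2) by (intro mult_left_mono divide_right_mono) (auto simp: avg_D \<beta>_def)
      also have "\<dots> \<le> \<theta>\<^sup>2 / 2 * avg G" using G_avg by (intro mult_left_mono) auto
      finally show ?thesis .
    qed
    ultimately show ?thesis using e_n by linarith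
  qed
  have "e n \<le> avg (indicator D)"
  proof -
    have "e n \<le> \<kappa> * \<beta>\<^sup>2" using e_n e_le by linarith
    also have "\<dots> \<le> 1 * \<beta>" using \<kappa> \<beta> \<beta>2 by (intro mult_mono) auto
    finally show ?thesis using C(2) by (simp add: avg_D \<beta>_def)
  qed
  then show ?thesis
    unfolding l_eq
    by (intro exI[of _ D] conjI per_D ballI allI impI popular) (auto intro!: D_bohr simp: \<Xi>'_def)
qed

text \<open>No colour has density between two suitable consecutive thresholds. By
  \<open>cover\<close> the colours of the points \<open>p * d\<close> share out \<open>D\<close>, so
  some colour receives a fraction at least \<open>1 / (2 * real r)\<close> of it. This forces its
  density above the lower threshold, hence above the upper one, where
  \<open>popular_differences\<close> applies to every \<open>s\<close> in \<open>S\<close> with the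
  same weight.\<close>

lemma colour_count:
  fixes A :: "'i \<Rightarrow> 'a set"
  assumes J: "finite J" "card J \<le> r" "r > 0"
    and A: "\<And>j. j \<in> J \<Longrightarrow> per (\<lambda>x. x \<in> A j)"
    and S: "finite S" "card S \<le> \<sigma>" "\<And>s. s \<in> S \<Longrightarrow> unit_mod s" and p: "unit_mod p"
    and \<Xi>: "finite \<Xi>" "card \<Xi> \<le> b" and \<eta>: "0 < \<eta>" "\<eta> \<le> 1 / 4"
    and cover: "\<And>d. (\<And>\<xi>. \<xi> \<in> \<Xi> \<Longrightarrow> cmod (\<psi> (\<xi> * d) - 1) \<le> \<eta>) \<Longrightarrow> \<exists>j\<in>J. p * d \<in> A j"
  shows "\<exists>j\<in>J. \<forall>s\<in>S. threshold r \<sigma> b \<eta> (Suc r) \<le>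
    avg (\<lambda>d. indicator (A j) (p * d) * avg (\<lambda>x. indicator (A j) (x + s * d) * indicator (A j) x))"
proof -
  define F :: "'i \<Rightarrow> 'a \<Rightarrow> real" where "F j = indicator (A j)" for j
  have per_F: "per (F j)" if "j \<in> J" for j
    unfolding F_def by (rule per_indicator[OF A[OF that]])
  have F01: "0 \<le> F j x" "F j x \<le> 1" for j x by (simp_all add: F_def indicator_def)
  define t where "t = threshold r \<sigma> b \<eta>"
  obtain i where i: "i \<le> r" "\<And>j. j \<in> J \<Longrightarrow> \<not> (t (Suc i) \<le> avg (F j) \<and> avg (F j) < t i)"
    using interval_gap[OF J(1,2), of t "\<lambda>j. avg (F j)"] threshold_antimono[OF J(3) \<eta>(1)] unfolding t_def by blast
  define H where "H = {j\<in>J. t i \<le> avg (F j)}"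
  define n where "n = nat \<lceil>4 * real r / (t i)\<^sup>2\<rceil>"
  define l where "l = level (arc_count \<eta>) (real (r * \<sigma>)) b ((t i)\<^sup>2 / (8 * real r)) (t i) n"
  have t_Suc: "t (Suc i) = l / (2 * real r)"
    by (simp add: t_def l_def n_def Let_def)
  have l_pos: "l > 0"
    unfolding l_def t_def using threshold_pos[OF J(3) \<eta>(1)] J(3) arc_count(1)[OF \<eta>(1)]
    by (intro level_pos divide_pos_pos zero_less_power) auto
  have "\<exists>D. per (\<lambda>x. x \<in> D) \<and> avg (indicator D) \<ge> l \<and>
     (\<forall>d\<in>D. \<forall>\<xi>\<in>\<Xi>. cmod (\<psi> (\<xi> * d) - 1) \<le> \<eta>) \<and>
     (\<forall>j\<in>H. \<forall>s\<in>S. \<forall>G. (\<forall>x. 0 \<le> G x \<and> G x \<le> indicator D x) \<longrightarrow> avg (indicator D) / (2 * real r) \<le> avg G \<longrightarrow>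
        l \<le> avg (\<lambda>d. G d * avg (\<lambda>x. F j (x + s * d) * F j x)))"
    unfolding l_def
  proof (rule popular_differences)
    have "card H \<le> card J" using J(1) by (intro card_mono) (auto simp: H_def)
    then show "card H \<le> r" using J(2) by simp
    show "4 * real r / (t i)\<^sup>2 \<le> real n" by (simp add: n_def)
    show "0 < t i" "t i \<le> 1" using threshold_pos threshold_le_1 J(3) \<eta>(1) by (auto simp: t_def)
  qed (use J S \<Xi> \<eta> per_F F01 in \<open>auto simp: H_def\<close>)
  then obtain D where D: "per (\<lambda>x. x \<in> D)" "avg (indicator D) \<ge> l"
    "\<And>d \<xi>. d \<in> D \<Longrightarrow> \<xi> \<in> \<Xi> \<Longrightarrow> cmod (\<psi> (\<xi> * d) - 1) \<le> \<eta>"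
    "\<And>j s G. j \<in> H \<Longrightarrow> s \<in> S \<Longrightarrow> (\<And>x. 0 \<le> G x \<and> G x \<le> indicator D x) \<Longrightarrow> avg (indicator D) / (2 * real r) \<le> avg G \<Longrightarrow>
        l \<le> avg (\<lambda>d. G d * avg (\<lambda>x. F j (x + s * d) * F j x))"
    by blast
  define G where "G j d = indicator D d * F j (p * d)" for j d
  have G01: "0 \<le> G j d \<and> G j d \<le> indicator D d" for j d
    by (simp add: G_def F_def indicator_def)
  have "\<exists>j\<in>J. avg (indicator D) / (2 * real r) \<le> avg (G j)"
  proof (rule ccontr)
    assume "\<not> ?thesis"
    then have less: "avg (G j) \<le> avg (indicator D) / (2 * real r)" if "j \<in> J" for j using that by force
    have "avg (indicator D) \<le> avg (\<lambda>d. \<Sum>j\<in>J. G j d)"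
    proof (rule avg_mono)
      fix d
      show "indicator D d \<le> (\<Sum>j\<in>J. G j d)"
      proof (cases "d \<in> D")
        case True
        then obtain j where j: "j \<in> J" "p * d \<in> A j" using cover[of d] D(3) by blast
        have "1 = G j d" using True j by (simp add: G_def F_def)
        also have "\<dots> \<le> (\<Sum>j\<in>J. G j d)"
          using G01 J(1) by (intro member_le_sum[OF j(1)]) auto
        finally show ?thesis using True by simp
      qed (use G01 in \<open>simp add: sum_nonneg\<close>)
    qed
    also have "\<dots> = (\<Sum>j\<in>J. avg (G j))" by (rule avg_sum)
    also have "\<dots> \<le> real (card J) * (avg (indicator D) / (2 * real r))"
      using sum_bounded_above[of J "\<lambda>j. avg (G j)", OF less] by simp
    also have "\<dots> \<le> real r * (avg (indicator D) / (2 * real r))"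
      using J(2) D(2) l_pos by (intro mult_right_mono) auto
    also have "\<dots> = avg (indicator D) / 2" using J(3) by simp
    finally show False using D(2) l_pos by simp
  qed
  then obtain j where j: "j \<in> J" "avg (indicator D) / (2 * real r) \<le> avg (G j)" by blast
  have "avg (G j) \<le> avg (\<lambda>d. F j (p * d))"
    by (intro avg_mono) (simp add: G_def F_def indicator_def)
  also have "\<dots> = avg (F j)" by (rule avg_scaled[OF per_F[OF j(1)] p])
  finally have "avg (indicator D) / (2 * real r) \<le> avg (F j)" using j(2) by linarith
  moreover have "l / (2 * real r) \<le> avg (indicator D) / (2 * real r)"
    using D(2) by (intro divide_right_mono) auto
  \<comment> \<open>The lower threshold \<open>t (Suc i)\<close> equals
    \<open>l / (2 * real r)\<close>, so the gap turns a density of at least this size into one of at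
    least \<open>t i\<close>.\<close>
  ultimately have "j \<in> H" using i(2)[OF j(1)] j(1) by (auto simp: H_def t_Suc)
  have "threshold r \<sigma> b \<eta> (Suc r) \<le>
    avg (\<lambda>d. F j (p * d) * avg (\<lambda>x. F j (x + s * d) * F j x))" if s: "s \<in> S" for s
  proof -
    have "threshold r \<sigma> b \<eta> (Suc r) \<le> t (Suc i)"
      unfolding t_def using i(1) by (intro threshold_antimono J(3) \<eta>(1)) simp
    also have "\<dots> \<le> l / 1"
      unfolding t_Suc using l_pos J(3) by (intro divide_left_mono) auto
    also have "l / 1 \<le> avg (\<lambda>d. G j d * avg (\<lambda>x. F j (x + s * d) * F j x))"
      using D(4)[OF \<open>j \<in> H\<close> s G01 j(2)] by simp
    also have "\<dots> \<le> avg (\<lambda>d. F j (p * d) * avg (\<lambda>x. F j (x + s * d) * F j x))"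
      by (intro avg_mono mult_right_mono avg_nonneg) (auto simp: G_def F_def indicator_def)
    finally show ?thesis .
  qed
  then show ?thesis using j(1) unfolding F_def by blast
qed

lemma count_schur:
  assumes "per f" "m dvd (s * k - 1)"
  shows "triple_count p (- p) k f f f 0 = avg (\<lambda>d. f (p * d) * avg (\<lambda>x. f (x + s * d) * f x))"
  using count_parametrize[OF assms(1,1,1), of p "- p" s 0 k] assms(2)
  by (simp add: avg_mult_left[symmetric] mult_ac)

end

section \<open>Gaussian integers\<close>

context residue_character
begin

text \<open>If \<open>w\<close> had no solution, its count would be 0; but on the Bohr set of
  \<open>Z\<close> it differs from the count at 0 by at most \<open>c / 4 + 2 * (c / 4)\<close>,
  which is less than \<open>c\<close>. \<open>Z\<close> is the spectrum of height
  \<open>c / 4\<close> pulled back along the unit \<open>c\<^sub>1\<close>, whence its size.\<close>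

lemma bohr_solutions:
  assumes A: "per (\<lambda>x. x \<in> A)" and unit: "unit_mod c\<^sub>1" "unit_mod c\<^sub>2" "m dvd (c\<^sub>3 * k - 1)"
    and c: "0 < c" "c \<le> Re (triple_count c\<^sub>1 c\<^sub>2 k (indicator A) (indicator A) (indicator A) 0)"
  shows "\<exists>Z\<subseteq>I. real (card Z) \<le> 16 / c\<^sup>2 \<and>
     (\<forall>w. (\<forall>\<zeta>\<in>Z. cmod (\<psi> (\<zeta> * w) - 1) \<le> c / 4) \<longrightarrow>
        (\<exists>x\<in>A. \<exists>y\<in>A. \<exists>z\<in>A. m dvd (c\<^sub>1 * x + c\<^sub>2 * y + c\<^sub>3 * z - w)))"
proof -
  define f :: "'a \<Rightarrow> complex" where "f = indicator A"
  have per: "per f" unfolding f_def by (rule per_indicator[OF A])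
  have f1: "cmod (f x) \<le> 1" for x by (simp add: f_def indicator_def)
  define Z where "Z = {\<zeta>\<in>I. c / 4 \<le> cmod (ft f (c\<^sub>1 * \<zeta>))}"
  have "real (card Z) * (c / 4)\<^sup>2 = (\<Sum>\<zeta>\<in>Z. (c / 4)\<^sup>2)" by simp
  also have "\<dots> \<le> (\<Sum>\<zeta>\<in>Z. (cmod (ft f (c\<^sub>1 * \<zeta>)))\<^sup>2)"
    using c(1) by (intro sum_mono power_mono) (auto simp: Z_def)
  also have "\<dots> \<le> (\<Sum>\<zeta>\<in>I. (cmod (ft f (c\<^sub>1 * \<zeta>)))\<^sup>2)"
    by (intro sum_mono2) (auto simp: Z_def)
  also have "\<dots> = (\<Sum>\<zeta>\<in>I. (cmod (ft f \<zeta>))\<^sup>2)"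
    using sum_affine[OF per_comp[OF per_ft, of "\<lambda>z. (cmod z)\<^sup>2" f] unit(1), of 0] by simp
  also have "\<dots> \<le> 1" by (rule energy_le_1[OF per f1 order_refl])
  finally have card: "real (card Z) \<le> 16 / c\<^sup>2" using c(1) by (simp add: power_divide field_simps)
  have "\<exists>x\<in>A. \<exists>y\<in>A. \<exists>z\<in>A. m dvd (c\<^sub>1 * x + c\<^sub>2 * y + c\<^sub>3 * z - w)"
    if w: "\<forall>\<zeta>\<in>Z. cmod (\<psi> (\<zeta> * w) - 1) \<le> c / 4" for w
  proof (rule ccontr)
    assume no: "\<not> ?thesis"
    let ?T = "triple_count c\<^sub>1 c\<^sub>2 k f f f"
    have "cmod (?T w - ?T 0) \<le> c / 4 + 2 * (c / 4)"
      by (rule count_stable[OF per f1 unit(2,3)]) (use w c(1) in \<open>auto simp: Z_def\<close>)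
    moreover have "?T w = 0"
    proof -
      have "f a * f b * f (k * (w - c\<^sub>1 * a - c\<^sub>2 * b)) = 0" for a b
      proof (rule ccontr)
        assume "\<not> ?thesis"
        then have "a \<in> A" "b \<in> A" "k * (w - c\<^sub>1 * a - c\<^sub>2 * b) \<in> A"
          by (auto simp: f_def indicator_def split: if_splits)
        moreover have "c\<^sub>1 * a + c\<^sub>2 * b + c\<^sub>3 * (k * (w - c\<^sub>1 * a - c\<^sub>2 * b)) - w
            = (c\<^sub>3 * k - 1) * (w - c\<^sub>1 * a - c\<^sub>2 * b)"
          by (simp add: algebra_simps)
        then have "m dvd (c\<^sub>1 * a + c\<^sub>2 * b + c\<^sub>3 * (k * (w - c\<^sub>1 * a - c\<^sub>2 * b)) - w)"
          using unit(3) by (metis dvd_mult2)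
        ultimately show False using no by blast
      qed
      then show ?thesis by (simp only: triple_count_def avg_const)
    qed
    ultimately have "cmod (?T 0) \<le> 3 / 4 * c" by simp
    then show False
      using c complex_Re_le_cmod[of "?T 0"] unfolding f_def by linarith
  qed
  then show ?thesis using card by (intro exI[of _ Z]) (auto simp: Z_def)
qed

end

section \<open>Chords of the circle and distance to the integers\<close>

lemma unit_exp_eq_cis: "unit_exp x = cis (2 * pi * x)"
  unfolding unit_exp_def cis_conv_exp by (simp add: mult_ac)

lemma norm_unit_exp [simp]: "cmod (unit_exp x) = 1"
  by (simp add: unit_exp_eq_cis)

lemma unit_exp_add: "unit_exp (x + y) = unit_exp x * unit_exp y"
  by (simp add: unit_exp_eq_cis cis_mult distrib_left)

lemma unit_exp_of_int [simp]: "unit_exp (of_int n) = 1"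
  using cis_multiple_2pi[of "of_int n"] by (simp add: unit_exp_eq_cis mult_ac)

lemma norm_unit_exp_minus_1: "(cmod (unit_exp x - 1))\<^sup>2 = 2 - 2 * cos (2 * pi * x)"
proof -
  have "(cmod (unit_exp x - 1))\<^sup>2 = (cos (2 * pi * x) - 1)\<^sup>2 + (sin (2 * pi * x))\<^sup>2"
    by (simp add: cmod_power2 unit_exp_eq_cis)
  then show ?thesis
    by (simp add: power2_diff sin_squared_eq)
qed

text \<open>The square root is the chord over the angle \<open>2 * pi * \<kappa>\<close>, and chords
  grow with the angle up to a half turn. Later this converts Bohr conditions into membership of a
  box.\<close>

lemma unit_exp_near_1:
  assumes "0 < \<kappa>" "\<kappa> \<le> 1 / 2" "cmod (unit_exp x - 1) \<le> sqrt (2 - 2 * cos (2 * pi * \<kappa>))"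
  shows "\<exists>n::int. \<bar>x - of_int n\<bar> \<le> \<kappa>"
proof (rule exI, rule ccontr)
  let ?y = "x - of_int (round x)"
  assume less: "\<not> \<bar>?y\<bar> \<le> \<kappa>"
  have "\<bar>?y\<bar> \<le> 1 / 2" using of_int_round_abs_le[of x] by (simp add: abs_minus_commute)
  then have "2 * pi * \<bar>?y\<bar> \<le> 2 * pi * (1 / 2)" by (intro mult_left_mono) auto
  then have "cos (2 * pi * \<bar>?y\<bar>) < cos (2 * pi * \<kappa>)"
    using less assms by (intro cos_monotone_0_pi) auto
  moreover have "cos (2 * pi * \<bar>?y\<bar>) = cos (2 * pi * ?y)"
    by (metis abs_mult abs_of_pos cos_abs_real mult_pos_pos pi_gt_zero zero_less_numeral)
  moreover have "unit_exp ?y = unit_exp x"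
    using unit_exp_add[of ?y "of_int (round x)"] by simp
  then have "2 - 2 * cos (2 * pi * ?y) \<le> 2 - 2 * cos (2 * pi * \<kappa>)"
    using assms(3) norm_unit_exp_minus_1[of ?y] by (metis cos_le_one norm_ge_zero real_le_lsqrt real_sqrt_le_iff real_sqrt_unique)
  ultimately show False by simp
qed

section \<open>The Gaussian integers as a ring type\<close>

text \<open>The locale needs a ring type in which \<open>dvd\<close> is divisibility of Gaussian
  integers; on the complex numbers \<open>dvd\<close> would be divisibility in a field.\<close>

datatype gint = Gint (gre: int) (gim: int)

instantiation gint :: comm_ring_1
begin
definition "0 = Gint 0 0"
definition "1 = Gint 1 0"
definition "x + y = Gint (gre x + gre y) (gim x + gim y)"
definition "x - y = Gint (gre x - gre y) (gim x - gim y)"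
definition "- x = Gint (- gre x) (- gim x)"
definition "x * y = Gint (gre x * gre y - gim x * gim y) (gre x * gim y + gim x * gre y)"
instance
  by standard
    (auto simp: zero_gint_def one_gint_def plus_gint_def minus_gint_def uminus_gint_def times_gint_def algebra_simps
      intro: gint.expand)
end

lemma gint_simps [simp]:
  "gre 0 = 0" "gim 0 = 0" "gre 1 = 1" "gim 1 = 0"
  "gre (x + y) = gre x + gre y" "gim (x + y) = gim x + gim y"
  "gre (x - y) = gre x - gre y" "gim (x - y) = gim x - gim y"
  "gre (- x) = - gre x" "gim (- x) = - gim x"
  "gre (x * y) = gre x * gre y - gim x * gim y" "gim (x * y) = gre x * gim y + gim x * gre y"
  by (simp_all add: zero_gint_def one_gint_def plus_gint_def minus_gint_def uminus_gint_def times_gint_def)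

lemma gint_of_nat [simp]: "gre (of_nat n) = int n" "gim (of_nat n) = 0"
  by (induction n) auto

lemma gint_of_int [simp]: "gre (of_int n) = n" "gim (of_int n) = 0"
  by (cases n; simp)+

lemma gint_eq_iff: "x = y \<longleftrightarrow> gre x = gre y \<and> gim x = gim y"
  by (auto intro: gint.expand)

lemma of_nat_dvd_gint_iff: "of_nat M dvd (z :: gint) \<longleftrightarrow> int M dvd gre z \<and> int M dvd gim z"
proof
  assume "int M dvd gre z \<and> int M dvd gim z"
  then obtain a b where "gre z = int M * a" "gim z = int M * b" by (auto elim!: dvdE)
  then have "z = of_nat M * Gint a b" by (simp add: gint_eq_iff)
  then show "of_nat M dvd z" by simp
qed (auto elim!: dvdE)

definition residues_mod :: "nat \<Rightarrow> gint set" where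
  "residues_mod M = {z. gre z \<in> {0..<int M} \<and> gim z \<in> {0..<int M}}"

text \<open>The real part alone suffices for nondegeneracy, because multiplying the argument by i
  moves the imaginary part, up to sign, into its place.\<close>

definition gchar :: "nat \<Rightarrow> gint \<Rightarrow> complex" where
  "gchar M z = unit_exp (of_int (gre z) / real M)"

lemma residues_mod_eq: "residues_mod M = (\<lambda>(a, b). Gint a b) ` ({0..<int M} \<times> {0..<int M})"
  by (auto simp: residues_mod_def image_iff gint_eq_iff intro!: exI[of _ "gre _"] exI[of _ "gim _"])

lemma card_residues_mod: "card (residues_mod M) = M\<^sup>2" and finite_residues_mod: "finite (residues_mod M)"
proof -
  have "inj_on (\<lambda>(a, b). Gint a b) ({0..<int M} \<times> {0..<int M})" by (auto simp: inj_on_def)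
  then show "card (residues_mod M) = M\<^sup>2"
    unfolding residues_mod_eq by (simp add: card_image card_cartesian_product power2_eq_square)
qed (simp add: residues_mod_eq)

lemma unit_exp_eq_1_imp: "unit_exp x = 1 \<Longrightarrow> \<exists>n::int. x = of_int n"
proof -
  assume "unit_exp x = 1"
  then have "cos (2 * pi * x) = 1" using norm_unit_exp_minus_1[of x] by simp
  then obtain n :: int where "2 * pi * x = of_int n * 2 * pi" using cos_one_2pi_int by blast
  then show ?thesis by (intro exI[of _ n]) simp
qed

lemma residue_character_gint:
  assumes "M > 0"
  shows "residue_character (residues_mod M) (of_nat M) (gchar M)"
proof
  show "finite (residues_mod M)" by (rule finite_residues_mod)
  fix x y \<xi> :: gint
  show "\<exists>!y. y \<in> residues_mod M \<and> of_nat M dvd (x - y)"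
  proof (rule ex1I)
    show "Gint (gre x mod int M) (gim x mod int M) \<in> residues_mod M
        \<and> of_nat M dvd (x - Gint (gre x mod int M) (gim x mod int M))"
      using assms by (simp add: residues_mod_def of_nat_dvd_gint_iff)
    fix y assume y: "y \<in> residues_mod M \<and> of_nat M dvd (x - y)"
    then have "gre x mod int M = gre y mod int M" "gim x mod int M = gim y mod int M"
      by (simp_all add: of_nat_dvd_gint_iff mod_eq_dvd_iff)
    then show "y = Gint (gre x mod int M) (gim x mod int M)"
      using y by (simp add: residues_mod_def gint_eq_iff)
  qed
  show "gchar M (x + y) = gchar M x * gchar M y"
    by (simp add: gchar_def add_divide_distrib unit_exp_add)
  show "cmod (gchar M x) = 1" by (simp add: gchar_def)
  show "gchar M (of_nat M * x) = 1" using assms by (simp add: gchar_def)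
  assume n: "\<not> of_nat M dvd \<xi>"
  show "\<exists>t. gchar M (\<xi> * t) \<noteq> 1"
  proof (rule ccontr)
    have dvd: "int M dvd a" if a: "unit_exp (of_int a / real M) = 1" for a
    proof -
      obtain n :: int where "of_int a / real M = of_int n" using unit_exp_eq_1_imp[OF a] by blast
      then have "real_of_int a = of_int (int M * n)" using assms by (simp add: field_simps)
      then show ?thesis by (simp only: of_int_eq_iff) simp
    qed
    assume "\<not> ?thesis"
    then have "gchar M (\<xi> * 1) = 1" "gchar M (\<xi> * Gint 0 1) = 1" by blast+
    then have "int M dvd gre \<xi>" "int M dvd - gim \<xi>"
      by (auto simp only: gchar_def intro!: dvd) simp_all
    then show False using n by (simp add: of_nat_dvd_gint_iff)
  qed
qed

section \<open>Boxes, periodization and the modulus\<close>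

text \<open>The sum norm is the factor by which multiplication by \<open>z\<close> can enlarge the
  maximum norm, so it measures the growth of boxes.\<close>

definition gsize :: "gint \<Rightarrow> nat" where
  "gsize z = nat (\<bar>gre z\<bar> + \<bar>gim z\<bar>)"

lemma gsize_pos: "z \<noteq> 0 \<Longrightarrow> gsize z > 0"
  by (auto simp: gsize_def gint_eq_iff)

lemma int_gsize: "int (gsize z) = \<bar>gre z\<bar> + \<bar>gim z\<bar>"
  by (simp add: gsize_def)

definition gbox :: "nat \<Rightarrow> gint set" where
  "gbox N = {z. \<bar>gre z\<bar> \<le> int N \<and> \<bar>gim z\<bar> \<le> int N}"

lemma abs_mult_le_gsize:
  assumes "\<bar>gre z\<bar> \<le> B" "\<bar>gim z\<bar> \<le> B"
  shows "\<bar>gre (c * z)\<bar> \<le> int (gsize c) * B" "\<bar>gim (c * z)\<bar> \<le> int (gsize c) * B"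
proof -
  have *: "\<bar>gre c\<bar> * B + \<bar>gim c\<bar> * B = int (gsize c) * B" by (simp add: int_gsize distrib_right)
  have "\<bar>gre c * gre z\<bar> \<le> \<bar>gre c\<bar> * B" "\<bar>gim c * gim z\<bar> \<le> \<bar>gim c\<bar> * B"
    "\<bar>gre c * gim z\<bar> \<le> \<bar>gre c\<bar> * B" "\<bar>gim c * gre z\<bar> \<le> \<bar>gim c\<bar> * B"
    unfolding abs_mult using assms by (simp_all add: mult_left_mono)
  then show "\<bar>gre (c * z)\<bar> \<le> int (gsize c) * B" "\<bar>gim (c * z)\<bar> \<le> int (gsize c) * B"
    unfolding gint_simps *[symmetric] by linarith+
qed

definition periodized :: "nat \<Rightarrow> nat \<Rightarrow> gint set \<Rightarrow> gint set" where
  "periodized M N A = {x. \<exists>a\<in>A \<inter> gbox N. of_nat M dvd (x - a)}"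

text \<open>After moving to representatives in the box, both coordinates of the defect are divisible
  by \<open>M\<close> and smaller than \<open>M\<close> in absolute value, so they vanish.\<close>

lemma periodized_solution:
  assumes "x \<in> periodized M N A" "y \<in> periodized M N A" "z \<in> periodized M N A"
    and dvd: "of_nat M dvd (c\<^sub>1 * x + c\<^sub>2 * y + c\<^sub>3 * z - w)"
    and M: "N * (gsize c\<^sub>1 + gsize c\<^sub>2 + gsize c\<^sub>3) + gsize w < M"
  shows "\<exists>a\<in>A. \<exists>b\<in>A. \<exists>c\<in>A. w = c\<^sub>1 * a + c\<^sub>2 * b + c\<^sub>3 * c"
proof -
  obtain a b c where abc: "a \<in> A \<inter> gbox N" "b \<in> A \<inter> gbox N" "c \<in> A \<inter> gbox N"
    "of_nat M dvd (x - a)" "of_nat M dvd (y - b)" "of_nat M dvd (z - c)"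
    using assms(1-3) unfolding periodized_def by blast
  let ?v = "c\<^sub>1 * a + c\<^sub>2 * b + c\<^sub>3 * c - w"
  have "?v = (c\<^sub>1 * x + c\<^sub>2 * y + c\<^sub>3 * z - w) - (c\<^sub>1 * (x - a) + c\<^sub>2 * (y - b) + c\<^sub>3 * (z - c))"
    by (simp add: algebra_simps)
  then have "of_nat M dvd ?v"
    using abc dvd by (metis dvd_add dvd_diff dvd_mult)
  then have d: "int M dvd gre ?v" "int M dvd gim ?v"
    by (simp_all only: of_nat_dvd_gint_iff)
  have M': "int (gsize c\<^sub>1) * int N + int (gsize c\<^sub>2) * int N + int (gsize c\<^sub>3) * int N + \<bar>gre w\<bar> + \<bar>gim w\<bar> < int M"
    using M unfolding of_nat_less_iff[symmetric, where 'a=int] by (simp add: int_gsize algebra_simps)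
  have ineq: "\<bar>gre (u * t)\<bar> \<le> int (gsize u) * int N" "\<bar>gim (u * t)\<bar> \<le> int (gsize u) * int N"
    if "t \<in> A \<inter> gbox N" for u t
    using abs_mult_le_gsize[of t "int N" u] that by (auto simp: gbox_def)
  have bound: "\<bar>p + q + r - t\<bar> < int M"
    if "\<bar>p\<bar> \<le> int (gsize c\<^sub>1) * int N" "\<bar>q\<bar> \<le> int (gsize c\<^sub>2) * int N" "\<bar>r\<bar> \<le> int (gsize c\<^sub>3) * int N"
      "\<bar>t\<bar> \<le> \<bar>gre w\<bar> + \<bar>gim w\<bar>" for p q r t
    using that M' by linarith
  have "\<bar>gre ?v\<bar> < int M"
    unfolding gint_simps(5-8) by (intro bound ineq abc) simp
  moreover have "\<bar>gim ?v\<bar> < int M"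
    unfolding gint_simps(5-8) by (intro bound ineq abc) simp
  moreover have "x = 0" if "int M dvd x" "\<bar>x\<bar> < int M" for x
    using that dvd_imp_le_int[of x "int M"] by force
  ultimately have "gre ?v = 0" "gim ?v = 0"
    using d by blast+
  then have "?v = 0" unfolding gint_eq_iff[of ?v 0] by simp
  then show ?thesis using abc by force
qed

text \<open>The factor \<open>c * N\<close> excludes wrap-around for boxes of size \<open>N\<close>,
  while the modulus stays at most a constant times \<open>N\<close>.\<close>

definition gmodulus :: "gint set \<Rightarrow> nat \<Rightarrow> nat \<Rightarrow> nat" where
  "gmodulus U c N = c * N * (\<Prod>u\<in>U. nat ((gre u)\<^sup>2 + (gim u)\<^sup>2)) + 1"

lemma gnorm_pos: "u \<noteq> 0 \<Longrightarrow> nat ((gre u)\<^sup>2 + (gim u)\<^sup>2) > 0"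
  by (auto simp: gint_eq_iff sum_power2_gt_zero_iff)

text \<open>With \<open>u\<close> times its conjugate equal to the norm and the modulus equal to
  norm times \<open>q\<close> plus 1, the inverse is minus the conjugate times
  \<open>q\<close>.\<close>

lemma gmodulus_inverse:
  assumes "finite U" "u \<in> U" "0 \<notin> U"
  shows "\<exists>k. of_nat (gmodulus U c N) dvd (u * k - 1)"
proof -
  let ?n = "\<lambda>u. nat ((gre u)\<^sup>2 + (gim u)\<^sup>2)"
  define q where "q = c * N * (\<Prod>v\<in>U - {u}. ?n v)"
  have g: "gmodulus U c N = ?n u * q + 1"
    using prod.remove[OF assms(1,2), of ?n] by (simp add: gmodulus_def q_def)
  have u: "u * Gint (gre u) (- gim u) = of_nat (?n u)"
    by (simp add: gint_eq_iff power2_eq_square)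
  have "u * (- (Gint (gre u) (- gim u) * of_nat q)) - 1 = - (u * Gint (gre u) (- gim u) * of_nat q + 1)"
    by (simp add: mult.assoc)
  also have "\<dots> = - of_nat (gmodulus U c N)" unfolding u g by simp
  finally show ?thesis by (metis dvd_minus_iff dvd_refl)
qed

lemma gmodulus_bounds:
  assumes "finite U" "0 \<notin> U"
  shows "c * N < gmodulus U c N"
    and "N > 0 \<Longrightarrow> gmodulus U c N \<le> gmodulus U c 1 * N"
proof -
  have "1 \<le> (\<Prod>u\<in>U. nat ((gre u)\<^sup>2 + (gim u)\<^sup>2))"
    using assms gnorm_pos by (intro prod_ge_1) (metis One_nat_def Suc_leI)
  then show "c * N < gmodulus U c N"
    unfolding gmodulus_def by (metis Suc_eq_plus1 le_imp_less_Suc mult.right_neutral mult_le_mono2)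
  show "gmodulus U c N \<le> gmodulus U c 1 * N" if "N > 0"
    using that by (simp add: gmodulus_def algebra_simps)
qed

section \<open>Bohr sets up to a scale and their limits\<close>

text \<open>The conclusion available from a single modulus, which says nothing about large
  \<open>w\<close>. Bounding the frequencies by 1 provides the compactness for the limit.\<close>

definition bohr_up_to :: "nat \<Rightarrow> real \<Rightarrow> gint set \<Rightarrow> nat \<Rightarrow> bool" where
  "bohr_up_to k \<eta> S N \<longleftrightarrow> (\<exists>\<alpha> \<beta> :: nat \<Rightarrow> real. (\<forall>j. \<bar>\<alpha> j\<bar> \<le> 1 \<and> \<bar>\<beta> j\<bar> \<le> 1) \<and>
     (\<forall>w. gsize w \<le> N \<longrightarrow> (\<forall>j\<in>{1..k}. cmod (unit_exp (of_int (gre w) * \<alpha> j + of_int (gim w) * \<beta> j) - 1) < \<eta>)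
        \<longrightarrow> w \<in> S))"

lemma finite_family_convergent_subseq:
  fixes X :: "'i \<Rightarrow> nat \<Rightarrow> real"
  assumes "finite J" "\<And>j n. \<bar>X j n\<bar> \<le> 1"
  shows "\<exists>r. strict_mono (r :: nat \<Rightarrow> nat) \<and> (\<forall>j\<in>J. convergent (X j \<circ> r))"
  using assms(1)
proof (induction J rule: finite_induct)
  case empty
  show ?case by (rule exI[of _ id]) (simp add: strict_mono_def)
next
  case (insert i J)
  then obtain r :: "nat \<Rightarrow> nat" where r: "strict_mono r" "\<And>j. j \<in> J \<Longrightarrow> convergent (X j \<circ> r)" by blast
  have "bounded (range (X i \<circ> r))"
    unfolding bounded_iff using assms(2) by (intro exI[of _ 1]) auto
  then obtain l r' where r': "strict_mono (r' :: nat \<Rightarrow> nat)" "((X i \<circ> r) \<circ> r') \<longlonglongrightarrow> l"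
    using bounded_imp_convergent_subsequence by blast
  have "convergent (X j \<circ> (r \<circ> r'))" if "j \<in> insert i J" for j
  proof (cases "j = i")
    case True
    then show ?thesis using r'(2) by (auto simp: convergent_def o_assoc)
  next
    case False
    then show ?thesis
      using convergent_subseq_convergent[OF r(2) r'(1), of j] that by (simp add: o_assoc)
  qed
  then show ?case using strict_mono_o[OF r(1) r'(1)] by blast
qed

text \<open>The frequencies converge along a subsequence. For fixed \<open>w\<close> the strict
  inequalities at the limit are open conditions, so they hold far along it, where the scale also
  exceeds \<open>gsize w\<close>.\<close>

lemma bohr_compactness:
  assumes "\<exists>\<^sub>F N in sequentially. bohr_up_to k \<eta> S N"
  shows "\<exists>\<alpha> \<beta> :: nat \<Rightarrow> real. \<forall>w. (\<forall>j\<in>{1..k}. cmod (unit_exp (of_int (gre w) * \<alpha> j + of_int (gim w) * \<beta> j) - 1) < \<eta>)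
        \<longrightarrow> w \<in> S"
proof -
  have "\<forall>n. \<exists>N\<ge>n. bohr_up_to k \<eta> S N"
    using assms by (auto simp: frequently_sequentially)
  then obtain g where g: "\<And>n. g n \<ge> n" "\<And>n. bohr_up_to k \<eta> S (g n)" by metis
  from g(2) obtain a b :: "nat \<Rightarrow> nat \<Rightarrow> real" where ab: "\<And>n j. \<bar>a n j\<bar> \<le> 1 \<and> \<bar>b n j\<bar> \<le> 1"
    "\<And>n w. gsize w \<le> g n \<Longrightarrow>
      (\<And>j. j \<in> {1..k} \<Longrightarrow> cmod (unit_exp (of_int (gre w) * a n j + of_int (gim w) * b n j) - 1) < \<eta>) \<Longrightarrow> w \<in> S"
    unfolding bohr_up_to_def by metis
  define X where "X = case_sum (\<lambda>j n. a n j) (\<lambda>j n. b n j)"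
  have "\<bar>X j n\<bar> \<le> 1" for j n using ab(1) by (auto simp: X_def split: sum.split)
  then obtain r where r: "strict_mono (r :: nat \<Rightarrow> nat)"
    "\<And>j. j \<in> {1..k} <+> {1..k} \<Longrightarrow> convergent (X j \<circ> r)"
    using finite_family_convergent_subseq[of "{1..k} <+> {1..k}" X] by auto
  define \<alpha> \<beta> where "\<alpha> j = lim (X (Inl j) \<circ> r)" and "\<beta> j = lim (X (Inr j) \<circ> r)" for j
  have lim: "(\<lambda>n. a (r n) j) \<longlonglongrightarrow> \<alpha> j" "(\<lambda>n. b (r n) j) \<longlonglongrightarrow> \<beta> j" if "j \<in> {1..k}" for j
  proof -
    have "convergent (X (Inl j) \<circ> r)" "convergent (X (Inr j) \<circ> r)" using that by (auto intro!: r(2))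
    then show "(\<lambda>n. a (r n) j) \<longlonglongrightarrow> \<alpha> j" "(\<lambda>n. b (r n) j) \<longlonglongrightarrow> \<beta> j"
      by (simp_all add: convergent_LIMSEQ_iff \<alpha>_def \<beta>_def X_def o_def)
  qed
  have "w \<in> S" if w: "\<forall>j\<in>{1..k}. cmod (unit_exp (of_int (gre w) * \<alpha> j + of_int (gim w) * \<beta> j) - 1) < \<eta>" for w
  proof -
    have "\<forall>\<^sub>F n in sequentially. cmod (unit_exp (of_int (gre w) * a (r n) j + of_int (gim w) * b (r n) j) - 1) < \<eta>"
      if j: "j \<in> {1..k}" for j
    proof (rule order_tendstoD(2))
      show "(\<lambda>n. cmod (unit_exp (of_int (gre w) * a (r n) j + of_int (gim w) * b (r n) j) - 1))
        \<longlonglongrightarrow> cmod (unit_exp (of_int (gre w) * \<alpha> j + of_int (gim w) * \<beta> j) - 1)"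
        unfolding unit_exp_def by (intro tendsto_intros lim j)
    qed (use w j in blast)
    then have "\<forall>\<^sub>F n in sequentially. \<forall>j\<in>{1..k}. cmod (unit_exp (of_int (gre w) * a (r n) j + of_int (gim w) * b (r n) j) - 1) < \<eta>"
      by (simp add: eventually_ball_finite)
    moreover have "\<forall>\<^sub>F n in sequentially. gsize w \<le> n" by (rule eventually_ge_at_top)
    ultimately have "\<forall>\<^sub>F n in sequentially. w \<in> S"
    proof eventually_elim
      case (elim n)
      have "gsize w \<le> g (r n)" using elim(2) seq_suble[OF r(1), of n] g(1)[of "r n"] by linarith
      then show ?case using ab(2)[of w "r n"] elim(1) by blast
    qed
    then show ?thesis by simp
  qed
  then show ?thesis by blast
qed

lemma per_periodized:
  assumes "M > 0"
  shows "residue_character.per (of_nat M) (\<lambda>x. x \<in> periodized M N A)"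
proof -
  interpret residue_character "residues_mod M" "of_nat M" "gchar M"
    by (rule residue_character_gint[OF assms])
  have *: "y \<in> periodized M N A" if xy: "of_nat M dvd (y - x)" "x \<in> periodized M N A" for x y
  proof -
    obtain a where a: "a \<in> A \<inter> gbox N" "of_nat M dvd (x - a)" using xy(2) unfolding periodized_def by blast
    then have "of_nat M dvd (y - a)" using dvd_add[OF xy(1) a(2)] by simp
    then show ?thesis using a(1) unfolding periodized_def by blast
  qed
  show ?thesis unfolding per_def
  proof (intro allI impI iffI)
    fix x y :: gint assume xy: "of_nat M dvd (x - y)"
    have yx: "of_nat M dvd (y - x)" using dvd_minus_iff[of "of_nat M" "x - y"] xy by simp
    show "y \<in> periodized M N A" if "x \<in> periodized M N A" using *[OF yx that] .
    show "x \<in> periodized M N A" if "y \<in> periodized M N A" using *[OF xy that] .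
  qed
qed

lemma bohr_up_to_of_count:
  fixes c\<^sub>1 c\<^sub>2 c\<^sub>3 :: gint
  assumes "M > 0" "residue_character.unit_mod (of_nat M) c\<^sub>1" "residue_character.unit_mod (of_nat M) c\<^sub>2"
    "of_nat M dvd (c\<^sub>3 * k - 1)"
    and c: "0 < c" "c \<le> Re (residue_character.triple_count (residues_mod M) c\<^sub>1 c\<^sub>2 k
      (indicator (periodized M N A)) (indicator (periodized M N A)) (indicator (periodized M N A)) 0)"
    and M: "N * (gsize c\<^sub>1 + gsize c\<^sub>2 + gsize c\<^sub>3) + N < M"
  shows "bohr_up_to (nat \<lceil>16 / c\<^sup>2\<rceil>) (c / 4) {c\<^sub>1 * x + c\<^sub>2 * y + c\<^sub>3 * z |x y z. x \<in> A \<and> y \<in> A \<and> z \<in> A} N"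
proof -
  interpret residue_character "residues_mod M" "of_nat M" "gchar M"
    by (rule residue_character_gint[OF assms(1)])
  from bohr_solutions[OF per_periodized[OF assms(1)] assms(2-4) c] obtain Z where Z: "Z \<subseteq> residues_mod M" "real (card Z) \<le> 16 / c\<^sup>2"
    "\<And>w. \<forall>\<zeta>\<in>Z. cmod (gchar M (\<zeta> * w) - 1) \<le> c / 4 \<Longrightarrow>
        \<exists>x\<in>periodized M N A. \<exists>y\<in>periodized M N A. \<exists>z\<in>periodized M N A. of_nat M dvd (c\<^sub>1 * x + c\<^sub>2 * y + c\<^sub>3 * z - w)"
    by auto
  have finZ: "finite Z" using Z(1) finite_residues_mod finite_subset by blast
  obtain h where h: "bij_betw h {1..card Z} Z" using ex_bij_betw_nat_finite_1[OF finZ] by blast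
  have cardZ: "card Z \<le> nat \<lceil>16 / c\<^sup>2\<rceil>" using Z(2) by linarith
  define \<alpha> where "\<alpha> j = (if j \<in> {1..card Z} then of_int (gre (h j)) / real M else 0)" for j
  define \<beta> where "\<beta> j = (if j \<in> {1..card Z} then - of_int (gim (h j)) / real M else 0)" for j
  have "\<bar>\<alpha> j\<bar> \<le> 1 \<and> \<bar>\<beta> j\<bar> \<le> 1" for j
  proof (cases "j \<in> {1..card Z}")
    case True
    then have "h j \<in> residues_mod M" using h Z(1) by (auto simp: bij_betw_def)
    then show ?thesis using True by (auto simp: \<alpha>_def \<beta>_def residues_mod_def)
  qed (auto simp: \<alpha>_def \<beta>_def)
  moreover have "w \<in> {c\<^sub>1 * x + c\<^sub>2 * y + c\<^sub>3 * z |x y z. x \<in> A \<and> y \<in> A \<and> z \<in> A}"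
    if w: "gsize w \<le> N" "\<forall>j\<in>{1..nat \<lceil>16 / c\<^sup>2\<rceil>}. cmod (unit_exp (of_int (gre w) * \<alpha> j + of_int (gim w) * \<beta> j) - 1) < c / 4" for w
  proof -
    have "cmod (gchar M (\<zeta> * w) - 1) \<le> c / 4" if z: "\<zeta> \<in> Z" for \<zeta>
    proof -
      have "\<zeta> \<in> h ` {1..card Z}"
        by (simp only: bij_betw_imp_surj_on[OF h] z)
      then obtain j where j: "j \<in> {1..card Z}" "h j = \<zeta>" by blast
      have "of_int (gre w) * \<alpha> j + of_int (gim w) * \<beta> j = of_int (gre (\<zeta> * w)) / real M"
        using j by (simp add: \<alpha>_def \<beta>_def diff_divide_distrib mult.commute)
      then show ?thesis using w(2) j(1) cardZ by (force simp: gchar_def)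
    qed
    then obtain x y z where xyz: "x \<in> periodized M N A" "y \<in> periodized M N A" "z \<in> periodized M N A"
      "of_nat M dvd (c\<^sub>1 * x + c\<^sub>2 * y + c\<^sub>3 * z - w)" using Z(3) by blast
    have "N * (gsize c\<^sub>1 + gsize c\<^sub>2 + gsize c\<^sub>3) + gsize w < M" using M w(1) by linarith
    from periodized_solution[OF xyz this] show ?thesis by blast
  qed
  ultimately show ?thesis unfolding bohr_up_to_def by blast
qed

section \<open>The dense and the coloured case\<close>

text \<open>The box has side less than \<open>M + 1\<close>, so reduction is injective on it and no
  points of \<open>A\<close> are merged.\<close>

lemma avg_periodized_ge:
  assumes "2 * N < M"
  shows "real (card (A \<inter> gbox N)) / (real M)\<^sup>2 \<le> residue_character.avg (residues_mod M) (indicator (periodized M N A))"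
proof -
  interpret residue_character "residues_mod M" "of_nat M" "gchar M"
    by (rule residue_character_gint) (use assms in simp)
  have "inj_on residue (A \<inter> gbox N)"
  proof (rule inj_onI)
    fix x y assume xy: "x \<in> A \<inter> gbox N" "y \<in> A \<inter> gbox N" "residue x = residue y"
    have "of_nat M dvd ((x - residue x) - (y - residue y))"
      by (intro dvd_diff residue_dvd)
    then have "int M dvd gre x - gre y" "int M dvd gim x - gim y"
      using xy(3) by (simp_all add: of_nat_dvd_gint_iff)
    moreover have "\<bar>gre x - gre y\<bar> < int M" "\<bar>gim x - gim y\<bar> < int M"
      using xy(1,2) assms by (auto simp: gbox_def)
    moreover have "t = 0" if "int M dvd t" "\<bar>t\<bar> < int M" for t
      using that dvd_imp_le_int[of t "int M"] by force
    ultimately have "gre x - gre y = 0" "gim x - gim y = 0" by blast+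
    then show "x = y" by (simp add: gint_eq_iff)
  qed
  moreover have "residue ` (A \<inter> gbox N) \<subseteq> {x \<in> residues_mod M. x \<in> periodized M N A}"
  proof safe
    fix x assume x: "x \<in> A" "x \<in> gbox N"
    have "of_nat M dvd (residue x - x)"
      using residue_dvd[of x] dvd_minus_iff[of "of_nat M" "x - residue x"] by simp
    then show "residue x \<in> periodized M N A" using x unfolding periodized_def by blast
  qed (rule residue_in)
  ultimately have "card (A \<inter> gbox N) \<le> card {x \<in> residues_mod M. x \<in> periodized M N A}"
    by (rule card_inj_on_le) (simp add: finite_residues_mod)
  moreover have "avg (indicator (periodized M N A)) = real (card {x \<in> residues_mod M. x \<in> periodized M N A}) / (real M)\<^sup>2"
    by (simp add: avg_def card_residues_mod indicator_def sum.If_cases Int_def divide_inverse mult.commute)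
  ultimately show ?thesis by (simp add: divide_right_mono)
qed

lemma dense_case:
  fixes s\<^sub>1 s\<^sub>2 s\<^sub>3 :: gint
  assumes "s\<^sub>1 \<noteq> 0" "s\<^sub>2 \<noteq> 0" "s\<^sub>3 \<noteq> 0" "s\<^sub>1 + s\<^sub>2 + s\<^sub>3 = 0" "0 < \<delta>"
  shows "\<exists>k. \<exists>\<eta>>0. \<forall>A. (\<exists>\<^sub>F N in sequentially. \<delta> < real (card (A \<inter> gbox N)) / (2 * real N + 1)\<^sup>2) \<longrightarrow>
     (\<exists>\<^sub>F N in sequentially. bohr_up_to k \<eta> {s\<^sub>1 * x + s\<^sub>2 * y + s\<^sub>3 * z |x y z. x \<in> A \<and> y \<in> A \<and> z \<in> A} N)"
proof -
  define U where "U = {s\<^sub>1, s\<^sub>2, s\<^sub>3}"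
  define g where "g = gsize s\<^sub>1 + gsize s\<^sub>2 + gsize s\<^sub>3"
  \<comment> \<open>Exceeding \<open>(g + 2) * N\<close> covers both \<open>N * g + N < M\<close>,
    for lifting solutions, and \<open>2 * N < M\<close>, for transferring density.\<close>
  define M where "M = gmodulus U (g + 2)"
  define Q where "Q = M 1"
  \<comment> \<open>The box has more than \<open>4 * N\<^sup>2\<close> points and the quotient at
    most \<open>(Q * N)\<^sup>2\<close>.\<close>
  define \<delta>' where "\<delta>' = 4 * \<delta> / (real Q)\<^sup>2"
  define n where "n = nat \<lceil>(16 / \<delta>'^4)\<^sup>2\<rceil>"
  define c where "c = level (arc_count (\<delta>'^4 / 16)) 2 0 (\<delta>'^4 / 8) \<delta>' n"
  have U: "finite U" "0 \<notin> U" using assms by (auto simp: U_def)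
  have M: "(g + 2) * N < M N" "N > 0 \<Longrightarrow> M N \<le> Q * N" for N
    unfolding Q_def M_def by (rule gmodulus_bounds[OF U])+
  have "Q > 0" using M(1)[of 1] by (simp add: Q_def)
  then have \<delta>': "\<delta>' > 0" using assms(5) by (simp add: \<delta>'_def)
  have c: "c > 0" unfolding c_def by (intro level_pos arc_count(1)) (use \<delta>' in auto)
  have "bohr_up_to (nat \<lceil>16 / c\<^sup>2\<rceil>) (c / 4) {s\<^sub>1 * x + s\<^sub>2 * y + s\<^sub>3 * z |x y z. x \<in> A \<and> y \<in> A \<and> z \<in> A} N"
    if N: "N > 0" "\<delta> < real (card (A \<inter> gbox N)) / (2 * real N + 1)\<^sup>2" for A N
  proof -
    have pos: "M N > 0" using M(1)[of N] by linarith
    interpret residue_character "residues_mod (M N)" "of_nat (M N)" "gchar (M N)"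
      by (rule residue_character_gint[OF pos])
    have unit: "\<exists>k. of_nat (M N) dvd (u * k - 1)" if "u \<in> U" for u
      unfolding M_def by (rule gmodulus_inverse[OF U(1) that U(2)])
    then have units: "unit_mod s\<^sub>1" "unit_mod s\<^sub>2" unfolding unit_mod_def U_def by auto
    obtain k where k: "of_nat (M N) dvd (s\<^sub>3 * k - 1)" using unit[of s\<^sub>3] by (auto simp: U_def)
    define P where "P = periodized (M N) N A"
    have perP: "per (\<lambda>x. x \<in> P)" unfolding P_def by (rule per_periodized[OF pos])
    have dens: "\<delta>' \<le> avg (indicator P)"
    proof -
      have MQ: "(real (M N))\<^sup>2 \<le> (real Q * real N)\<^sup>2"
        using M(2)[OF N(1)] by (intro power_mono) (simp_all flip: of_nat_mult)
      have "\<delta>' = \<delta> * (2 * real N)\<^sup>2 / (real Q * real N)\<^sup>2"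
        using N(1) by (simp add: \<delta>'_def power_mult_distrib)
      also have "\<dots> \<le> \<delta> * (2 * real N + 1)\<^sup>2 / (real Q * real N)\<^sup>2"
        using assms(5) by (intro divide_right_mono mult_left_mono power_mono) auto
      also have "\<dots> \<le> \<delta> * (2 * real N + 1)\<^sup>2 / (real (M N))\<^sup>2"
        using MQ pos assms(5) N(1) \<open>Q > 0\<close> by (intro divide_left_mono mult_pos_pos zero_less_power) auto
      also have "\<dots> \<le> real (card (A \<inter> gbox N)) / (real (M N))\<^sup>2"
        using N(2) by (intro divide_right_mono) (auto simp: pos_less_divide_eq)
      also have "\<dots> \<le> avg (indicator P)"
        unfolding P_def by (rule avg_periodized_ge) (use M(1)[of N] in \<open>simp add: algebra_simps\<close>)
      finally show ?thesis .
    qed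
    have "c \<le> Re (triple_count s\<^sub>1 s\<^sub>2 k (indicator P) (indicator P) (indicator P) 0)"
      unfolding c_def
    proof (rule roth_count[OF per_indicator[OF perP] _ _ dens \<delta>' assms(4) units k])
      show "(16 / \<delta>' ^ 4)\<^sup>2 \<le> real n" by (simp add: n_def)
      show "indicator P = (\<lambda>x. complex_of_real (indicator P x))" by (auto simp: indicator_def)
    qed (auto simp: indicator_def)
    then show ?thesis
      unfolding P_def by (intro bohr_up_to_of_count[OF pos units k c])
        (use M(1)[of N] N(1) in \<open>auto simp: g_def algebra_simps\<close>)
  qed
  note main = this
  have "\<exists>\<^sub>F N in sequentially. bohr_up_to (nat \<lceil>16 / c\<^sup>2\<rceil>) (c / 4) {s\<^sub>1 * x + s\<^sub>2 * y + s\<^sub>3 * z |x y z. x \<in> A \<and> y \<in> A \<and> z \<in> A} N"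
    if "\<exists>\<^sub>F N in sequentially. \<delta> < real (card (A \<inter> gbox N)) / (2 * real N + 1)\<^sup>2" for A
    by (rule frequently_rev_mp[OF that]) (auto intro!: main eventually_mono[OF eventually_gt_at_top[of 0]])
  then show ?thesis using c by (intro exI[of _ "nat \<lceil>16 / c\<^sup>2\<rceil>"] exI[of _ "c / 4"]) simp
qed

text \<open>A whole finite set \<open>S\<close> is treated with one colour, as (c) requires; (b) is
  the case of a singleton.\<close>

lemma colour_case:
  fixes p :: gint
  assumes "p \<noteq> 0" "finite S" "0 \<notin> S"
  shows "\<exists>k. \<exists>\<eta>>0. \<forall>A. (\<Union>j\<in>{1..r}. A j) = UNIV \<longrightarrow>
     (\<exists>j\<in>{1..r::nat}. \<forall>s\<in>S. \<exists>\<^sub>F N in sequentially.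
        bohr_up_to k \<eta> {p * x + (- p) * y + s * z |x y z. x \<in> A j \<and> y \<in> A j \<and> z \<in> A j} N)"
proof (cases "r = 0")
  case True
  then show ?thesis by (intro exI[of _ 0] exI[of _ 1]) auto
next
  case False
  define U where "U = insert p S"
  \<comment> \<open>Summing over \<open>S\<close> lets the same modulus serve all
    multipliers.\<close>
  define g where "g = 2 * gsize p + (\<Sum>s\<in>S. gsize s)"
  define M where "M = gmodulus U (g + 1)"
  define Q where "Q = M 1"
  \<comment> \<open>Then \<open>M N * \<kappa>\<close> is at most \<open>N / gsize p\<close>, so
    multiplication by \<open>p\<close> keeps the reduced \<open>d\<close> inside the box of size
    \<open>N\<close>.\<close>
  define \<kappa> where "\<kappa> = 1 / (real Q * real (gsize p))"
  define \<eta> where "\<eta> = min (1 / 4) (sqrt (2 - 2 * cos (2 * pi * \<kappa>)))"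
  define c where "c = threshold r (card S) 2 \<eta> (Suc r)"
  have U: "finite U" "0 \<notin> U" using assms by (auto simp: U_def)
  have M: "(g + 1) * N < M N" "N > 0 \<Longrightarrow> M N \<le> Q * N" for N
    unfolding Q_def M_def by (rule gmodulus_bounds[OF U])+
  have Q: "Q \<ge> 2" using M(1)[of 1] by (simp add: Q_def)
  have gp: "gsize p \<ge> 1" using gsize_pos[OF assms(1)] by simp
  have \<kappa>: "0 < \<kappa>" "\<kappa> \<le> 1 / 2"
  proof -
    have "2 * 1 \<le> real Q * real (gsize p)" using Q gp by (intro mult_mono) auto
    then show "0 < \<kappa>" "\<kappa> \<le> 1 / 2" by (auto simp: \<kappa>_def field_simps)
  qed
  have "cos (2 * pi * \<kappa>) < cos 0" using \<kappa> by (intro cos_monotone_0_pi) auto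
  then have \<eta>: "0 < \<eta>" "\<eta> \<le> 1 / 4" by (auto simp: \<eta>_def)
  have c: "c > 0" unfolding c_def using False \<eta> by (intro threshold_pos) auto
  have "\<exists>j\<in>{1..r}. \<forall>s\<in>S. bohr_up_to (nat \<lceil>16 / c\<^sup>2\<rceil>) (c / 4)
      {p * x + (- p) * y + s * z |x y z. x \<in> A j \<and> y \<in> A j \<and> z \<in> A j} N"
    if N: "N > 0" and A: "(\<Union>j\<in>{1..r}. A j) = UNIV" for A N
  proof -
    have pos: "M N > 0" using M(1)[of N] by linarith
    interpret residue_character "residues_mod (M N)" "of_nat (M N)" "gchar (M N)"
      by (rule residue_character_gint[OF pos])
    have unit: "\<exists>k. of_nat (M N) dvd (u * k - 1)" if "u \<in> U" for u
      unfolding M_def by (rule gmodulus_inverse[OF U(1) that U(2)])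
    then have units: "unit_mod u" if "u \<in> U" for u unfolding unit_mod_def using that by blast
    define P where "P j = periodized (M N) N (A j)" for j
    have perP: "per (\<lambda>x. x \<in> P j)" for j unfolding P_def by (rule per_periodized[OF pos])
    \<comment> \<open>The Bohr conditions at 1 and i put \<open>d\<close> close to a multiple of the
      modulus. The nearby representative \<open>d'\<close> has \<open>p * d'\<close> in the box,
      where the colouring is still visible.\<close>
    have "\<exists>j\<in>{1..r}. p * d \<in> P j"
      if d: "\<And>\<xi>. \<xi> \<in> {1, Gint 0 1} \<Longrightarrow> cmod (gchar (M N) (\<xi> * d) - 1) \<le> \<eta>" for d
    proof -
      have "cmod (unit_exp (of_int (gre d) / real (M N)) - 1) \<le> sqrt (2 - 2 * cos (2 * pi * \<kappa>))"
        "cmod (unit_exp (- of_int (gim d) / real (M N)) - 1) \<le> sqrt (2 - 2 * cos (2 * pi * \<kappa>))"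
        using d[of 1] d[of "Gint 0 1"] by (simp_all add: \<eta>_def gchar_def)
      then obtain a b :: int where ab: "\<bar>of_int (gre d) / real (M N) - of_int a\<bar> \<le> \<kappa>"
        "\<bar>- of_int (gim d) / real (M N) - of_int b\<bar> \<le> \<kappa>"
        using unit_exp_near_1[OF \<kappa>] by meson
      have scale: "real (M N) * \<bar>x / real (M N) - y\<bar> = \<bar>x - real (M N) * y\<bar>" for x y
      proof -
        have "x - real (M N) * y = real (M N) * (x / real (M N) - y)"
          using pos by (simp add: right_diff_distrib)
        then show ?thesis by (simp add: abs_mult)
      qed
      \<comment> \<open>The sign changes in the second coordinate because the character at
        \<open>Gint 0 1\<close> sees minus the imaginary part.\<close>
      define d' where "d' = Gint (gre d - int (M N) * a) (gim d + int (M N) * b)"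
      have "of_int \<bar>gre d'\<bar> = real (M N) * \<bar>of_int (gre d) / real (M N) - of_int a\<bar>"
        unfolding scale by (simp add: d'_def)
      also have "\<dots> \<le> real (M N) * \<kappa>" using ab(1) by (intro mult_left_mono) auto
      finally have re: "\<bar>gre d'\<bar> \<le> \<lfloor>real (M N) * \<kappa>\<rfloor>" by (simp only: le_floor_iff)
      have "of_int \<bar>gim d'\<bar> = real (M N) * \<bar>- of_int (gim d) / real (M N) - of_int b\<bar>"
        unfolding scale by (simp add: d'_def)
      also have "\<dots> \<le> real (M N) * \<kappa>" using ab(2) by (intro mult_left_mono) auto
      finally have im: "\<bar>gim d'\<bar> \<le> \<lfloor>real (M N) * \<kappa>\<rfloor>" by (simp only: le_floor_iff)
      have "real_of_int (int (gsize p) * \<lfloor>real (M N) * \<kappa>\<rfloor>) \<le> real (gsize p) * (real (M N) * \<kappa>)"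
        by simp (intro mult_left_mono; simp)
      also have "\<dots> = real (M N) / real Q" using gp by (simp add: \<kappa>_def)
      also have "\<dots> \<le> real N"
      proof -
        have "real (M N) \<le> real Q * real N" using M(2)[OF N] by (simp flip: of_nat_mult)
        then show ?thesis using Q by (simp add: field_simps)
      qed
      finally have "int (gsize p) * \<lfloor>real (M N) * \<kappa>\<rfloor> \<le> int N" by linarith
      then have box: "p * d' \<in> gbox N"
        unfolding gbox_def using abs_mult_le_gsize[OF re im, of p] by (auto simp del: gint_simps)
      obtain j where j: "j \<in> {1..r}" "p * d' \<in> A j" using A by blast
      have "of_nat (M N) dvd (d - d')" by (simp add: of_nat_dvd_gint_iff d'_def)
      then have "of_nat (M N) dvd (p * d - p * d')"
        unfolding right_diff_distrib[symmetric] by (rule dvd_mult)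
      then show ?thesis using j box unfolding P_def periodized_def by blast
    qed
    note cover = this
    have "\<exists>j\<in>{1..r}. \<forall>s\<in>S. c \<le> avg (\<lambda>d. indicator (P j) (p * d) * avg (\<lambda>x. indicator (P j) (x + s * d) * indicator (P j) x))"
      unfolding c_def
    proof (rule colour_count[where \<Xi> = "{1, Gint 0 1}"])
      show "card {1, Gint 0 1} \<le> 2" by (simp add: card_insert_if)
    qed (use False perP assms units \<eta> cover in \<open>auto simp: U_def\<close>)
    then obtain j where j: "j \<in> {1..r}"
      "\<And>s. s \<in> S \<Longrightarrow> c \<le> avg (\<lambda>d. indicator (P j) (p * d) * avg (\<lambda>x. indicator (P j) (x + s * d) * indicator (P j) x))"
      by blast
    have "bohr_up_to (nat \<lceil>16 / c\<^sup>2\<rceil>) (c / 4)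
      {p * x + (- p) * y + s * z |x y z. x \<in> A j \<and> y \<in> A j \<and> z \<in> A j} N" if s: "s \<in> S" for s
    proof -
      obtain k where k: "of_nat (M N) dvd (s * k - 1)" using unit[of s] s by (auto simp: U_def)
      have up: "unit_mod p" "unit_mod (- p)" using units[of p] unit_mod_minus by (auto simp: U_def)
      have ind: "indicator (P j) = (\<lambda>x. complex_of_real (indicator (P j) x))"
        by (auto simp: indicator_def)
      have "triple_count p (- p) k (indicator (P j)) (indicator (P j)) (indicator (P j)) 0
         = of_real (avg (\<lambda>d. indicator (P j) (p * d) * avg (\<lambda>x. indicator (P j) (x + s * d) * indicator (P j) x)))"
        unfolding count_schur[OF per_indicator[OF perP] k] avg_of_real[symmetric] of_real_mult of_real_indicator ..
      then have "c \<le> Re (triple_count p (- p) k (indicator (P j)) (indicator (P j)) (indicator (P j)) 0)"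
        using j(2)[OF s] by simp
      moreover have "N * (gsize p + gsize (- p) + gsize s) + N < M N"
      proof -
        have "gsize s \<le> (\<Sum>s\<in>S. gsize s)" using assms(2) s by (intro member_le_sum) auto
        then have "gsize p + gsize (- p) + gsize s \<le> g" by (simp add: g_def gsize_def)
        then have "N * (gsize p + gsize (- p) + gsize s) + N \<le> (g + 1) * N"
          by (simp add: algebra_simps) (metis add_mult_distrib2 mult_le_mono2)
        then show ?thesis using M(1)[of N] by linarith
      qed
      ultimately show ?thesis
        unfolding P_def by (intro bohr_up_to_of_count[OF pos up k c])
    qed
    then show ?thesis using j(1) by blast
  qed
  note main = this
  have "\<exists>j\<in>{1..r}. \<forall>s\<in>S. \<exists>\<^sub>F N in sequentially. bohr_up_to (nat \<lceil>16 / c\<^sup>2\<rceil>) (c / 4)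
      {p * x + (- p) * y + s * z |x y z. x \<in> A j \<and> y \<in> A j \<and> z \<in> A j} N"
    if A: "(\<Union>j\<in>{1..r}. A j) = UNIV" for A
  proof -
    let ?B = "\<lambda>j s N. bohr_up_to (nat \<lceil>16 / c\<^sup>2\<rceil>) (c / 4)
      {p * x + (- p) * y + s * z |x y z. x \<in> A j \<and> y \<in> A j \<and> z \<in> A j} N"
    have "\<forall>\<^sub>F N in sequentially. \<exists>j\<in>{1..r}. \<forall>s\<in>S. ?B j s N"
      by (rule eventually_mono[OF eventually_gt_at_top[of 0]]) (rule main[OF _ A])
    then have "\<exists>\<^sub>F N in sequentially. \<exists>j\<in>{1..r}. \<forall>s\<in>S. ?B j s N"
      by (rule eventually_frequently[rotated]) simp
    \<comment> \<open>The colour found depends on \<open>N\<close>; there are finitely many colours,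
      so one of them occurs for arbitrarily large \<open>N\<close>.\<close>
    then obtain j where j: "j \<in> {1..r}" "\<exists>\<^sub>F N in sequentially. \<forall>s\<in>S. ?B j s N"
      by (subst (asm) frequently_bex_finite_distrib) auto
    then show ?thesis by (intro bexI[of _ j] ballI) (auto elim: frequently_elim1)
  qed
  then show ?thesis using c by (intro exI[of _ "nat \<lceil>16 / c\<^sup>2\<rceil>"] exI[of _ "c / 4"]) simp
qed

section \<open>Transfer to subsets of the complex numbers\<close>

definition of_gint :: "gint \<Rightarrow> complex" where
  "of_gint z = Complex (of_int (gre z)) (of_int (gim z))"

lemma of_gint_simps [simp]:
  "Re (of_gint z) = of_int (gre z)" "Im (of_gint z) = of_int (gim z)"
  "of_gint (x + y) = of_gint x + of_gint y" "of_gint (x * y) = of_gint x * of_gint y"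
  "of_gint (x - y) = of_gint x - of_gint y"
  "of_gint 0 = 0" "of_gint 1 = 1"
  by (simp_all add: of_gint_def complex_eq_iff)

lemma of_gint_in [simp]: "of_gint z \<in> gauss_ints"
  by (simp add: gauss_ints_def)

lemma gauss_intsE: "z \<in> gauss_ints \<Longrightarrow> (\<And>t. z = of_gint t \<Longrightarrow> thesis) \<Longrightarrow> thesis"
  unfolding gauss_ints_def of_gint_def
  by (auto elim!: Ints_cases) (metis complex_surj gint.sel)

lemma inj_of_gint: "inj of_gint"
  by (auto simp: inj_def complex_eq_iff gint_eq_iff)

lemma bohr_set_of_bohr_up_to:
  assumes "\<exists>\<^sub>F N in sequentially. bohr_up_to k \<eta> S N"
  shows "\<exists>B. is_bohr_set_with k \<eta> B \<and> B \<subseteq> of_gint ` S"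
proof -
  obtain \<alpha> \<beta> :: "nat \<Rightarrow> real" where ab:
    "\<And>w. \<forall>j\<in>{1..k}. cmod (unit_exp (of_int (gre w) * \<alpha> j + of_int (gim w) * \<beta> j) - 1) < \<eta> \<Longrightarrow> w \<in> S"
    using bohr_compactness[OF assms] by blast
  define B where "B = {z \<in> gauss_ints. \<forall>j\<in>{1..k}. cmod (unit_exp (Re z * \<alpha> j + Im z * \<beta> j) - 1) < \<eta>}"
  have "B \<subseteq> of_gint ` S"
  proof
    fix z assume z: "z \<in> B"
    then have "z \<in> gauss_ints" by (simp add: B_def)
    then obtain t where "z = of_gint t" by (rule gauss_intsE)
    then show "z \<in> of_gint ` S" using z by (auto simp: B_def intro!: ab)
  qed
  then show ?thesis unfolding is_bohr_set_with_def B_def by blast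
qed

lemma card_gauss_box:
  "A \<subseteq> gauss_ints \<Longrightarrow> card (A \<inter> gauss_box N) = card ({z. of_gint z \<in> A} \<inter> gbox N)"
proof -
  assume A: "A \<subseteq> gauss_ints"
  have "\<bar>real_of_int x\<bar> \<le> real N \<longleftrightarrow> \<bar>x\<bar> \<le> int N" for x by linarith
  then have "A \<inter> gauss_box N = of_gint ` ({z. of_gint z \<in> A} \<inter> gbox N)"
    using A by (auto simp: gauss_box_def gbox_def elim!: gauss_intsE)
  then show ?thesis by (simp add: card_image inj_on_subset[OF inj_of_gint])
qed

lemma upper_density_frequently:
  assumes "A \<subseteq> gauss_ints" "upper_density A = ereal \<delta>" "\<epsilon> < \<delta>"
  shows "\<exists>\<^sub>F N in sequentially. \<epsilon> < real (card ({z. of_gint z \<in> A} \<inter> gbox N)) / (2 * real N + 1)\<^sup>2"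
proof (rule ccontr)
  assume "\<not> ?thesis"
  then have "\<forall>\<^sub>F N in sequentially. ereal (real (card (A \<inter> gauss_box N)) / (2 * real N + 1)\<^sup>2) \<le> ereal \<epsilon>"
    by (simp add: not_frequently not_less card_gauss_box[OF assms(1)])
  then have "upper_density A \<le> ereal \<epsilon>"
    unfolding upper_density_def by (rule Limsup_bounded)
  then show False using assms(2,3) by simp
qed

lemma cover_gint:
  assumes "gauss_ints = (\<Union>j\<in>{1..r}. A j)"
  shows "(\<Union>j\<in>{1..r}. {z. of_gint z \<in> A j}) = UNIV"
  using assms of_gint_in by blast

theorem theorem1p9:
  fixes s\<^sub>1 s\<^sub>2 s\<^sub>3 :: complex
  assumes "s\<^sub>1 \<in> gauss_ints - {0}" "s\<^sub>2 \<in> gauss_ints - {0}" "s\<^sub>3 \<in> gauss_ints - {0}"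
    and "s\<^sub>1 + s\<^sub>2 + s\<^sub>3 = 0"
  shows
    "(\<forall>\<delta>::real. \<delta> > 0 \<longrightarrow>
        (\<exists>k::nat. \<exists>\<eta>::real. \<eta> > 0 \<and>
          (\<forall>A. A \<subseteq> gauss_ints \<and> upper_density A = ereal \<delta> \<longrightarrow>
             (\<exists>B. is_bohr_set_with k \<eta> B \<and> B \<subseteq> s\<^sub>1 *o A + s\<^sub>2 *o A + s\<^sub>3 *o A))))
     \<and> (\<forall>r::nat. \<exists>k::nat. \<exists>\<eta>::real. \<eta> > 0 \<and>
          (\<forall>A :: nat \<Rightarrow> complex set. gauss_ints = (\<Union>j\<in>{1..r}. A j) \<longrightarrow>
             (\<exists>j\<in>{1..r}. \<exists>B. is_bohr_set_with k \<eta> B \<and>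
                B \<subseteq> diffset (s\<^sub>1 *o A j) (s\<^sub>1 *o A j) + s\<^sub>2 *o A j)))
     \<and> (\<forall>(r::nat) (A :: nat \<Rightarrow> complex set). gauss_ints = (\<Union>j\<in>{1..r}. A j) \<longrightarrow>
          (\<exists>j\<in>{1..r}. \<forall>s\<in>gauss_ints - {0}. \<exists>B. is_bohr_set B \<and>
             B \<subseteq> diffset (A j) (A j) + s *o A j))"
proof (intro conjI allI impI)
  obtain t\<^sub>1 t\<^sub>2 t\<^sub>3 where t: "s\<^sub>1 = of_gint t\<^sub>1" "s\<^sub>2 = of_gint t\<^sub>2" "s\<^sub>3 = of_gint t\<^sub>3"
    using assms by (metis DiffD1 gauss_intsE)
  have nz: "t\<^sub>1 \<noteq> 0" "t\<^sub>2 \<noteq> 0" "t\<^sub>3 \<noteq> 0" using assms t by auto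
  have "of_gint (t\<^sub>1 + t\<^sub>2 + t\<^sub>3) = of_gint 0" using assms(4) t by simp
  then have sum0: "t\<^sub>1 + t\<^sub>2 + t\<^sub>3 = 0" using inj_of_gint by (blast dest: injD)
  {
    fix \<delta> :: real assume \<delta>: "\<delta> > 0"
    \<comment> \<open>An upper density of \<open>\<delta>\<close> guarantees densities above any
      smaller number infinitely often; half of it is a convenient choice.\<close>
    obtain k \<eta> where k: "\<eta> > 0" "\<And>A. \<exists>\<^sub>F N in sequentially. \<delta> / 2 < real (card (A \<inter> gbox N)) / (2 * real N + 1)\<^sup>2 \<Longrightarrow>
      \<exists>\<^sub>F N in sequentially. bohr_up_to k \<eta> {t\<^sub>1 * x + t\<^sub>2 * y + t\<^sub>3 * z |x y z. x \<in> A \<and> y \<in> A \<and> z \<in> A} N"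
      using dense_case[OF nz sum0, of "\<delta> / 2"] \<delta> by auto
    have "\<exists>B. is_bohr_set_with k \<eta> B \<and> B \<subseteq> s\<^sub>1 *o A + s\<^sub>2 *o A + s\<^sub>3 *o A"
      if A: "A \<subseteq> gauss_ints" "upper_density A = ereal \<delta>" for A
    proof -
      let ?A = "{z. of_gint z \<in> A}"
      have "\<exists>\<^sub>F N in sequentially. bohr_up_to k \<eta> {t\<^sub>1 * x + t\<^sub>2 * y + t\<^sub>3 * z |x y z. x \<in> ?A \<and> y \<in> ?A \<and> z \<in> ?A} N"
        using \<delta> by (intro k(2) upper_density_frequently[OF A]) simp
      moreover have "of_gint ` {t\<^sub>1 * x + t\<^sub>2 * y + t\<^sub>3 * z |x y z. x \<in> ?A \<and> y \<in> ?A \<and> z \<in> ?A}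
          \<subseteq> s\<^sub>1 *o A + s\<^sub>2 *o A + s\<^sub>3 *o A"
        unfolding t elt_set_times_def by (auto intro!: set_plus_intro)
      ultimately show ?thesis using bohr_set_of_bohr_up_to by (meson order_trans)
    qed
    then show "\<exists>k \<eta>. \<eta> > 0 \<and> (\<forall>A. A \<subseteq> gauss_ints \<and> upper_density A = ereal \<delta> \<longrightarrow>
             (\<exists>B. is_bohr_set_with k \<eta> B \<and> B \<subseteq> s\<^sub>1 *o A + s\<^sub>2 *o A + s\<^sub>3 *o A))"
      using k(1) by blast
  }
  have sub: "of_gint ` {p * x + (- p) * y + s * z |x y z. x \<in> {z. of_gint z \<in> A} \<and> y \<in> {z. of_gint z \<in> A} \<and> z \<in> {z. of_gint z \<in> A}}
      \<subseteq> diffset (of_gint p *o A) (of_gint p *o A) + of_gint s *o A" for p s A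
  proof safe
    fix x y z assume xyz: "of_gint x \<in> A" "of_gint y \<in> A" "of_gint z \<in> A"
    have "of_gint p * of_gint x - of_gint p * of_gint y \<in> diffset (of_gint p *o A) (of_gint p *o A)"
      unfolding diffset_def elt_set_times_def using xyz by blast
    moreover have "of_gint s * of_gint z \<in> of_gint s *o A"
      unfolding elt_set_times_def using xyz by blast
    ultimately have "(of_gint p * of_gint x - of_gint p * of_gint y) + of_gint s * of_gint z
        \<in> diffset (of_gint p *o A) (of_gint p *o A) + of_gint s *o A"
      by (rule set_plus_intro)
    then show "of_gint (p * x + (- p) * y + s * z) \<in> diffset (of_gint p *o A) (of_gint p *o A) + of_gint s *o A"
      by simp
  qed
  {
    fix r :: nat
    obtain k \<eta> where k: "\<eta> > 0" "\<And>A. (\<Union>j\<in>{1..r}. A j) = UNIV \<Longrightarrow> \<exists>j\<in>{1..r}. \<exists>\<^sub>F N in sequentially.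
        bohr_up_to k \<eta> {t\<^sub>1 * x + (- t\<^sub>1) * y + t\<^sub>2 * z |x y z. x \<in> A j \<and> y \<in> A j \<and> z \<in> A j} N"
      using colour_case[OF nz(1), of "{t\<^sub>2}" r] nz(2) by auto
    have "\<exists>j\<in>{1..r}. \<exists>B. is_bohr_set_with k \<eta> B \<and> B \<subseteq> diffset (s\<^sub>1 *o A j) (s\<^sub>1 *o A j) + s\<^sub>2 *o A j"
      if A: "gauss_ints = (\<Union>j\<in>{1..r}. A j)" for A
      using k(2)[OF cover_gint[OF A]] bohr_set_of_bohr_up_to sub[of t\<^sub>1 t\<^sub>2] unfolding t
      by (meson order_trans)
    then show "\<exists>k \<eta>. \<eta> > 0 \<and> (\<forall>A. gauss_ints = (\<Union>j\<in>{1..r}. A j) \<longrightarrow>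
             (\<exists>j\<in>{1..r}. \<exists>B. is_bohr_set_with k \<eta> B \<and>
                B \<subseteq> diffset (s\<^sub>1 *o A j) (s\<^sub>1 *o A j) + s\<^sub>2 *o A j))"
      using k(1) by blast
  }
  {
    fix r :: nat and A :: "nat \<Rightarrow> complex set"
    assume A: "gauss_ints = (\<Union>j\<in>{1..r}. A j)"
    show "\<exists>j\<in>{1..r}. \<forall>s\<in>gauss_ints - {0}. \<exists>B. is_bohr_set B \<and> B \<subseteq> diffset (A j) (A j) + s *o A j"
    proof (rule ccontr)
      assume no: "\<not> ?thesis"
      \<comment> \<open>Each colour is assumed to fail for some multiplier. These form a finite set,
        for all of which \<open>colour_case\<close> provides a common colour, and that colour has to
        succeed for its own bad multiplier.\<close>
      have "\<forall>j\<in>{1..r}. \<exists>t. t \<noteq> 0 \<and> (\<forall>B. is_bohr_set B \<longrightarrow> \<not> B \<subseteq> diffset (A j) (A j) + of_gint t *o A j)"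
      proof (intro ballI)
        fix j assume "j \<in> {1..r}"
        then obtain s where s: "s \<in> gauss_ints - {0}" "\<And>B. is_bohr_set B \<Longrightarrow> \<not> B \<subseteq> diffset (A j) (A j) + s *o A j"
          using no by blast
        from s(1) obtain t where t: "s = of_gint t" by (auto elim: gauss_intsE)
        have "t \<noteq> 0" using s(1) t by auto
        then show "\<exists>t. t \<noteq> 0 \<and> (\<forall>B. is_bohr_set B \<longrightarrow> \<not> B \<subseteq> diffset (A j) (A j) + of_gint t *o A j)"
          using s(2) unfolding t by blast
      qed
      then obtain t where t: "\<And>j. j \<in> {1..r} \<Longrightarrow> t j \<noteq> 0"
        "\<And>j B. j \<in> {1..r} \<Longrightarrow> is_bohr_set B \<Longrightarrow> \<not> B \<subseteq> diffset (A j) (A j) + of_gint (t j) *o A j"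
        unfolding bchoice_iff by blast
      let ?A = "\<lambda>j. {z. of_gint z \<in> A j}"
      have "finite (t ` {1..r})" "0 \<notin> t ` {1..r}" using t(1) by auto
      from colour_case[OF one_neq_zero this, of r] obtain k \<eta> where k: "\<eta> > 0"
        "\<forall>A. (\<Union>j\<in>{1..r}. A j) = UNIV \<longrightarrow> (\<exists>j\<in>{1..r}. \<forall>s\<in>t ` {1..r}. \<exists>\<^sub>F N in sequentially.
          bohr_up_to k \<eta> {1 * x + (- 1) * y + s * z |x y z. x \<in> A j \<and> y \<in> A j \<and> z \<in> A j} N)"
        by (elim exE conjE) (rule that)
      from k(2)[THEN spec, THEN mp, OF cover_gint[OF A]]
      obtain j where j: "j \<in> {1..r}" "\<exists>\<^sub>F N in sequentially.
          bohr_up_to k \<eta> {1 * x + (- 1) * y + t j * z |x y z. x \<in> ?A j \<and> y \<in> ?A j \<and> z \<in> ?A j} N"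
        by blast
      from bohr_set_of_bohr_up_to[OF j(2)] obtain B where "is_bohr_set_with k \<eta> B"
        "B \<subseteq> diffset (of_gint 1 *o A j) (of_gint 1 *o A j) + of_gint (t j) *o A j"
        using order_trans[OF _ sub[of 1 "t j" "A j"]] by blast
      moreover have "of_gint 1 *o A j = A j" by (simp add: elt_set_times_def)
      ultimately show False using t(2)[OF j(1)] k(1) unfolding is_bohr_set_def by auto
    qed
  }
qed

end
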